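(* Let $n\geq3$ and let $\Gamma_n=\langle\phi_1,\dots,\phi_n\rangle$ be the group generated by the flips. It has presentation $$\langle \phi_1,\dots,\phi_n \mid \phi_i^2=1,\quad \phi_i\phi_j=\phi_j\phi_i\ \text{ if } |i-j|\geq2,\quad \phi_i\phi_{i+1}\phi_i=\phi_{i+1}\phi_i\phi_{i+1}\rangle,$$ where the indices (and the distance $|i-j|$) are understood modulo $n$. (This group is the affine symmetric group.)
   Context: Let $F$ be a field, $\mathbb{P}^1=\mathbb{P}^1(F)$, $\mathrm{PGL}_2=\mathrm{GL}_2(F)/F^*$, $\mathbb{G}_m=F^*$. For four points of $\mathbb{P}^1$, $[a,b,c,d]=\frac{a-c}{a-d}\cdot\frac{b-d}{b-c}$. A (twisted) $n$-gon in $\mathbb{P}^1$ is $P=((p_i)_{i\in\mathbb{Z}},M)$ with monodromy $M\in\mathrm{PGL}_2$, $p_{i+n}=Mp_i$, with $p_i,p_{i+1},p_{i+2}$ pairwise distinct for all $i$. It is enriched with an $n$-periodic discrete curvature $\mu=(\mu_i)_{i\in\mathbb{Z}}$, $\mu_i\in\mathbb{G}_m$. For $\alpha,\beta\in\mathbb{G}_m$ and distinct points $b,d\in\mathbb{P}^1$, let $h^{\alpha/\beta}_{b,d}$ be the projective transformation of $\mathbb{P}^1$ sending $a$ to the point $c$ with $[a,c,b,d]=\alpha/\beta$, i.e. $h^{\alpha/\beta}_{b,d}(z)=\frac{(\beta d-\alpha b)z-(\beta-\alpha)bd}{(\beta-\alpha)z-(\beta b-\alpha d)}$. For $j\in\mathbb{Z}/n\mathbb{Z}$,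 the flip at index $j$ is the (birational) map $\phi_j:(P,\mu)\mapsto(\tilde P,\tilde\mu)$, where $\tilde P$ has the same monodromy as $P$ and: $\tilde p_i=h^{\mu_i/\mu_{i-1}}_{p_{i+1},p_{i-1}}(p_i)$ for $i\in n\mathbb{Z}+j$; $\tilde p_i=p_i$ for $i\notin n\mathbb{Z}+j$; $\tilde\mu_{i-1}=\mu_i$ and $\tilde\mu_i=\mu_{i-1}$ for $i\in n\mathbb{Z}+j$; $\tilde\mu_i=\mu_i$ for $i\notin(n\mathbb{Z}+j-1)\cup(n\mathbb{Z}+j)$. $\Gamma_n$ is the group generated by $\phi_1,\dots,\phi_n$ under composition. *)

theory Defs
  imports "HOL-Analysis.Analysis" "HOL-Algebra.Generated_Groups"
begin

section \<open>The projective line and its transformations\<close>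

definition prop_vec :: "'a::field ^ 2 \<Rightarrow> 'a ^ 2 \<Rightarrow> bool" where
  "prop_vec v w \<longleftrightarrow> v \<noteq> 0 \<and> w \<noteq> 0 \<and> (\<exists>c. c \<noteq> 0 \<and> w = c *s v)"

definition prop_mat :: "'a::field ^ 2 ^ 2 \<Rightarrow> 'a ^ 2 ^ 2 \<Rightarrow> bool" where
  "prop_mat A B \<longleftrightarrow> det A \<noteq> 0 \<and> det B \<noteq> 0 \<and> (\<exists>c. c \<noteq> 0 \<and> B = (\<chi> i j. c * A $ i $ j))"

quotient_type (overloaded) 'a proj_line = "'a::field ^ 2" / partial: prop_vec
proof (rule part_equivpI)
  show "\<exists>x::'a^2. prop_vec x x"
    by (rule exI[of _ "vector [1, 1]"]) (auto simp: prop_vec_def vec_eq_iff forall_2 intro: exI[of _ 1])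
  show "symp (prop_vec :: 'a^2 \<Rightarrow> _)"
  proof (rule sympI)
    fix v w :: "'a^2"
    assume "prop_vec v w"
    then obtain c where c: "v \<noteq> 0" "w \<noteq> 0" "c \<noteq> 0" "w = c *s v"
      by (auto simp: prop_vec_def)
    then have "v = inverse c *s w" by (simp add: vec_eq_iff)
    with c show "prop_vec w v"
      unfolding prop_vec_def by (metis inverse_nonzero_iff_nonzero)
  qed
  show "transp (prop_vec :: 'a^2 \<Rightarrow> _)"
  proof (rule transpI)
    fix u v w :: "'a^2"
    assume "prop_vec u v" "prop_vec v w"
    then obtain c d where "u \<noteq> 0" "w \<noteq> 0" "c \<noteq> 0" "d \<noteq> 0" "v = c *s u" "w = d *s v"
      by (auto simp: prop_vec_def)
    then show "prop_vec u w"
      unfolding prop_vec_def by (auto intro!: exI[of _ "d * c"])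
  qed
qed

quotient_type (overloaded) 'a pgl2 = "'a::field ^ 2 ^ 2" / partial: prop_mat
proof (rule part_equivpI)
  show "\<exists>x::'a^2^2. prop_mat x x"
    by (rule exI[of _ "mat 1"]) (auto simp: prop_mat_def vec_eq_iff intro: exI[of _ 1])
  show "symp (prop_mat :: 'a^2^2 \<Rightarrow> _)"
  proof (rule sympI)
    fix A B :: "'a^2^2"
    assume "prop_mat A B"
    then obtain c where c: "det A \<noteq> 0" "det B \<noteq> 0" "c \<noteq> 0" "B = (\<chi> i j. c * A $ i $ j)"
      by (auto simp: prop_mat_def)
    then have "A = (\<chi> i j. inverse c * B $ i $ j)" by (simp add: vec_eq_iff)
    with c show "prop_mat B A"
      unfolding prop_mat_def by (metis inverse_nonzero_iff_nonzero)
  qed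
  show "transp (prop_mat :: 'a^2^2 \<Rightarrow> _)"
  proof (rule transpI)
    fix A B C :: "'a^2^2"
    assume "prop_mat A B" "prop_mat B C"
    then obtain c d where "det A \<noteq> 0" "det C \<noteq> 0" "c \<noteq> 0" "d \<noteq> 0"
      "B = (\<chi> i j. c * A $ i $ j)" "C = (\<chi> i j. d * B $ i $ j)"
      by (auto simp: prop_mat_def)
    moreover from this have "C = (\<chi> i j. (d * c) * A $ i $ j)"
      by (simp add: vec_eq_iff mult.assoc)
    ultimately show "prop_mat A C"
      unfolding prop_mat_def by (metis mult_eq_0_iff)
  qed
qed

lift_definition pgl_act :: "'a::field pgl2 \<Rightarrow> 'a proj_line \<Rightarrow> 'a proj_line"
  is "\<lambda>A v. A *v v"
proof -
  fix A B :: "'a^2^2" and v w :: "'a^2"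
  assume "prop_mat A B" "prop_vec v w"
  then obtain c d where h: "det A \<noteq> 0" "det B \<noteq> 0" "c \<noteq> 0" "B = (\<chi> i j. c * A $ i $ j)"
    "v \<noteq> 0" "w \<noteq> 0" "d \<noteq> 0" "w = d *s v"
    by (auto simp: prop_mat_def prop_vec_def)
  have nz: "M *v x \<noteq> 0" if "det M \<noteq> 0" "x \<noteq> 0" for M :: "'a^2^2" and x
  proof -
    from that(1) have "invertible M" by (simp add: invertible_det_nz)
    then obtain N where "N ** M = mat 1" by (auto simp: invertible_def)
    then show ?thesis using that(2)
      by (metis matrix_vector_mul_assoc matrix_vector_mul_lid matrix_vector_mult_0_right)
  qed
  have "B *v w = (c * d) *s (A *v v)"
    by (simp add: h vec_eq_iff matrix_vector_mult_def sum_distrib_left mult_ac)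
  then show "prop_vec (A *v v) (B *v w)"
    unfolding prop_vec_def using nz h by (metis mult_eq_0_iff)
qed

text \<open>The affine coordinate \<open>z\<close> of the point \<open>[z : 1]\<close>; meaningless at infinity.\<close>

lift_definition at_infinity :: "'a::field proj_line \<Rightarrow> bool" is "\<lambda>v. v $ 2 = 0"
  by (auto simp: prop_vec_def)

lift_definition affine_coord :: "'a::field proj_line \<Rightarrow> 'a" is "\<lambda>v. v $ 1 / v $ 2"
  by (auto simp: prop_vec_def)

text \<open>Similarly \<open>PGL\<^sub>2\<close> is covered up to a hypersurface by the chart in which the lower right
  entry is normalized to 1.\<close>

lift_definition pgl_at_infinity :: "'a::field pgl2 \<Rightarrow> bool" is "\<lambda>A. A $ 2 $ 2 = 0"
  by (auto simp: prop_mat_def)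

lift_definition pgl_coord :: "2 \<Rightarrow> 2 \<Rightarrow> 'a::field pgl2 \<Rightarrow> 'a" is "\<lambda>i j A. A $ i $ j / A $ 2 $ 2"
  by (auto simp: prop_mat_def)

definition det2 :: "'a::field ^ 2 \<Rightarrow> 'a ^ 2 \<Rightarrow> 'a" where
  "det2 v w = v $ 1 * w $ 2 - v $ 2 * w $ 1"

lemma det2_scale: "det2 (c *s v) (d *s w) = c * d * det2 v w"
  by (simp add: det2_def algebra_simps)

text \<open>In homogeneous coordinates each difference \<open>a - c\<close> of the cross-ratio becomes a
  determinant.\<close>

lift_definition cross_ratio ::
    "'a::field proj_line \<Rightarrow> 'a proj_line \<Rightarrow> 'a proj_line \<Rightarrow> 'a proj_line \<Rightarrow> 'a"
  is "\<lambda>a b c d. (det2 a c / det2 a d) * (det2 b d / det2 b c)"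
  by (auto simp: prop_vec_def det2_scale)

text \<open>The map \<open>h\<close> of ratio \<open>\<alpha>/\<beta>\<close> fixing \<open>b\<close> and \<open>d\<close>: the matrix
  of \<open>z \<mapsto> ((\<beta> d - \<alpha> b) z - (\<beta> - \<alpha>) b d) / ((\<beta> - \<alpha>) z - (\<beta> b - \<alpha> d))\<close>, homogenized
  in \<open>b\<close> and \<open>d\<close>. Its determinant is \<open>\<alpha> * \<beta> * (det2 b d)\<^sup>2\<close>; the map is only used for nonzero
  \<open>\<alpha>\<close>, \<open>\<beta>\<close> and distinct \<open>b\<close>, \<open>d\<close>, and is set to the identity otherwise.\<close>

definition hmat :: "'a::field \<Rightarrow> 'a \<Rightarrow> 'a ^ 2 \<Rightarrow> 'a ^ 2 \<Rightarrow> 'a ^ 2 ^ 2" where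
  "hmat \<alpha> \<beta> b d =
     vector [vector [\<beta> * d$1 * b$2 - \<alpha> * b$1 * d$2, - ((\<beta> - \<alpha>) * b$1 * d$1)],
             vector [(\<beta> - \<alpha>) * b$2 * d$2, - (\<beta> * b$1 * d$2 - \<alpha> * d$1 * b$2)]]"

lemma det_hmat: "det (hmat \<alpha> \<beta> b d) = \<alpha> * \<beta> * (det2 b d)\<^sup>2"
  by (simp add: hmat_def det_2 det2_def power2_eq_square algebra_simps)

lift_definition hmap :: "'a::field \<Rightarrow> 'a \<Rightarrow> 'a proj_line \<Rightarrow> 'a proj_line \<Rightarrow> 'a pgl2"
  is "\<lambda>\<alpha> \<beta> b d. if \<alpha> = 0 \<or> \<beta> = 0 \<or> det2 b d = 0 then mat 1 else hmat \<alpha> \<beta> b d"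
proof -
  fix \<alpha> \<beta> :: 'a and b b' d d' :: "'a^2"
  assume "prop_vec b b'" "prop_vec d d'"
  then obtain x y where h: "x \<noteq> 0" "y \<noteq> 0" "b' = x *s b" "d' = y *s d"
    by (auto simp: prop_vec_def)
  have "hmat \<alpha> \<beta> b' d' = (\<chi> i j. (x * y) * hmat \<alpha> \<beta> b d $ i $ j)"
    by (simp add: h hmat_def vec_eq_iff forall_2 algebra_simps)
  moreover have "prop_mat (mat 1 :: 'a^2^2) (mat 1)"
    unfolding prop_mat_def by (auto simp: vec_eq_iff intro!: exI[of _ 1])
  moreover have "(\<chi> i j. (x * y) * hmat \<alpha> \<beta> b d $ i $ j) = hmat \<alpha> \<beta> b' d'"
    using calculation by simp
  ultimately show "prop_mat (if \<alpha> = 0 \<or> \<beta> = 0 \<or> det2 b d = 0 then mat 1 else hmat \<alpha> \<beta> b d)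
     (if \<alpha> = 0 \<or> \<beta> = 0 \<or> det2 b' d' = 0 then mat 1 else hmat \<alpha> \<beta> b' d')"
    using h unfolding prop_mat_def
    by (auto simp: det_hmat det2_scale intro!: exI[of _ "x * y"])
qed

lemma cross_ratio_hmap:
  assumes "\<alpha> \<noteq> 0" "\<beta> \<noteq> 0" "b \<noteq> d" "a \<noteq> b" "a \<noteq> d"
  shows "cross_ratio a (pgl_act (hmap \<alpha> \<beta> b d) a) b d = \<alpha> / \<beta>"
  using assms
proof transfer
  fix \<alpha> \<beta> :: 'a and b d a :: "'a^2"
  assume h: "\<alpha> \<noteq> 0" "\<beta> \<noteq> 0" "prop_vec b b" "prop_vec d d" "prop_vec a a"
    "\<not> prop_vec b d" "\<not> prop_vec a b" "\<not> prop_vec a d"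
  have nz: "det2 v w \<noteq> 0" if "v \<noteq> 0" "w \<noteq> 0" "\<not> prop_vec v w" for v w :: "'a^2"
  proof
    assume z: "det2 v w = 0"
    from that(1) obtain i where i: "v $ i \<noteq> 0" by (auto simp: vec_eq_iff)
    have e: "v $ i * w $ j = w $ i * v $ j" for j
      using z exhaust_2[of i] exhaust_2[of j] by (auto simp: det2_def algebra_simps)
    then have w: "w = (w $ i / v $ i) *s v" using i by (simp add: vec_eq_iff field_simps)
    moreover have "w $ i / v $ i \<noteq> 0" using w that(2) by (metis vector_smult_lzero)
    ultimately show False using that unfolding prop_vec_def by blast
  qed
  have n: "det2 b d \<noteq> 0" "det2 a b \<noteq> 0" "det2 a d \<noteq> 0"
    using h nz by (auto simp: prop_vec_def)
  have e: "det2 (hmat \<alpha> \<beta> b d *v a) d = \<alpha> * det2 a d * (- det2 b d)"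
    "det2 (hmat \<alpha> \<beta> b d *v a) b = \<beta> * det2 a b * (- det2 b d)"
    by (simp_all add: det2_def hmat_def matrix_vector_mult_def sum_2 algebra_simps)
  show "det2 a b / det2 a d *
    (det2 ((if \<alpha> = 0 \<or> \<beta> = 0 \<or> det2 b d = 0 then mat 1 else hmat \<alpha> \<beta> b d) *v a) d /
     det2 ((if \<alpha> = 0 \<or> \<beta> = 0 \<or> det2 b d = 0 then mat 1 else hmat \<alpha> \<beta> b d) *v a) b) = \<alpha> / \<beta>"
    using h(1,2) n by (simp add: e field_simps)
qed


section \<open>Enriched twisted polygons and flips\<close>

record (overloaded) ('k::field) polygon =
  vertex :: "int \<Rightarrow> 'k proj_line"
  monodromy :: "'k pgl2"
  curvature :: "int \<Rightarrow> 'k"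

definition ngons :: "nat \<Rightarrow> 'k::field polygon set" where
  "ngons n = {P.
     (\<forall>i. vertex P (i + int n) = pgl_act (monodromy P) (vertex P i)) \<and>
     (\<forall>i. vertex P i \<noteq> vertex P (i + 1) \<and> vertex P (i + 1) \<noteq> vertex P (i + 2) \<and>
          vertex P i \<noteq> vertex P (i + 2)) \<and>
     (\<forall>i. curvature P i \<noteq> 0 \<and> curvature P (i + int n) = curvature P i)}"

text \<open>A total function: the flip, as a partial map, is undefined where the result is not an \<open>n\<close>-gon.
  This happens only off a dense open set and is invisible to the germs used below.\<close>

definition flip :: "nat \<Rightarrow> int \<Rightarrow> 'k::field polygon \<Rightarrow> 'k polygon" where
  "flip n j P = P\<lparr>
     vertex := (\<lambda>i. if i mod int n = j mod int n
       then pgl_act (hmap (curvature P i) (curvature P (i - 1)) (vertex P (i + 1)) (vertex P (i - 1)))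
              (vertex P i)
       else vertex P i),
     curvature := (\<lambda>i. if i mod int n = (j - 1) mod int n then curvature P (i + 1)
       else if i mod int n = j mod int n then curvature P (i - 1)
       else curvature P i)\<rparr>"


section \<open>Birational maps of the space of polygons\<close>

text \<open>The \<open>n\<close>-gons form an irreducible rational variety of dimension \<open>2 n + 3\<close> over the base
  field \<open>F\<close>. It is represented by its points over an infinite extension \<open>\<iota> : F \<rightarrow> K\<close> (one can
  take \<open>K = F\<close> when \<open>F\<close> is infinite, and an algebraic closure of \<open>F\<close> in any case); since \<open>K\<close> is
  infinite, these points are Zariski dense. For a finite field \<open>F\<close> there are only finitely
  many points over \<open>F\<close> itself, and they do not determine a birational map.\<close>

definition field_embedding :: "('f::field \<Rightarrow> 'k::field) \<Rightarrow> bool" where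
  "field_embedding \<iota> \<longleftrightarrow> \<iota> 1 = 1 \<and> (\<forall>x y. \<iota> (x + y) = \<iota> x + \<iota> y) \<and> (\<forall>x y. \<iota> (x * y) = \<iota> x * \<iota> y)"

definition chart :: "nat \<Rightarrow> 'k::field polygon set" where
  "chart n = {P \<in> ngons n. (\<forall>i\<in>{1..int n}. \<not> at_infinity (vertex P i)) \<and>
                           \<not> pgl_at_infinity (monodromy P)}"

definition coords :: "nat \<Rightarrow> ('k::field polygon \<Rightarrow> 'k) set" where
  "coords n =
     {\<lambda>P. affine_coord (vertex P i) |i. i \<in> {1..int n}} \<union>
     {\<lambda>P. curvature P i |i. i \<in> {1..int n}} \<union>
     {\<lambda>P. pgl_coord k l (monodromy P) |k l. (k, l) \<noteq> (2, 2)}"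

inductive_set poly_funs :: "('f::field \<Rightarrow> 'k::field) \<Rightarrow> nat \<Rightarrow> ('k polygon \<Rightarrow> 'k) set"
  for \<iota> n where
  const: "(\<lambda>P. \<iota> c) \<in> poly_funs \<iota> n"
| coord: "f \<in> coords n \<Longrightarrow> f \<in> poly_funs \<iota> n"
| add: "f \<in> poly_funs \<iota> n \<Longrightarrow> g \<in> poly_funs \<iota> n \<Longrightarrow> (\<lambda>P. f P + g P) \<in> poly_funs \<iota> n"
| mult: "f \<in> poly_funs \<iota> n \<Longrightarrow> g \<in> poly_funs \<iota> n \<Longrightarrow> (\<lambda>P. f P * g P) \<in> poly_funs \<iota> n"

text \<open>The filter of all sets containing a nonempty Zariski open set of \<open>n\<close>-gons. By irreducibility
  every nonempty open set contains a nonempty principal open subset of the chart, and these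
  principal open sets are closed under finite intersections.\<close>

definition generic :: "('f::field \<Rightarrow> 'k::field) \<Rightarrow> nat \<Rightarrow> 'k polygon filter" where
  "generic \<iota> n = (INF q \<in> {q \<in> poly_funs \<iota> n. \<exists>P\<in>chart n. q P \<noteq> 0}.
                    principal {P \<in> chart n. q P \<noteq> 0})"

definition rational_map ::
    "('f::field \<Rightarrow> 'k::field) \<Rightarrow> nat \<Rightarrow> ('k polygon \<Rightarrow> 'k polygon) \<Rightarrow> bool" where
  "rational_map \<iota> n f \<longleftrightarrow>
     (\<forall>c \<in> coords n. \<exists>num \<in> poly_funs \<iota> n. \<exists>den \<in> poly_funs \<iota> n.
        \<forall>\<^sub>F P in generic \<iota> n. den P \<noteq> 0 \<and> c (f P) = num P / den P)"

text \<open>The \<open>filterlim\<close> condition says that \<open>f\<close> sends a generic \<open>n\<close>-gon to an \<open>n\<close>-gon and that the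
  preimage of a nonempty open set contains a nonempty open set, i.e. that \<open>f\<close> is dominant.\<close>

definition dominant_map ::
    "('f::field \<Rightarrow> 'k::field) \<Rightarrow> nat \<Rightarrow> ('k polygon \<Rightarrow> 'k polygon) \<Rightarrow> bool" where
  "dominant_map \<iota> n f \<longleftrightarrow> rational_map \<iota> n f \<and> filterlim f (generic \<iota> n) (generic \<iota> n)"

definition birational_map ::
    "('f::field \<Rightarrow> 'k::field) \<Rightarrow> nat \<Rightarrow> ('k polygon \<Rightarrow> 'k polygon) \<Rightarrow> bool" where
  "birational_map \<iota> n f \<longleftrightarrow> dominant_map \<iota> n f \<and>
     (\<exists>g. dominant_map \<iota> n g \<and>
        (\<forall>\<^sub>F P in generic \<iota> n. g (f P) = P) \<and> (\<forall>\<^sub>F P in generic \<iota> n. f (g P) = P))"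

definition germ ::
    "('f::field \<Rightarrow> 'k::field) \<Rightarrow> nat \<Rightarrow> ('k polygon \<Rightarrow> 'k polygon) \<Rightarrow> ('k polygon \<Rightarrow> 'k polygon) set" where
  "germ \<iota> n f = {g. \<forall>\<^sub>F P in generic \<iota> n. g P = f P}"

text \<open>Birational self-maps, two of them being identified if they agree on a nonempty open set. The
  product of two classes is the class of the composition of representatives.\<close>

definition birational_group ::
    "('f::field \<Rightarrow> 'k::field) \<Rightarrow> nat \<Rightarrow> ('k polygon \<Rightarrow> 'k polygon) set monoid" where
  "birational_group \<iota> n =
     \<lparr>carrier = germ \<iota> n ` {f. birational_map \<iota> n f},
      mult = (\<lambda>A B. {h. \<exists>f\<in>A. \<exists>g\<in>B. \<forall>\<^sub>F P in generic \<iota> n. h P = (f \<circ> g) P}),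
      one = germ \<iota> n id\<rparr>"

definition flip_group ::
    "('f::field \<Rightarrow> 'k::field) \<Rightarrow> nat \<Rightarrow> ('k polygon \<Rightarrow> 'k polygon) set monoid" where
  "flip_group \<iota> n =
     subgroup_generated (birational_group \<iota> n) ((\<lambda>j. germ \<iota> n (flip n j)) ` {1..int n})"


section \<open>Group presentations\<close>

text \<open>A letter \<open>(g, True)\<close> stands for the generator \<open>g\<close> and \<open>(g, False)\<close> for its inverse; a
  relation \<open>u = v\<close> is given by the pair \<open>(u, v)\<close>.\<close>

type_synonym 'g word = "('g \<times> bool) list"

inductive word_equiv :: "'g set \<Rightarrow> ('g word \<times> 'g word) set \<Rightarrow> 'g word \<Rightarrow> 'g word \<Rightarrow> bool"
  for S R where
  refl: "word_equiv S R u u"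
| sym: "word_equiv S R u v \<Longrightarrow> word_equiv S R v u"
| trans: "word_equiv S R u v \<Longrightarrow> word_equiv S R v w \<Longrightarrow> word_equiv S R u w"
| cancel: "g \<in> S \<Longrightarrow> word_equiv S R (u @ [(g, b), (g, \<not> b)] @ v) (u @ v)"
| relation: "(r, r') \<in> R \<Longrightarrow> word_equiv S R (u @ r @ v) (u @ r' @ v)"

definition word_class :: "'g set \<Rightarrow> ('g word \<times> 'g word) set \<Rightarrow> 'g word \<Rightarrow> 'g word set" where
  "word_class S R u = {v \<in> lists (S \<times> UNIV). word_equiv S R u v}"

definition presented_group :: "'g set \<Rightarrow> ('g word \<times> 'g word) set \<Rightarrow> 'g word set monoid" where
  "presented_group S R =
     \<lparr>carrier = word_class S R ` lists (S \<times> UNIV),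
      mult = (\<lambda>A B. {w. \<exists>u\<in>A. \<exists>v\<in>B. w \<in> word_class S R (u @ v)}),
      one = word_class S R []\<rparr>"

text \<open>The group \<open>G\<close> has the presentation \<open>\<langle>S | R\<rangle>\<close>, with the generator \<open>s\<close> interpreted
  as \<open>x s\<close>.\<close>

definition has_presentation ::
    "('a, 'b) monoid_scheme \<Rightarrow> ('g \<Rightarrow> 'a) \<Rightarrow> 'g set \<Rightarrow> ('g word \<times> 'g word) set \<Rightarrow> bool" where
  "has_presentation G x S R \<longleftrightarrow>
     (\<exists>f \<in> iso (presented_group S R) G. \<forall>s\<in>S. f (word_class S R [(s, True)]) = x s)"

definition cyclic_dist :: "nat \<Rightarrow> int \<Rightarrow> int \<Rightarrow> int" where
  "cyclic_dist n i j = min ((i - j) mod int n) ((j - i) mod int n)"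

definition flip_relations :: "nat \<Rightarrow> (int word \<times> int word) set" where
  "flip_relations n =
     {([(i, True), (i, True)], []) |i. i \<in> {1..int n}} \<union>
     {([(i, True), (j, True)], [(j, True), (i, True)]) |i j.
        i \<in> {1..int n} \<and> j \<in> {1..int n} \<and> cyclic_dist n i j \<ge> 2} \<union>
     {([(i, True), (j, True), (i, True)], [(j, True), (i, True), (j, True)]) |i j.
        i \<in> {1..int n} \<and> j \<in> {1..int n} \<and> j mod int n = (i + 1) mod int n}"

definition affine_symmetric_group :: "nat \<Rightarrow> (int \<Rightarrow> int) monoid" where
  "affine_symmetric_group n =
     \<lparr>carrier = {\<sigma>. bij \<sigma> \<and> (\<forall>i. \<sigma> (i + int n) = \<sigma> i + int n) \<and>
                    (\<Sum>i\<in>{1..int n}. \<sigma> i) = (\<Sum>i\<in>{1..int n}. i)},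
      mult = (\<circ>), one = id\<rparr>"

end

theory Submission
  imports Defs "HOL-Computational_Algebra.Polynomial"
begin

text \<open>
  A word in the flips is compared with the word in the adjacent swaps \<open>s\<^sub>j\<close> of the integers (\<open>s\<^sub>j\<close>
  exchanges \<open>i - 1\<close> and \<open>i\<close> for every \<open>i \<equiv> j\<close> modulo \<open>n\<close>) that has the same letters. For two words \<open>u\<close>
  and \<open>v\<close> three statements turn out to be equivalent: the relations transform \<open>u\<close> into \<open>v\<close>; the
  compositions of flips have the same germ; the products of swaps are the same permutation. Both
  parts of the theorem follow, because flips generate the flip group and adjacent swaps generate the
  affine symmetric group.

  Relations imply equality of germs (\<open>flip_word_invariant\<close>). That a flip is an involution and that
  distant flips commute is immediate. For the braid relation only the four points
  \<open>p\<^sub>i\<^sub>-\<^sub>1, \<dots>, p\<^sub>i\<^sub>+\<^sub>2\<close> matter; when they are written in the basis given by \<open>p\<^sub>i\<close> and \<open>p\<^sub>i\<^sub>+\<^sub>1\<close> it becomes a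
  small polynomial identity (\<open>hmap_braid\<close>). It is valid as long as the intermediate polygons are
  nondegenerate, and this holds generically because flips are dominant (\<open>filterlim_flip\<close>).

  Equality of germs implies equality of permutations (\<open>flip_word_faithful\<close>). The action on the
  curvature only sees permutations modulo \<open>n\<close>, so that the vertices have to be used. In a polygon
  with \<open>p\<^sub>i \<sim> z\<^sub>i t\<^bsup>i+1\<^esup>\<close> as \<open>t \<rightarrow> 0\<close>, consecutive vertices have different orders of magnitude: from \<open>p\<^sub>i\<close>
  the points \<open>p\<^sub>i\<^sub>+\<^sub>1\<close> and \<open>p\<^sub>i\<^sub>-\<^sub>1\<close> look like \<open>0\<close> and \<open>\<infinity>\<close>, and the flip at \<open>i\<close> simply multiplies \<open>z\<^sub>i\<close> by
  \<open>\<mu>\<^sub>i\<^sub>-\<^sub>1 / \<mu>\<^sub>i\<close> to leading order. Let the curvature be \<open>s\<close> at the indices congruent to \<open>x\<close> and \<open>1\<close>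
  elsewhere, and let \<open>z\<^sub>i = s\<^bsup>e\<^esup>\<close> where \<open>e\<close> is the floor of \<open>(x - i) / n\<close>. Then the flip at \<open>j\<close> changes the
  leading terms exactly as if \<open>x\<close> were replaced by \<open>s\<^sub>j x\<close> (\<open>scaled_family_flip\<close>). So a word that
  acts trivially satisfies \<open>s\<^bsup>a\<^esup> = s\<^bsup>b\<^esup>\<close> for all nonzero \<open>s\<close>, where \<open>a\<close> and \<open>b\<close> are the floors of
  \<open>(\<sigma> x - i) / n\<close> and of \<open>(x - i) / n\<close> and \<open>\<sigma>\<close> is its permutation. If \<open>a \<noteq> b\<close>, an infinite field
  contains an \<open>s\<close> that violates this equation, so \<open>a = b\<close> for every \<open>i\<close> and hence \<open>\<sigma> x = x\<close>. As
  everything is multiplicative, the argument works in every characteristic. Germs only see a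
  nonempty Zariski open set, but an asymptotic family can be led at \<open>t = 1\<close> through any point of
  it without a change of the leading terms at \<open>0\<close>, and then it stays in the set for almost all \<open>t\<close>.

  Equality of permutations implies equivalence of words (\<open>flip_equiv_of_word_perm_eq\<close>). This is the
  fact that the Coxeter group acts faithfully on its roots: if appending \<open>s\<^sub>j\<close> to a word keeps it
  reduced, then the permutation of the word is increasing from \<open>j - 1\<close> to \<open>j\<close>
  (\<open>word_perm_ascent_of_reduced\<close>), and a nonempty reduced word cannot give the identity.
\<close>

section \<open>Actions of words\<close>

text \<open>The sign of a letter is ignored: words are only applied to involutions.\<close>

definition word_map :: "('g \<Rightarrow> 'x \<Rightarrow> 'x) \<Rightarrow> 'g word \<Rightarrow> 'x \<Rightarrow> 'x" where
  "word_map \<phi> w = foldr (\<lambda>l f. \<phi> (fst l) \<circ> f) w id"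

lemma word_map_Nil [simp]: "word_map \<phi> [] = id"
  by (simp add: word_map_def)

lemma word_map_Cons [simp]: "word_map \<phi> (l # w) = \<phi> (fst l) \<circ> word_map \<phi> w"
  by (simp add: word_map_def)

lemma word_map_append: "word_map \<phi> (u @ v) = word_map \<phi> u \<circ> word_map \<phi> v"
  by (induction u) (auto simp: o_assoc)

lemma word_map_rev:
  assumes "\<And>g. \<phi> g \<circ> \<phi> g = id"
  shows "word_map \<phi> (rev u) \<circ> word_map \<phi> u = id"
proof (induction u)
  case (Cons l u)
  have "word_map \<phi> (rev (l # u)) \<circ> word_map \<phi> (l # u)
      = word_map \<phi> (rev u) \<circ> (\<phi> (fst l) \<circ> \<phi> (fst l)) \<circ> word_map \<phi> u"
    by (simp add: word_map_append o_assoc)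
  also have "\<dots> = id" using Cons by (simp only: assms comp_id)
  finally show ?case .
qed simp

text \<open>Two groups that are images of the same words are isomorphic as soon as the two evaluations
  identify the same words. This lemma gives both the presentation (\<open>G\<close> is the presented group)
  and the isomorphism with the affine symmetric group.\<close>

lemma iso_of_evaluations:
  fixes ev1 :: "'w list \<Rightarrow> 'a" and ev2 :: "'w list \<Rightarrow> 'b"
  assumes carr: "carrier G = ev1 ` lists L" "carrier H = ev2 ` lists L"
    and mult1: "\<And>u v. u \<in> lists L \<Longrightarrow> v \<in> lists L \<Longrightarrow> ev1 (u @ v) = mult G (ev1 u) (ev1 v)"
    and mult2: "\<And>u v. u \<in> lists L \<Longrightarrow> v \<in> lists L \<Longrightarrow> ev2 (u @ v) = mult H (ev2 u) (ev2 v)"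
    and ker: "\<And>u v. u \<in> lists L \<Longrightarrow> v \<in> lists L \<Longrightarrow> ev1 u = ev1 v \<longleftrightarrow> ev2 u = ev2 v"
  shows "\<exists>f \<in> iso G H. \<forall>u \<in> lists L. f (ev1 u) = ev2 u"
proof -
  define f where "f a = ev2 (SOME u. u \<in> lists L \<and> ev1 u = a)" for a
  have f: "f (ev1 u) = ev2 u" if "u \<in> lists L" for u
  proof -
    have "(SOME v. v \<in> lists L \<and> ev1 v = ev1 u) \<in> lists L
        \<and> ev1 (SOME v. v \<in> lists L \<and> ev1 v = ev1 u) = ev1 u"
      by (rule someI[of _ u]) (use that in simp)
    then show ?thesis unfolding f_def using ker that by blast
  qed
  have "f \<in> hom G H"
    unfolding hom_def
  proof (intro CollectI conjI ballI funcsetI)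
    fix a assume "a \<in> carrier G"
    then show "f a \<in> carrier H" using f carr by auto
  next
    fix a b assume "a \<in> carrier G" "b \<in> carrier G"
    then obtain u v where uv: "u \<in> lists L" "v \<in> lists L" "a = ev1 u" "b = ev1 v"
      using carr by auto
    then have "u @ v \<in> lists L" by simp
    with uv show "f (a \<otimes>\<^bsub>G\<^esub> b) = f a \<otimes>\<^bsub>H\<^esub> f b"
      by (metis f mult1 mult2)
  qed
  moreover have "bij_betw f (carrier G) (carrier H)"
    unfolding bij_betw_def inj_on_def carr using f ker by (auto simp: image_image)
  ultimately show ?thesis using f by (auto simp: iso_def)
qed

section \<open>Presented groups\<close>

lemma word_equiv_context:
  "word_equiv S R u v \<Longrightarrow> word_equiv S R (x @ u @ y) (x @ v @ y)"
proof (induction rule: word_equiv.induct)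
  case (refl u) show ?case by (rule word_equiv.refl)
next
  case (sym u v) then show ?case by (blast intro: word_equiv.sym)
next
  case (trans u v w) then show ?case by (blast intro: word_equiv.trans)
next
  case (cancel g u b v)
  then show ?case using word_equiv.cancel[of g S R "x @ u" b "v @ y"] by simp
next
  case (relation r r' u v)
  then show ?case using word_equiv.relation[of r r' R S "x @ u" "v @ y"] by simp
qed

lemma word_equiv_append:
  assumes "word_equiv S R u u'" "word_equiv S R v v'"
  shows "word_equiv S R (u @ v) (u' @ v')"
  using word_equiv_context[OF assms(1), of "[]" v] word_equiv_context[OF assms(2), of u' "[]"]
  by (auto intro: word_equiv.trans)

lemma word_class_eq_iff:
  assumes "u \<in> lists (S \<times> UNIV)" "v \<in> lists (S \<times> UNIV)"
  shows "word_class S R u = word_class S R v \<longleftrightarrow> word_equiv S R u v"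
  using assms unfolding word_class_def
  by (auto intro: word_equiv.refl word_equiv.sym word_equiv.trans)

lemma mult_presented_group:
  assumes "u \<in> lists (S \<times> UNIV)" "v \<in> lists (S \<times> UNIV)"
  shows "word_class S R u \<otimes>\<^bsub>presented_group S R\<^esub> word_class S R v = word_class S R (u @ v)"
proof (intro equalityI subsetI)
  fix w assume "w \<in> word_class S R u \<otimes>\<^bsub>presented_group S R\<^esub> word_class S R v"
  then obtain u' v' where "word_equiv S R u u'" "word_equiv S R v v'"
      "w \<in> lists (S \<times> UNIV)" "word_equiv S R (u' @ v') w"
    unfolding presented_group_def word_class_def by auto
  then show "w \<in> word_class S R (u @ v)"
    unfolding word_class_def by (blast intro: word_equiv.trans word_equiv_append)
next
  fix w assume "w \<in> word_class S R (u @ v)"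
  moreover have "u \<in> word_class S R u" "v \<in> word_class S R v"
    using assms by (auto simp: word_class_def word_equiv.refl)
  ultimately show "w \<in> word_class S R u \<otimes>\<^bsub>presented_group S R\<^esub> word_class S R v"
    unfolding presented_group_def by auto
qed

lemma has_presentationI:
  assumes carr: "carrier G = ev ` lists (S \<times> UNIV)"
    and mult: "\<And>u v. ev (u @ v) = mult G (ev u) (ev v)"
    and gen: "\<And>s. s \<in> S \<Longrightarrow> ev [(s, True)] = x s"
    and ker: "\<And>u v. u \<in> lists (S \<times> UNIV) \<Longrightarrow> v \<in> lists (S \<times> UNIV) \<Longrightarrow>
                ev u = ev v \<longleftrightarrow> word_equiv S R u v"
  shows "has_presentation G x S R"
proof -
  have "\<exists>f \<in> iso (presented_group S R) G. \<forall>u \<in> lists (S \<times> UNIV). f (word_class S R u) = ev u"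
    by (rule iso_of_evaluations)
      (simp_all only: carr mult ker word_class_eq_iff mult_presented_group,
       simp add: presented_group_def)
  then obtain f where "f \<in> iso (presented_group S R) G"
      and f: "\<And>u. u \<in> lists (S \<times> UNIV) \<Longrightarrow> f (word_class S R u) = ev u" by blast
  moreover have "f (word_class S R [(s, True)]) = x s" if "s \<in> S" for s
    using f[of "[(s, True)]"] gen that by simp
  ultimately show ?thesis unfolding has_presentation_def by blast
qed

section \<open>Affine permutations\<close>

definition adj_swap :: "nat \<Rightarrow> int \<Rightarrow> int \<Rightarrow> int" where
  "adj_swap n j i = (if i mod int n = (j - 1) mod int n then i + 1
                     else if i mod int n = j mod int n then i - 1 else i)"

lemma mod_eq_shift: "(i + c) mod m = (j + c) mod m \<longleftrightarrow> i mod m = j mod (m::int)"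
  by (simp add: mod_eq_dvd_iff)

lemma pred_mod_neq:
  assumes "n \<ge> 2" shows "(j - 1) mod int n \<noteq> j mod int n"
proof
  assume "(j - 1) mod int n = j mod int n"
  then have "int n dvd 1" by (simp add: mod_eq_dvd_iff)
  with assms show False by simp
qed

text \<open>Indices that are congruent modulo \<open>n\<close> stay incongruent after shifts by different amounts less
  than \<open>n\<close> apart. This is where \<open>n \<ge> 3\<close> separates the neighbours of an index from each other.\<close>

lemma mod_neq_shift:
  assumes "i mod int n = j mod int n" "\<bar>c - d\<bar> < int n" "c \<noteq> d"
  shows "(i + c) mod int n \<noteq> (j + d) mod int n"
proof
  assume "(i + c) mod int n = (j + d) mod int n"
  then have "int n dvd (i + c - (j + d))" by (simp add: mod_eq_dvd_iff)
  moreover have "int n dvd i - j" using assms(1) by (simp add: mod_eq_dvd_iff)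
  ultimately have "int n dvd (i + c - (j + d)) - (i - j)" by (rule dvd_diff)
  then have "int n dvd (c - d)" by simp
  with assms(2,3) show False
    by (metis abs_of_nat dvd_imp_le_int eq_iff_diff_eq_0 not_less)
qed

lemma adj_swap_simps:
  assumes "n \<ge> 2"
  shows "i mod int n = j mod int n \<Longrightarrow> adj_swap n j i = i - 1"
    and "i mod int n = j mod int n \<Longrightarrow> adj_swap n j (i - 1) = i"
    and "i mod int n \<noteq> j mod int n \<Longrightarrow> i mod int n \<noteq> (j - 1) mod int n \<Longrightarrow> adj_swap n j i = i"
  using pred_mod_neq[OF assms, of j] mod_eq_shift[of "i" "-1" "int n" j]
  by (simp_all add: adj_swap_def)

lemma adj_swap_involution:
  assumes "n \<ge> 2" shows "adj_swap n j \<circ> adj_swap n j = id"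
proof
  fix i
  consider "i mod int n = j mod int n" | "(i + 1) mod int n = j mod int n"
    | "i mod int n \<noteq> j mod int n" "i mod int n \<noteq> (j - 1) mod int n"
    using mod_eq_shift[of i 1 "int n" "j - 1"] by auto
  then show "(adj_swap n j \<circ> adj_swap n j) i = id i"
  proof cases
    case 1 then show ?thesis using assms by (simp add: adj_swap_simps)
  next
    case 2
    then show ?thesis using adj_swap_simps(1,2)[OF assms 2] by simp
  next
    case 3 then show ?thesis using assms by (simp add: adj_swap_simps)
  qed
qed

text \<open>Everything that two cyclically adjacent swaps do happens on the triples \<open>y - 1, y, y + 1\<close>.\<close>

lemma adj_swap_neighbours:
  assumes n: "n \<ge> 3" and t: "y mod int n = t mod int n" and j: "j mod int n = (t + 1) mod int n"
  shows "adj_swap n t (y - 1) = y" "adj_swap n t y = y - 1" "adj_swap n t (y + 1) = y + 1"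
    "adj_swap n j (y - 1) = y - 1" "adj_swap n j y = y + 1" "adj_swap n j (y + 1) = y"
proof -
  have y: "(y + 1) mod int n = j mod int n" using t j by (simp add: mod_eq_shift)
  show "adj_swap n t (y - 1) = y" "adj_swap n t y = y - 1"
    using n t by (simp_all add: adj_swap_simps)
  show "adj_swap n j y = y + 1" "adj_swap n j (y + 1) = y"
    using adj_swap_simps(1,2)[OF _ y] n by simp_all
  have "(y + 1) mod int n \<noteq> (t + 0) mod int n" "(y + 1) mod int n \<noteq> (t + - 1) mod int n"
    using mod_neq_shift[OF t, of 1 0] mod_neq_shift[OF t, of 1 "-1"] n by simp_all
  then show "adj_swap n t (y + 1) = y + 1" using n by (simp add: adj_swap_simps)
  have "(y + 1 + - 2) mod int n \<noteq> (j + 0) mod int n"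
      "(y + 1 + - 2) mod int n \<noteq> (j + - 1) mod int n"
    using mod_neq_shift[OF y, of "-2" 0] mod_neq_shift[OF y, of "-2" "-1"] n by simp_all
  then show "adj_swap n j (y - 1) = y - 1" using n by (simp add: adj_swap_simps)
qed

lemma adj_swap_braid:
  assumes n: "n \<ge> 3" and j: "j mod int n = (t + 1) mod int n"
  shows "adj_swap n t \<circ> adj_swap n j \<circ> adj_swap n t = adj_swap n j \<circ> adj_swap n t \<circ> adj_swap n j"
proof
  fix x
  show "(adj_swap n t \<circ> adj_swap n j \<circ> adj_swap n t) x = (adj_swap n j \<circ> adj_swap n t \<circ> adj_swap n j) x"
  proof (cases "\<exists>y. y mod int n = t mod int n \<and> x \<in> {y - 1, y, y + 1}")
    case True
    then obtain y where "y mod int n = t mod int n" "x \<in> {y - 1, y, y + 1}" by blast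
    with adj_swap_neighbours[OF n _ j, of y] show ?thesis by auto
  next
    case False
    have "x mod int n \<noteq> t mod int n" using False by auto
    moreover have "x mod int n \<noteq> (t - 1) mod int n"
      using False[simplified, rule_format, of "x + 1"] mod_eq_shift[of x 1 "int n" "t - 1"] by auto
    moreover have "x mod int n \<noteq> j mod int n"
      using False[simplified, rule_format, of "x - 1"] mod_eq_shift[of x "-1" "int n" "t + 1"] j
      by auto
    moreover have "(j - 1) mod int n = t mod int n"
      using mod_eq_shift[of j "-1" "int n" "t + 1"] j by simp
    ultimately show ?thesis using n by (simp add: adj_swap_simps)
  qed
qed

lemma cyclic_dist_cases:
  assumes "i \<in> {1..int n}" "j \<in> {1..int n}"
  obtains "i = j" | "cyclic_dist n i j \<ge> 2" | "j mod int n = (i + 1) mod int n"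
    | "i mod int n = (j + 1) mod int n"
proof -
  have n: "int n > 0" using assms by simp
  have "(i - j) mod int n \<ge> 0" "(j - i) mod int n \<ge> 0" using n by simp_all
  then consider "(i - j) mod int n = 0" | "(i - j) mod int n = 1" | "(j - i) mod int n = 1"
    | "(j - i) mod int n = 0" | "cyclic_dist n i j \<ge> 2"
    unfolding cyclic_dist_def by linarith
  moreover have eq: "x = y" if "(x - y) mod int n = 0" "x \<in> {1..int n}" "y \<in> {1..int n}" for x y
  proof -
    have "int n dvd x - y" using that(1) by presburger
    moreover have "\<bar>x - y\<bar> < int n" using that by auto
    ultimately show ?thesis using dvd_imp_le_int[of "x - y" "int n"] by linarith
  qed
  moreover have "x mod int n = (y + 1) mod int n" if "(x - y) mod int n = 1" for x y
  proof -
    have "(x - y + y) mod int n = (1 + y) mod int n"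
      using that by (metis mod_add_left_eq)
    then show ?thesis by (simp add: add.commute)
  qed
  ultimately show thesis using assms that eq by metis
qed

lemma cyclic_dist_ge_2:
  assumes "cyclic_dist n i j \<ge> 2"
  shows "i mod int n \<noteq> j mod int n" "i mod int n \<noteq> (j - 1) mod int n" "i mod int n \<noteq> (j + 1) mod int n"
proof -
  have "n \<noteq> 1" using assms by (auto simp: cyclic_dist_def)
  have a: "(i - j) mod int n \<ge> 2" "(j - i) mod int n \<ge> 2"
    using assms by (auto simp: cyclic_dist_def)
  have e: "(x - y) mod int n = c mod int n" if "x mod int n = (y + c) mod int n" for x y c
    using that by (metis add_diff_cancel_left' mod_diff_left_eq)
  have one: "1 mod int n \<le> 1"
    by (cases "n = 0") (auto simp: \<open>n \<noteq> 1\<close> intro: zmod_le_nonneg_dividend)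
  show "i mod int n \<noteq> j mod int n" using e[of i j 0] a by auto
  show "i mod int n \<noteq> (j + 1) mod int n" using e[of i j 1] a one by auto
  show "i mod int n \<noteq> (j - 1) mod int n"
    using e[of j i 1] mod_eq_shift[of i 1 "int n" "j - 1"] a one by auto
qed

lemma adj_swap_commute:
  assumes "n \<ge> 3" "cyclic_dist n t j \<ge> 2" "i mod int n = j mod int n"
  shows "adj_swap n t i = i" "adj_swap n t (i - 1) = i - 1"
proof -
  note d = cyclic_dist_ge_2[OF assms(2)]
  show "adj_swap n t i = i"
    using d mod_eq_shift[of t 1 "int n" "j"] mod_eq_shift[of j 1 "int n" "t - 1"] assms
    by (simp add: adj_swap_simps)
  have "(i - 1) mod int n = (j - 1) mod int n"
    using assms(3) mod_eq_shift[of i "-1" "int n" j] by simp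
  then show "adj_swap n t (i - 1) = i - 1"
    using d mod_eq_shift[of t "-1" "int n" "j"] assms
    by (simp add: adj_swap_simps)
qed

lemma adj_swaps_commute:
  assumes n: "n \<ge> 3" and d: "cyclic_dist n t j \<ge> 2"
  shows "adj_swap n t \<circ> adj_swap n j = adj_swap n j \<circ> adj_swap n t"
proof
  fix x
  have d': "cyclic_dist n j t \<ge> 2" using d by (simp add: cyclic_dist_def min.commute)
  have n2: "n \<ge> 2" using n by simp
  have *: "(adj_swap n t \<circ> adj_swap n j) x = (adj_swap n j \<circ> adj_swap n t) x"
    if x: "x \<in> {i, i - 1}" and "i mod int n = j mod int n" and "cyclic_dist n t j \<ge> 2" for i j t
    using adj_swap_commute[OF n that(3,2)] adj_swap_simps(1,2)[OF n2 that(2)] x by auto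
  consider i where "i mod int n = j mod int n" "x \<in> {i, i - 1}"
    | i where "i mod int n = t mod int n" "x \<in> {i, i - 1}"
    | "adj_swap n t x = x" "adj_swap n j x = x"
    using mod_eq_shift[of x 1 "int n" "j - 1"] mod_eq_shift[of x 1 "int n" "t - 1"]
      adj_swap_simps(3)[OF n2, of x t] adj_swap_simps(3)[OF n2, of x j]
    by (metis add_diff_cancel diff_add_cancel insertCI)
  then show "(adj_swap n t \<circ> adj_swap n j) x = (adj_swap n j \<circ> adj_swap n t) x"
  proof cases
    case 1 then show ?thesis using * d by blast
  next
    case 2 then show ?thesis using *[OF _ _ d'] by metis
  qed simp
qed

lemma window_mod_eq_iff:
  assumes "i \<in> {1..int n}" "j \<in> {1..int n}"
  shows "i mod int n = j mod int n \<longleftrightarrow> i = j"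
proof (cases "i = j")
  case False
  have "\<bar>i - j\<bar> < int n" using assms by auto
  then show ?thesis using mod_neq_shift[of j n j "i - j" 0] False by simp
qed simp

lemma adj_swap_cong:
  assumes "a mod int n = b mod int n"
  shows "adj_swap n j a mod int n = adj_swap n j b mod int n"
  using assms mod_eq_shift[of a 1 "int n" b] mod_eq_shift[of a "-1" "int n" b]
  by (simp add: adj_swap_def)

lemma int_div_succ:
  assumes "m > 0" shows "(a + 1) div m = a div m + (if m dvd a + 1 then 1 else 0 :: int)"
proof -
  let ?q = "a div m" and ?r = "a mod m"
  have a: "a = m * ?q + ?r" by simp
  have r: "0 \<le> ?r" "?r < m" using assms by simp_all
  show ?thesis
  proof (cases "?r + 1 = m")
    case True
    have "a + 1 = m * ?q + m" using a True by linarith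
    then have "a + 1 = m * (?q + 1)" by (simp add: distrib_left)
    then show ?thesis using assms by simp
  next
    case False
    have e: "a + 1 = m * ?q + (?r + 1)" using a by simp
    have d: "(a + 1) div m = ?q" by (rule int_div_pos_eq[OF e]) (use r False in auto)
    have "(a + 1) mod m = ?r + 1" by (rule int_mod_pos_eq[OF e]) (use r False in auto)
    then have "\<not> m dvd a + 1" using r by (simp add: dvd_eq_mod_eq_0)
    then show ?thesis using d by simp
  qed
qed

text \<open>The quotient counts the periods between \<open>i\<close> and \<open>x\<close>, so a swap at \<open>j\<close> changes it only if it moves
  \<open>x\<close> across a number congruent to \<open>i\<close>. These quotients are the exponents in the leading terms of
  the asymptotic families.\<close>

lemma adj_swap_div:
  assumes n: "n \<ge> 2"
  shows "(adj_swap n j x - i) div int n = (x - i) div int n +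
    (if i mod int n = j mod int n
     then (if x mod int n = (j - 1) mod int n then 1 else 0) - (if x mod int n = j mod int n then 1 else 0)
     else 0)"
proof -
  have np: "int n > 0" using n by simp
  have dvd: "int n dvd a - b \<longleftrightarrow> a mod int n = b mod int n" for a b :: int
    by (simp add: mod_eq_dvd_iff)
  consider "x mod int n = (j - 1) mod int n" "x mod int n \<noteq> j mod int n" | "x mod int n = j mod int n"
      "x mod int n \<noteq> (j - 1) mod int n"
    | "x mod int n \<noteq> j mod int n" "x mod int n \<noteq> (j - 1) mod int n"
    using pred_mod_neq[OF n, of j] by metis
  then show ?thesis
  proof cases
    case 1
    have "(x + 1) mod int n = j mod int n" using 1 mod_eq_shift[of x 1 "int n" "j - 1"] by simp
    then have "int n dvd x - i + 1 \<longleftrightarrow> i mod int n = j mod int n" using dvd[of "x + 1" i] by (auto simp: algebra_simps)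
    moreover have "adj_swap n j x - i = x - i + 1" using 1 by (simp add: adj_swap_def)
    then have "(adj_swap n j x - i) div int n = (x - i + 1) div int n" by (simp only:)
    ultimately show ?thesis using 1 int_div_succ[OF np, of "x - i"] by simp
  next
    case 2
    have "int n dvd x - 1 - i + 1 \<longleftrightarrow> i mod int n = j mod int n" using dvd[of x i] 2 by auto
    moreover have "adj_swap n j x - i = x - 1 - i" using 2 by (simp add: adj_swap_def)
    then have "(adj_swap n j x - i) div int n = (x - 1 - i) div int n" by (simp only:)
    moreover have "x - 1 - i + 1 = x - i" by simp
    ultimately show ?thesis using 2 int_div_succ[OF np, of "x - 1 - i"] by simp
  next
    case 3 then show ?thesis using n by (simp add: adj_swap_simps)
  qed
qed

section \<open>The Coxeter presentation of the affine symmetric group\<close>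

abbreviation flip_equiv :: "nat \<Rightarrow> int word \<Rightarrow> int word \<Rightarrow> bool" where
  "flip_equiv n \<equiv> word_equiv {1..int n} (flip_relations n)"

abbreviation flip_words :: "nat \<Rightarrow> int word set" where
  "flip_words n \<equiv> lists ({1..int n} \<times> UNIV)"

text \<open>Generators are involutions, so that the signs of the letters are irrelevant.\<close>

lemma flip_equiv_sign:
  assumes "t \<in> {1..int n}" shows "flip_equiv n [(t, b)] [(t, True)]"
proof (cases b)
  case False
  have "flip_equiv n ([] @ [(t, False), (t, \<not> False)] @ [(t, True)]) ([] @ [(t, True)])"
    by (rule word_equiv.cancel) fact
  moreover have "flip_equiv n ([(t, False)] @ [(t, True), (t, True)] @ []) ([(t, False)] @ [] @ [])"
    by (rule word_equiv.relation) (use assms in \<open>auto simp: flip_relations_def\<close>)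
  ultimately show ?thesis using False by (auto intro: word_equiv.sym word_equiv.trans)
qed (simp add: word_equiv.refl)

lemma flip_equiv_signs:
  assumes "u \<in> flip_words n" "map fst u = map fst v"
  shows "flip_equiv n u v"
proof -
  have "length u = length v" using assms(2) by (metis length_map)
  then show ?thesis using assms
  proof (induction u v rule: list_induct2)
    case (Cons l u l' v)
    then have "flip_equiv n [l] [l']"
      using flip_equiv_sign[of "fst l" n "snd l"] flip_equiv_sign[of "fst l" n "snd l'"]
      by (cases l; cases l') (auto intro: word_equiv.sym word_equiv.trans)
    then show ?case using Cons word_equiv_append[of _ _ "[l]" "[l']" u v] by auto
  qed (simp add: word_equiv.refl)
qed

lemma flip_equiv_relation:
  assumes "(r, r') \<in> flip_relations n" "u \<in> flip_words n" "map fst u = map fst r" "map fst r' = map fst v"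
    "r' \<in> flip_words n"
  shows "flip_equiv n u v"
proof -
  have "flip_equiv n ([] @ r @ []) ([] @ r' @ [])" using assms(1) by (rule word_equiv.relation)
  moreover have "flip_equiv n u r" "flip_equiv n r' v"
    using assms by (auto intro: flip_equiv_signs)
  ultimately show ?thesis by (metis append_Nil append_Nil2 word_equiv.trans)
qed

lemma flip_equiv_involution:
  "i \<in> {1..int n} \<Longrightarrow> flip_equiv n [(i, a), (i, b)] []"
  by (rule flip_equiv_relation[of "[(i, True), (i, True)]" "[]"])
    (auto simp: flip_relations_def)

lemma flip_equiv_commute:
  "i \<in> {1..int n} \<Longrightarrow> j \<in> {1..int n} \<Longrightarrow> cyclic_dist n i j \<ge> 2 \<Longrightarrow>
   flip_equiv n [(i, a), (j, b)] [(j, c), (i, d)]"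
  by (rule flip_equiv_relation[of "[(i, True), (j, True)]" "[(j, True), (i, True)]"])
    (auto simp: flip_relations_def)

lemma flip_equiv_braid:
  assumes "i \<in> {1..int n}" "j \<in> {1..int n}"
    and "j mod int n = (i + 1) mod int n \<or> i mod int n = (j + 1) mod int n"
  shows "flip_equiv n [(i, a), (j, b), (i, c)] [(j, d), (i, e), (j, f)]"
proof -
  have *: "flip_equiv n [(i, a), (j, b), (i, c)] [(j, d), (i, e), (j, f)]"
    if "i \<in> {1..int n}" "j \<in> {1..int n}" "j mod int n = (i + 1) mod int n" for i j a b c d e f
    by (rule flip_equiv_relation[of "[(i, True), (j, True), (i, True)]" "[(j, True), (i, True), (j, True)]"])
      (use that in \<open>auto simp: flip_relations_def\<close>)
  show ?thesis using assms(3) *[OF assms(1,2)] *[OF assms(2,1)] word_equiv.sym by metis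
qed

text \<open>Each relation has sides of equal parity. Hence a word that stops being reduced when one letter is
  appended becomes equivalent to a word that is shorter by exactly one (\<open>not_reducedE\<close>).\<close>

lemma flip_equiv_parity:
  "flip_equiv n u v \<Longrightarrow> even (length u) \<longleftrightarrow> even (length v)"
  by (induction rule: word_equiv.induct) (auto simp: flip_relations_def)

lemma flip_equiv_rev:
  "u \<in> flip_words n \<Longrightarrow> flip_equiv n (u @ rev u) []"
proof (induction u)
  case (Cons l u)
  obtain t b where l: "l = (t, b)" by fastforce
  have "flip_equiv n ([l] @ (u @ rev u) @ [l]) ([l] @ [] @ [l])"
    by (rule word_equiv_context) (use Cons in auto)
  moreover have "flip_equiv n ([l] @ [] @ [l]) []"
    using Cons l by (auto intro: flip_equiv_involution)
  ultimately show ?case by (auto intro: word_equiv.trans)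
qed (simp add: word_equiv.refl)

abbreviation word_perm :: "nat \<Rightarrow> int word \<Rightarrow> int \<Rightarrow> int" where
  "word_perm n \<equiv> word_map (adj_swap n)"

lemma word_perm_invariant:
  assumes n: "n \<ge> 3" and "flip_equiv n u v"
  shows "word_perm n u = word_perm n v"
  using assms(2)
proof (induction rule: word_equiv.induct)
  case (cancel g u b v)
  have "adj_swap n g \<circ> adj_swap n g = id" using n by (intro adj_swap_involution) simp
  then have "adj_swap n g (adj_swap n g x) = x" for x by (metis comp_apply id_apply)
  then show ?case by (simp add: word_map_append fun_eq_iff)
next
  case (relation r r' u v)
  have "word_perm n r = word_perm n r'"
    using relation adj_swap_involution[of n] n adj_swap_braid[OF n] adj_swaps_commute[OF n]
    by (auto simp: flip_relations_def o_assoc)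
  then show ?case by (simp add: word_map_append)
qed auto

definition reduced :: "nat \<Rightarrow> int word \<Rightarrow> bool" where
  "reduced n u \<longleftrightarrow> u \<in> flip_words n \<and>
     (\<forall>v \<in> flip_words n. flip_equiv n u v \<longrightarrow> length u \<le> length v)"

lemma reduced_prefix:
  assumes "reduced n (u @ x)" shows "reduced n u"
  unfolding reduced_def
proof (intro conjI ballI impI)
  show "u \<in> flip_words n" using assms by (simp add: reduced_def)
next
  fix v assume v: "v \<in> flip_words n" "flip_equiv n u v"
  then have "flip_equiv n (u @ x) (v @ x)" using word_equiv_append word_equiv.refl by blast
  then have "length (u @ x) \<le> length (v @ x)"
    using assms v unfolding reduced_def by (metis append_in_lists_conv)
  then show "length u \<le> length v" by simp
qed

lemma reduced_equiv:
  assumes "reduced n u" "flip_equiv n u v" "v \<in> flip_words n" "length v = length u"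
  shows "reduced n v"
  using assms unfolding reduced_def by (metis word_equiv.trans)

lemma flip_equiv_context: "flip_equiv n u v \<Longrightarrow> flip_equiv n (x @ u) (x @ v)"
  using word_equiv_context[of _ _ u v x "[]"] by simp

lemma not_reducedE:
  assumes "reduced n u" "j \<in> {1..int n}" "\<not> reduced n (u @ [(j, b)])"
  obtains v where "flip_equiv n u (v @ [(j, b)])" "length u = Suc (length v)" "v \<in> flip_words n"
proof -
  have u: "u \<in> flip_words n" using assms by (simp add: reduced_def)
  then have "u @ [(j, b)] \<in> flip_words n" using assms by simp
  then obtain v where v: "v \<in> flip_words n" "flip_equiv n (u @ [(j, b)]) v"
      "\<not> length (u @ [(j, b)]) \<le> length v"
    using assms unfolding reduced_def by blast
  then have "length v \<le> length u" by simp
  note v = v(1,2) this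
  have "even (length v) \<longleftrightarrow> \<not> even (length u)" using flip_equiv_parity[OF v(2)] by simp
  then have less: "length v < length u" using v(3) by (metis le_neq_implies_less)
  have "flip_equiv n (u @ [(j, b), (j, b)]) (v @ [(j, b)])"
    using word_equiv_append[OF v(2) word_equiv.refl, of "[(j, b)]"] by simp
  moreover have "flip_equiv n (u @ [(j, b), (j, b)]) u"
    using flip_equiv_context[OF flip_equiv_involution[OF assms(2)], of u] by simp
  ultimately have e: "flip_equiv n u (v @ [(j, b)])"
    by (blast intro: word_equiv.sym word_equiv.trans)
  moreover have "v @ [(j, b)] \<in> flip_words n" using v assms by simp
  ultimately have "length u \<le> Suc (length v)"
    using assms(1) unfolding reduced_def by fastforce
  with less e v that show thesis by simp
qed

text \<open>The case of the dihedral subgroup generated by \<open>t\<close> and \<open>j\<close> in which \<open>v\<close> ends with \<open>j\<close>, up to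
  equivalence: the braid relation turns \<open>x j t j\<close> into \<open>x t j t\<close>, whose prefixes are reduced too.\<close>

lemma braid_exchange:
  assumes red: "reduced n (v @ [(t, c), (j, b)])"
    and adj: "j mod int n = (t + 1) mod int n \<or> t mod int n = (j + 1) mod int n"
    and not_red: "\<not> reduced n (v @ [(j, b)])"
  obtains x where "flip_equiv n v (x @ [(j, b)])" "length v = Suc (length x)" "reduced n (x @ [(t, c)])"
proof -
  have redv: "reduced n v" using reduced_prefix[OF red] .
  have t: "t \<in> {1..int n}" and j: "j \<in> {1..int n}" using red by (auto simp: reduced_def)
  obtain x where x: "flip_equiv n v (x @ [(j, b)])" "length v = Suc (length x)" "x \<in> flip_words n"
    using not_reducedE[OF redv j not_red] by blast
  have "flip_equiv n (v @ [(t, c), (j, b)]) (x @ [(j, b), (t, c), (j, b)])"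
    using word_equiv_append[OF x(1) word_equiv.refl, of "[(t, c), (j, b)]"] by simp
  moreover have "flip_equiv n (x @ [(j, b), (t, c), (j, b)]) (x @ [(t, c), (j, b), (t, c)])"
    by (rule flip_equiv_context, rule flip_equiv_braid) (use t j adj in auto)
  ultimately have "flip_equiv n (v @ [(t, c), (j, b)]) (x @ [(t, c), (j, b), (t, c)])"
    by (rule word_equiv.trans)
  then have "reduced n ((x @ [(t, c)]) @ [(j, b), (t, c)])"
    using reduced_equiv[OF red] t j x by simp
  then have "reduced n (x @ [(t, c)])" by (rule reduced_prefix)
  with x show thesis by (intro that)
qed

text \<open>The standard argument for Coxeter groups, where the inequality says that \<open>u\<close> sends a simple root to
  a positive root. The last letter \<open>t\<close> of \<open>u = v t\<close> is distinct from \<open>j\<close>. If \<open>t\<close> and \<open>j\<close> commute, the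
  claim for \<open>v\<close> suffices. Otherwise the claim is applied to the shortest element obtained by removing
  letters \<open>t\<close> and \<open>j\<close> from the end of \<open>u\<close>: to \<open>v\<close> and both letters if \<open>v j\<close> is reduced, and else to the
  word \<open>x\<close> of \<open>braid_exchange\<close> and the letter \<open>t\<close>.\<close>

lemma word_perm_ascent_of_reduced:
  assumes n: "n \<ge> 3" and "reduced n (u @ [(j, b)])" and "i mod int n = j mod int n"
  shows "word_perm n u (i - 1) < word_perm n u i"
  using assms(2,3)
proof (induction "length u" arbitrary: u j b i rule: less_induct)
  case less
  have IH: "word_perm n v (i - 1) < word_perm n v i"
    if "length v < length u" "reduced n (v @ [(k, c)])" "i mod int n = k mod int n" for v k c i
    using less(1) that by blast
  show ?case
  proof (cases u rule: rev_exhaust)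
    case (snoc v l)
    obtain t c where l: "l = (t, c)" by fastforce
    have u: "u = v @ [(t, c)]" using snoc l by simp
    have red: "reduced n (v @ [(t, c), (j, b)])" using less(2) u by simp
    have redt: "reduced n (v @ [(t, c)])" using reduced_prefix[of n "v @ [(t, c)]" "[(j, b)]"] red by simp
    have t: "t \<in> {1..int n}" and j: "j \<in> {1..int n}" and v: "v \<in> flip_words n"
      using red by (auto simp: reduced_def)
    have perm: "word_perm n u = word_perm n v \<circ> adj_swap n t" by (simp add: u word_map_append)
    from t j show ?thesis
    proof (cases rule: cyclic_dist_cases)
      case 1
      have "flip_equiv n (v @ [(t, c), (j, b)]) v"
        using flip_equiv_context[OF flip_equiv_involution[OF j], of v] 1 by simp
      then show ?thesis using red v by (auto simp: reduced_def)
    next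
      case 2
      have "flip_equiv n (v @ [(t, c), (j, b)]) (v @ [(j, b), (t, c)])"
        using flip_equiv_context[OF flip_equiv_commute[OF t j 2]] .
      then have "reduced n ((v @ [(j, b)]) @ [(t, c)])"
        using reduced_equiv[OF red] t j v by simp
      then have "reduced n (v @ [(j, b)])" by (rule reduced_prefix)
      then have "word_perm n v (i - 1) < word_perm n v i" using IH[of v] less(3) u by simp
      then show ?thesis using adj_swap_commute[OF n 2 less(3)] by (simp add: perm)
    next
      case 3 note adj = this
      have i: "(i - 1) mod int n = t mod int n"
        using less(3) 3 mod_eq_shift[of i "-1" "int n" "t + 1"] by simp
      have ev: "adj_swap n t (i - 1) = i - 2" "adj_swap n t i = i"
          "adj_swap n j (i - 2) = i - 2" "adj_swap n j i = i - 1"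
        using adj_swap_neighbours[OF n i 3] by simp_all
      show ?thesis
      proof (cases "reduced n (v @ [(j, b)])")
        case True
        have "word_perm n v (i - 1) < word_perm n v i" using IH[of v] True less(3) u by simp
        moreover have "word_perm n v (i - 1 - 1) < word_perm n v (i - 1)"
          by (rule IH[of v t c]) (use redt u i in simp_all)
        ultimately show ?thesis using ev by (simp add: perm)
      next
        case False
        obtain x where x: "flip_equiv n v (x @ [(j, b)])" "length v = Suc (length x)"
            and xt: "reduced n (x @ [(t, c)])"
          using braid_exchange[OF red _ False] adj by blast
        from xt have "word_perm n x (i - 1 - 1) < word_perm n x (i - 1)"
          by (rule IH[rotated]) (use x u i in simp_all)
        moreover have "word_perm n v = word_perm n x \<circ> adj_swap n j"
          using word_perm_invariant[OF n x(1)] by (simp add: word_map_append)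
        ultimately show ?thesis using ev by (simp add: perm)
      qed
    next
      case 4 note adj = this
      have i: "(i + 1) mod int n = t mod int n" using less(3) 4 by (simp add: mod_eq_shift)
      note ev = adj_swap_neighbours[OF n less(3) 4]
      show ?thesis
      proof (cases "reduced n (v @ [(j, b)])")
        case True
        have "word_perm n v (i - 1) < word_perm n v i" using IH[of v] True less(3) u by simp
        moreover have "word_perm n v (i + 1 - 1) < word_perm n v (i + 1)"
          by (rule IH[of v t c]) (use redt u i in simp_all)
        ultimately show ?thesis using ev by (simp add: perm)
      next
        case False
        obtain x where x: "flip_equiv n v (x @ [(j, b)])" "length v = Suc (length x)"
            and xt: "reduced n (x @ [(t, c)])"
          using braid_exchange[OF red _ False] adj by blast
        from xt have "word_perm n x (i + 1 - 1) < word_perm n x (i + 1)"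
          by (rule IH[rotated]) (use x u i in simp_all)
        moreover have "word_perm n v = word_perm n x \<circ> adj_swap n j"
          using word_perm_invariant[OF n x(1)] by (simp add: word_map_append)
        ultimately show ?thesis using ev by (simp add: perm)
      qed
    qed
  qed simp
qed

lemma flip_equiv_Nil_of_word_perm:
  assumes n: "n \<ge> 3" and u: "u \<in> flip_words n" and id: "word_perm n u = id"
  shows "flip_equiv n u []"
proof -
  obtain v where v: "v \<in> flip_words n" "flip_equiv n u v"
    and min: "\<And>x. x \<in> flip_words n \<Longrightarrow> flip_equiv n u x \<Longrightarrow> length v \<le> length x"
    using ex_has_least_nat[of "\<lambda>v. v \<in> flip_words n \<and> flip_equiv n u v" u length] u
      word_equiv.refl by metis
  have red: "reduced n v"
    unfolding reduced_def using v min by (blast intro: word_equiv.trans)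
  have perm: "word_perm n v = id" using word_perm_invariant[OF n v(2)] id by simp
  show ?thesis
  proof (cases v rule: rev_exhaust)
    case (snoc x l)
    obtain t c where l: "l = (t, c)" by fastforce
    have "word_perm n x (t - 1) < word_perm n x t"
      using word_perm_ascent_of_reduced[OF n, of x t c t] red snoc l by simp
    moreover have "(word_perm n x \<circ> adj_swap n t) t = t" "(word_perm n x \<circ> adj_swap n t) (t - 1) = t - 1"
      using perm snoc l by (simp_all add: word_map_append)
    ultimately show ?thesis using n by (simp add: adj_swap_simps)
  qed (use v in simp)
qed

lemma flip_equiv_of_word_perm_eq:
  assumes n: "n \<ge> 3" and u: "u \<in> flip_words n" and v: "v \<in> flip_words n"
    and eq: "word_perm n u = word_perm n v"
  shows "flip_equiv n u v"
proof -
  have "word_perm n (rev u @ v) = id"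
    using word_map_rev[of "adj_swap n" u] adj_swap_involution[of n] n eq
    by (simp add: word_map_append)
  moreover have "rev u @ v \<in> flip_words n" using u v by (auto simp: in_lists_conv_set)
  ultimately have "flip_equiv n (rev u @ v) []" using flip_equiv_Nil_of_word_perm[OF n] by blast
  then have "flip_equiv n (u @ rev u @ v) u" using flip_equiv_context[of n _ _ u] by fastforce
  moreover have "flip_equiv n ((u @ rev u) @ v) ([] @ v)"
    by (rule word_equiv_append[OF flip_equiv_rev[OF u] word_equiv.refl])
  ultimately show ?thesis by (auto intro: word_equiv.sym word_equiv.trans)
qed

section \<open>Generation of the affine symmetric group by adjacent swaps\<close>

lemma sum_window_periodic:
  fixes f :: "int \<Rightarrow> int"
  assumes "\<And>i. f (i + int n) = f i"
  shows "sum f {a..<a + int n} = sum f {b..<b + int n}"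
proof -
  have step: "sum f {a + 1..<a + 1 + int n} = sum f {a..<a + int n}" for a
  proof -
    have "sum f {a..<a + int n + 1} = f a + sum f {a + 1..<a + int n + 1}"
      by (subst sum.remove[of _ a]) (auto intro!: arg_cong2[of _ _ _ _ "(+)"] sum.cong)
    moreover have "sum f {a..<a + int n + 1} = f (a + int n) + sum f {a..<a + int n}"
      by (subst sum.remove[of _ "a + int n"]) (auto intro!: arg_cong2[of _ _ _ _ "(+)"] sum.cong)
    ultimately show ?thesis using assms[of a] by (simp add: algebra_simps)
  qed
  have *: "sum f {a..<a + int n} = sum f {0..<0 + int n}" for a
  proof (induction a rule: int_induct[of _ 0])
    case (step1 i) then show ?case using step[of i] by simp
  next
    case (step2 i) then show ?case using step[of "i - 1"] by simp
  qed simp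
  show ?thesis using *[of a] *[of b] by simp
qed

text \<open>Summation over a period does not depend on its starting point. It can be started at \<open>j - 1\<close>, so that
  both values affected by a swap lie in the same period even if \<open>j = 1\<close>.\<close>

lemma sum_window_swap:
  fixes f g :: "int \<Rightarrow> int"
  assumes n: "n \<ge> 2" and f: "\<And>i. f (i + int n) = f i" and g: "\<And>i. g (i + int n) = g i"
    and eq: "\<And>i. i mod int n \<noteq> j mod int n \<Longrightarrow> i mod int n \<noteq> (j - 1) mod int n \<Longrightarrow> g i = f i"
  shows "sum g {1..int n} - sum f {1..int n} = g (j - 1) + g j - (f (j - 1) + f j)"
proof -
  let ?A = "{j - 1..<j - 1 + int n}"
  have win: "sum h {1..int n} = sum h ?A" if "\<And>i. h (i + int n) = h i" for h :: "int \<Rightarrow> int"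
  proof -
    have "{1..int n} = {1..<1 + int n}" by auto
    then show ?thesis using sum_window_periodic[of h n 1 "j - 1"] that by simp
  qed
  have split: "sum h ?A = h (j - 1) + h j + sum h {j + 1..<j - 1 + int n}" for h :: "int \<Rightarrow> int"
  proof -
    have "?A = {j - 1, j} \<union> {j + 1..<j - 1 + int n}" using n by auto
    then show ?thesis by (simp add: sum.union_disjoint)
  qed
  have "sum g {j + 1..<j - 1 + int n} = sum f {j + 1..<j - 1 + int n}"
  proof (rule sum.cong)
    fix i assume i: "i \<in> {j + 1..<j - 1 + int n}"
    show "g i = f i"
      using mod_neq_shift[of j n j "i - j" 0] mod_neq_shift[of j n j "i - j" "-1"] i
      by (intro eq) auto
  qed simp
  then show ?thesis using win[of f] win[of g] f g split[of f] split[of g] by simp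
qed

lemma adj_swap_periodic: "adj_swap n j (i + int n) = adj_swap n j i + int n"
  by (simp add: adj_swap_def)

lemma affine_carrier_swap:
  assumes n: "n \<ge> 2" and \<sigma>: "\<sigma> \<in> carrier (affine_symmetric_group n)"
  shows "\<sigma> \<circ> adj_swap n j \<in> carrier (affine_symmetric_group n)"
proof -
  have bij: "bij \<sigma>" and per: "\<And>i. \<sigma> (i + int n) = \<sigma> i + int n"
    and sum: "sum \<sigma> {1..int n} = (\<Sum>i\<in>{1..int n}. i)"
    using \<sigma> by (auto simp: affine_symmetric_group_def)
  have "bij (adj_swap n j)"
    using adj_swap_involution[OF n, of j] o_bij by blast
  moreover have "(\<Sum>i\<in>{1..int n}. (\<sigma> \<circ> adj_swap n j) i - i) - (\<Sum>i\<in>{1..int n}. \<sigma> i - i)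
      = ((\<sigma> \<circ> adj_swap n j) (j - 1) - (j - 1)) + ((\<sigma> \<circ> adj_swap n j) j - j)
        - ((\<sigma> (j - 1) - (j - 1)) + (\<sigma> j - j))"
    using n per by (intro sum_window_swap) (auto simp: adj_swap_periodic adj_swap_simps)
  then have "(\<Sum>i\<in>{1..int n}. (\<sigma> \<circ> adj_swap n j) i) = (\<Sum>i\<in>{1..int n}. \<sigma> i)"
    using n by (simp add: adj_swap_simps sum_subtractf)
  ultimately show ?thesis
    using bij per sum
    by (simp add: affine_symmetric_group_def bij_comp adj_swap_periodic)
qed

lemma word_perm_in_affine:
  assumes n: "n \<ge> 2" shows "word_perm n u \<in> carrier (affine_symmetric_group n)"
proof (induction u rule: rev_induct)
  case Nil then show ?case by (simp add: affine_symmetric_group_def flip: id_def)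
next
  case (snoc l u)
  then show ?case
    using affine_carrier_swap[OF n snoc, of "fst l"]
    by (simp only: word_map_append word_map_Cons word_map_Nil comp_id)
qed

lemma periodic_all:
  assumes n: "n \<ge> 1" and "\<And>i. P (i + int n) = P i" and "\<And>i. i \<in> {1..int n} \<Longrightarrow> P i"
  shows "P i"
proof -
  have up: "P (i + int n * int k) = P i" for i k
  proof (induction k)
    case (Suc k)
    then show ?case using assms(2)[of "i + int n * int k"] by (simp add: algebra_simps)
  qed simp
  have *: "P (i + int n * k) = P i" for i k
    using up[of i "nat k"] up[of "i + int n * k" "nat (- k)"] by (cases "k \<ge> 0") auto
  have "i = ((i - 1) mod int n + 1) + int n * ((i - 1) div int n)"
    using mult_div_mod_eq[of "int n" "i - 1"] by linarith
  moreover have "(i - 1) mod int n + 1 \<in> {1..int n}"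
    using n pos_mod_bound[of "int n" "i - 1"] by (auto simp: add1_zle_eq)
  ultimately show ?thesis
    using *[of "(i - 1) mod int n + 1" "(i - 1) div int n"] assms(3) by simp
qed

text \<open>A permutation without descents is increasing, so it is a translation, and the normalization of
  the sum excludes all translations except the identity.\<close>

lemma affine_no_descent:
  assumes n: "n \<ge> 1" and \<sigma>: "\<sigma> \<in> carrier (affine_symmetric_group n)"
    and asc: "\<And>j. j \<in> {1..int n} \<Longrightarrow> \<sigma> (j - 1) \<le> \<sigma> j"
  shows "\<sigma> = id"
proof -
  have bij: "bij \<sigma>" and per: "\<And>i. \<sigma> (i + int n) = \<sigma> i + int n"
    and sum: "sum \<sigma> {1..int n} = (\<Sum>i\<in>{1..int n}. i)"
    using \<sigma> by (auto simp: affine_symmetric_group_def)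
  have inj: "\<sigma> x = \<sigma> y \<Longrightarrow> x = y" for x y using bij by (metis bij_pointE)
  have le: "\<sigma> (j - 1) \<le> \<sigma> j" for j
  proof (rule periodic_all[OF n, of "\<lambda>j. \<sigma> (j - 1) \<le> \<sigma> j"])
    fix i show "(\<sigma> (i + int n - 1) \<le> \<sigma> (i + int n)) = (\<sigma> (i - 1) \<le> \<sigma> i)"
      using per[of "i - 1"] per[of i] by (simp add: algebra_simps)
  qed (rule asc)
  have mono: "\<sigma> x \<le> \<sigma> (x + int k)" for x k
  proof (induction k)
    case (Suc k) then show ?case using le[of "x + int (Suc k)"] by (simp add: algebra_simps)
  qed simp
  have mono: "\<sigma> x \<le> \<sigma> y" if "x \<le> y" for x y using mono[of x "nat (y - x)"] that by simp
  have suc: "\<sigma> (i + 1) = \<sigma> i + 1" for i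
  proof -
    obtain k where k: "\<sigma> k = \<sigma> i + 1" using bij by (metis bij_pointE)
    have "i < k" using mono[of k i] k by force
    then have "\<sigma> (i + 1) \<le> \<sigma> i + 1" using mono[of "i + 1" k] k by simp
    moreover have "\<sigma> i \<le> \<sigma> (i + 1)" "\<sigma> i \<noteq> \<sigma> (i + 1)" using mono[of i "i + 1"] inj[of i "i + 1"] by auto
    ultimately show ?thesis by simp
  qed
  define c where "c = \<sigma> 0"
  have shift: "\<sigma> i = c + i" for i
  proof (induction i rule: int_induct[of _ 0])
    case (step1 i) then show ?case using suc[of i] by simp
  next
    case (step2 i) then show ?case using suc[of "i - 1"] by simp
  qed (simp add: c_def)
  have "sum \<sigma> {1..int n} = (\<Sum>i\<in>{1..int n}. c + i)"
    by (rule sum.cong) (simp_all only: shift)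
  then have "c = 0" using sum n by (simp add: sum.distrib)
  then show ?thesis using shift by auto
qed

text \<open>Bubble sort: removing a descent lowers the sum of the squared displacements over a period.\<close>

lemma word_perm_surj:
  assumes n: "n \<ge> 2" and \<sigma>: "\<sigma> \<in> carrier (affine_symmetric_group n)"
  shows "\<exists>u \<in> flip_words n. \<sigma> = word_perm n u"
  using \<sigma>
proof (induction "nat (\<Sum>i\<in>{1..int n}. (\<sigma> i - i)\<^sup>2)" arbitrary: \<sigma> rule: less_induct)
  case less
  show ?case
  proof (cases "\<forall>j \<in> {1..int n}. \<sigma> (j - 1) \<le> \<sigma> j")
    case True
    then have "\<sigma> = word_perm n []" using affine_no_descent[OF _ less(2)] n by simp
    then show ?thesis by blast
  next
    case False
    then obtain j where j: "j \<in> {1..int n}" "\<sigma> j < \<sigma> (j - 1)" by auto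
    have per: "\<And>i. \<sigma> (i + int n) = \<sigma> i + int n"
      using less(2) by (auto simp: affine_symmetric_group_def)
    define \<tau> where "\<tau> = \<sigma> \<circ> adj_swap n j"
    have \<tau>: "\<tau> (i + int n) = \<tau> i + int n" "\<tau> (j - 1) = \<sigma> j" "\<tau> j = \<sigma> (j - 1)"
      "i mod int n \<noteq> j mod int n \<Longrightarrow> i mod int n \<noteq> (j - 1) mod int n \<Longrightarrow> \<tau> i = \<sigma> i" for i
      using n per by (simp_all add: \<tau>_def adj_swap_periodic adj_swap_simps)
    have "(\<Sum>i\<in>{1..int n}. (\<tau> i - i)\<^sup>2) - (\<Sum>i\<in>{1..int n}. (\<sigma> i - i)\<^sup>2)
      = (\<tau> (j - 1) - (j - 1))\<^sup>2 + (\<tau> j - j)\<^sup>2 - ((\<sigma> (j - 1) - (j - 1))\<^sup>2 + (\<sigma> j - j)\<^sup>2)"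
      using n per \<tau> by (intro sum_window_swap) auto
    also have "\<dots> = 2 * (\<sigma> j - \<sigma> (j - 1))"
      by (simp add: \<tau> power2_eq_square algebra_simps)
    finally have "(\<Sum>i\<in>{1..int n}. (\<tau> i - i)\<^sup>2) < (\<Sum>i\<in>{1..int n}. (\<sigma> i - i)\<^sup>2)"
      using j(2) by simp
    moreover have "0 \<le> (\<Sum>i\<in>{1..int n}. (\<tau> i - i)\<^sup>2)" by (rule sum_nonneg) simp
    ultimately have "nat (\<Sum>i\<in>{1..int n}. (\<tau> i - i)\<^sup>2) < nat (\<Sum>i\<in>{1..int n}. (\<sigma> i - i)\<^sup>2)" by linarith
    then obtain u where u: "u \<in> flip_words n" "\<tau> = word_perm n u"
      using less(1)[of \<tau>] affine_carrier_swap[OF n less(2), of j] by (auto simp: \<tau>_def)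
    have "\<sigma> = \<tau> \<circ> adj_swap n j" using adj_swap_involution[OF n, of j] by (simp add: \<tau>_def flip: o_assoc)
    then have "\<sigma> = word_perm n (u @ [(j, True)])" using u by (simp add: word_map_append)
    moreover have "u @ [(j, True)] \<in> flip_words n" using u j by simp
    ultimately show ?thesis by blast
  qed
qed
section \<open>Homogeneous coordinates\<close>

lemma det2_zero_iff_proportional:
  assumes "v \<noteq> 0" "w \<noteq> 0"
  shows "det2 v w = 0 \<longleftrightarrow> prop_vec v w"
proof
  assume z: "det2 v w = 0"
  from assms(1) obtain i where i: "v $ i \<noteq> 0" by (auto simp: vec_eq_iff)
  have "v $ i * w $ j = w $ i * v $ j" for j
    using z exhaust_2[of i] exhaust_2[of j] by (auto simp: det2_def algebra_simps)
  then have w: "w = (w $ i / v $ i) *s v" using i by (simp add: vec_eq_iff field_simps)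
  moreover have "w $ i / v $ i \<noteq> 0" using w assms(2) by (metis vector_smult_lzero)
  ultimately show "prop_vec v w" using assms unfolding prop_vec_def by blast
next
  assume "prop_vec v w"
  then show "det2 v w = 0" by (auto simp: prop_vec_def det2_def algebra_simps)
qed

lemma prop_vec_refl: "v \<noteq> 0 \<Longrightarrow> prop_vec v v"
  unfolding prop_vec_def by (auto intro!: exI[of _ 1])

lemma prop_mat_refl: "det A \<noteq> 0 \<Longrightarrow> prop_mat A A"
  unfolding prop_mat_def by (auto intro!: exI[of _ 1] simp: vec_eq_iff)

abbreviation point :: "'a::field ^ 2 \<Rightarrow> 'a proj_line" where
  "point \<equiv> abs_proj_line"

lemma point_eq_iff:
  assumes "v \<noteq> 0" "w \<noteq> 0" shows "point v = point w \<longleftrightarrow> det2 v w = 0"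
  using Quotient3_rel[OF Quotient3_proj_line, of v w] prop_vec_refl assms
    det2_zero_iff_proportional[OF assms] by auto

lemma point_cases:
  obtains v where "v \<noteq> 0" "p = point v"
proof -
  have "prop_vec (rep_proj_line p) (rep_proj_line p)"
    by (rule Quotient3_rep_reflp[OF Quotient3_proj_line])
  then have "rep_proj_line p \<noteq> 0" by (simp add: prop_vec_def)
  moreover have "p = point (rep_proj_line p)"
    by (simp add: Quotient3_abs_rep[OF Quotient3_proj_line])
  ultimately show thesis using that by blast
qed

lemma pgl2_cases:
  obtains A where "det A \<noteq> 0" "M = abs_pgl2 A"
proof -
  have "prop_mat (rep_pgl2 M) (rep_pgl2 M)"
    by (rule Quotient3_rep_reflp[OF Quotient3_pgl2])
  then have "det (rep_pgl2 M) \<noteq> 0" by (simp add: prop_mat_def)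
  moreover have "M = abs_pgl2 (rep_pgl2 M)"
    by (simp add: Quotient3_abs_rep[OF Quotient3_pgl2])
  ultimately show thesis using that by blast
qed

lemma pgl_act_point:
  assumes "det A \<noteq> 0" "v \<noteq> 0" shows "pgl_act (abs_pgl2 A) (point v) = point (A *v v)"
  using pgl_act.abs_eq prop_mat_refl prop_vec_refl assms by blast

lemma matrix_vector_mult_nonzero:
  fixes A :: "'a::field ^ 2 ^ 2"
  assumes "det A \<noteq> 0" "v \<noteq> 0" shows "A *v v \<noteq> 0"
proof -
  from assms(1) have "invertible A" by (simp add: invertible_det_nz)
  then obtain N where "N ** A = mat 1" by (auto simp: invertible_def)
  then show ?thesis using assms(2)
    by (metis matrix_vector_mul_assoc matrix_vector_mul_lid matrix_vector_mult_0_right)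
qed

lemma det2_matrix_vector_mult: "det2 (A *v v) (A *v w) = det A * det2 v w"
  by (simp add: det2_def det_2 matrix_vector_mult_def sum_2 algebra_simps)

lemma pgl_act_eq_iff: "pgl_act M p = pgl_act M q \<longleftrightarrow> p = q"
proof -
  obtain A where A: "det A \<noteq> 0" "M = abs_pgl2 A" by (rule pgl2_cases)
  obtain v where v: "v \<noteq> 0" "p = point v" by (rule point_cases)
  obtain w where w: "w \<noteq> 0" "q = point w" by (rule point_cases)
  show ?thesis
    using A v w by (simp add: pgl_act_point point_eq_iff matrix_vector_mult_nonzero det2_matrix_vector_mult)
qed

lemma point_scale:
  assumes "v \<noteq> 0" "c \<noteq> 0" shows "point (c *s v) = point v"
  using assms by (subst point_eq_iff) (auto simp: det2_def)

lemma hmap_trivial: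
  assumes "\<alpha> = 0 \<or> \<beta> = 0 \<or> b = d" shows "pgl_act (hmap \<alpha> \<beta> b d) p = p"
proof -
  obtain v where v: "v \<noteq> 0" "b = point v" by (rule point_cases)
  obtain w where w: "w \<noteq> 0" "d = point w" by (rule point_cases)
  obtain u where u: "u \<noteq> 0" "p = point u" by (rule point_cases)
  have "hmap \<alpha> \<beta> b d = abs_pgl2 (mat 1)"
    using assms v w by (auto simp: hmap.abs_eq prop_vec_refl point_eq_iff)
  then show ?thesis using u by (simp add: pgl_act_point)
qed

lemma pgl_act_hmap:
  assumes "\<alpha> \<noteq> 0" "\<beta> \<noteq> 0" "b \<noteq> 0" "d \<noteq> 0" "a \<noteq> 0" "point b \<noteq> point d"
  shows "pgl_act (hmap \<alpha> \<beta> (point b) (point d)) (point a) = point (hmat \<alpha> \<beta> b d *v a)"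
    and "hmat \<alpha> \<beta> b d *v a \<noteq> 0"
proof -
  have "det2 b d \<noteq> 0" using assms by (simp add: point_eq_iff)
  then have "det (hmat \<alpha> \<beta> b d) \<noteq> 0" using assms by (simp add: det_hmat)
  moreover have "hmap \<alpha> \<beta> (point b) (point d) = abs_pgl2 (hmat \<alpha> \<beta> b d)"
    using assms \<open>det2 b d \<noteq> 0\<close> by (simp add: hmap.abs_eq prop_vec_refl)
  ultimately show "pgl_act (hmap \<alpha> \<beta> (point b) (point d)) (point a) = point (hmat \<alpha> \<beta> b d *v a)"
    "hmat \<alpha> \<beta> b d *v a \<noteq> 0"
    using assms by (simp_all add: pgl_act_point matrix_vector_mult_nonzero)
qed

text \<open>In terms of the two fixed points \<open>b\<close> and \<open>d\<close> the transformation is diagonal. This form is symmetric,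
  and it makes the covariance under linear maps and the braid relation easy.\<close>

lemma hmat_mult_vec: "hmat \<alpha> \<beta> b d *v a = (\<alpha> * det2 d a) *s b + (\<beta> * det2 a b) *s d"
  by (simp add: vec_eq_iff forall_2 hmat_def det2_def matrix_vector_mult_def sum_2 algebra_simps)

lemma pgl_act_hmap_inverse:
  "pgl_act (hmap \<beta> \<alpha> b d) (pgl_act (hmap \<alpha> \<beta> b d) p) = p"
proof (cases "\<alpha> = 0 \<or> \<beta> = 0 \<or> b = d")
  case True then show ?thesis using hmap_trivial by metis
next
  case False
  obtain v where v: "v \<noteq> 0" "b = point v" by (rule point_cases)
  obtain w where w: "w \<noteq> 0" "d = point w" by (rule point_cases)
  obtain u where u: "u \<noteq> 0" "p = point u" by (rule point_cases)
  have d: "det2 v w \<noteq> 0" using v w False by (simp add: point_eq_iff)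
  have "hmat \<beta> \<alpha> v w *v (hmat \<alpha> \<beta> v w *v u) = (\<alpha> * \<beta> * (det2 v w)\<^sup>2) *s u"
    by (simp add: vec_eq_iff forall_2 hmat_def det2_def matrix_vector_mult_def sum_2
        power2_eq_square algebra_simps)
  then show ?thesis using False u v w d by (simp add: pgl_act_hmap point_scale)
qed

section \<open>The Yang-Baxter property of the projective transformations\<close>

definition bracket :: "'a::field \<times> 'a \<Rightarrow> 'a \<times> 'a \<Rightarrow> 'a" where
  "bracket x y = fst x * snd y - snd x * fst y"

definition comb :: "'a::field ^ 2 \<Rightarrow> 'a ^ 2 \<Rightarrow> 'a \<times> 'a \<Rightarrow> 'a ^ 2" where
  "comb v w x = fst x *s v + snd x *s w"

text \<open>The matrix \<open>hmat\<close> in coordinates with respect to a basis \<open>v, w\<close>, up to the factor \<open>det2 v w\<close>.\<close>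

definition hcoord :: "'a::field \<Rightarrow> 'a \<Rightarrow> 'a \<times> 'a \<Rightarrow> 'a \<times> 'a \<Rightarrow> 'a \<times> 'a \<Rightarrow> 'a \<times> 'a" where
  "hcoord \<alpha> \<beta> b d a =
     (\<alpha> * bracket d a * fst b + \<beta> * bracket a b * fst d, \<alpha> * bracket d a * snd b + \<beta> * bracket a b * snd d)"

lemma det2_comb: "det2 (comb v w x) (comb v w y) = bracket x y * det2 v w"
  by (simp add: det2_def comb_def bracket_def algebra_simps)

lemma hmat_comb:
  "hmat \<alpha> \<beta> (comb v w b) (comb v w d) *v comb v w a = det2 v w *s comb v w (hcoord \<alpha> \<beta> b d a)"
  unfolding hmat_mult_vec det2_comb
  by (simp add: vec_eq_iff comb_def hcoord_def algebra_simps)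

context
  fixes v w :: "'a::field ^ 2"
  assumes vw: "det2 v w \<noteq> 0"
begin

lemma comb_eq_0_iff: "comb v w x = 0 \<longleftrightarrow> x = (0, 0)"
proof
  assume "comb v w x = 0"
  then have "bracket x y = 0" for y
    using vw det2_comb[of v w x y] by (simp add: det2_def)
  from this[of "(1, 0)"] this[of "(0, 1)"] show "x = (0, 0)"
    by (cases x) (simp add: bracket_def)
qed (simp add: comb_def)

lemma point_comb_cases:
  obtains x where "x \<noteq> (0, 0)" "p = point (comb v w x)"
proof -
  obtain u where u: "u \<noteq> 0" "p = point u" by (rule point_cases)
  have "u = comb v w (det2 u w / det2 v w, det2 v u / det2 v w)"
    using vw by (simp add: vec_eq_iff forall_2 comb_def field_simps) (simp add: det2_def algebra_simps)
  then show thesis using that u comb_eq_0_iff by metis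
qed

lemma point_comb_eq_iff:
  "x \<noteq> (0, 0) \<Longrightarrow> y \<noteq> (0, 0) \<Longrightarrow> point (comb v w x) = point (comb v w y) \<longleftrightarrow> bracket x y = 0"
  using vw by (simp add: point_eq_iff comb_eq_0_iff det2_comb)

lemma pgl_act_hmap_comb:
  assumes "\<alpha> \<noteq> 0" "\<beta> \<noteq> 0" "b \<noteq> (0, 0)" "d \<noteq> (0, 0)" "a \<noteq> (0, 0)"
    "point (comb v w b) \<noteq> point (comb v w d)"
  shows "pgl_act (hmap \<alpha> \<beta> (point (comb v w b)) (point (comb v w d))) (point (comb v w a))
      = point (comb v w (hcoord \<alpha> \<beta> b d a))"
    and "hcoord \<alpha> \<beta> b d a \<noteq> (0, 0)"
proof -
  have "hmat \<alpha> \<beta> (comb v w b) (comb v w d) *v comb v w a \<noteq> 0"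
    using assms by (intro pgl_act_hmap(2)) (auto simp: comb_eq_0_iff)
  then show nz: "hcoord \<alpha> \<beta> b d a \<noteq> (0, 0)"
    unfolding hmat_comb by (auto simp flip: comb_eq_0_iff)
  have "pgl_act (hmap \<alpha> \<beta> (point (comb v w b)) (point (comb v w d))) (point (comb v w a))
      = point (det2 v w *s comb v w (hcoord \<alpha> \<beta> b d a))"
    using assms by (subst pgl_act_hmap) (auto simp: comb_eq_0_iff hmat_comb)
  then show "pgl_act (hmap \<alpha> \<beta> (point (comb v w b)) (point (comb v w d))) (point (comb v w a))
      = point (comb v w (hcoord \<alpha> \<beta> b d a))"
    using vw nz by (simp add: point_scale comb_eq_0_iff)
qed

end

text \<open>Both sides of the braid relation move only \<open>p1\<close> and \<open>p2\<close>. In the basis of representatives of \<open>p1\<close>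
  and \<open>p2\<close> the first step of each side becomes so simple that the rest can be multiplied out. The
  inequalities between points guarantee that every \<open>hmap\<close> is the intended transformation
  and not the identity, its value for degenerate arguments.\<close>

lemma hmap_braid:
  fixes \<alpha> \<beta> \<gamma> :: "'a::field" and p0 p1 p2 p3 :: "'a proj_line"
  assumes par: "\<alpha> \<noteq> 0" "\<beta> \<noteq> 0" "\<gamma> \<noteq> 0" and ne: "p1 \<noteq> p2" "p2 \<noteq> p0" "p3 \<noteq> p1"
    and q1: "q1 = pgl_act (hmap \<beta> \<alpha> p2 p0) p1" "p3 \<noteq> q1"
    and q2: "q2 = pgl_act (hmap \<gamma> \<alpha> p3 q1) p2" "q2 \<noteq> p0"
    and s2: "s2 = pgl_act (hmap \<gamma> \<beta> p3 p1) p2" "s2 \<noteq> p0"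
    and s1: "s1 = pgl_act (hmap \<gamma> \<alpha> s2 p0) p1" "p3 \<noteq> s1"
  shows "pgl_act (hmap \<gamma> \<beta> q2 p0) q1 = s1"
    and "pgl_act (hmap \<beta> \<alpha> p3 s1) s2 = q2"
proof -
  obtain v where v: "v \<noteq> 0" "p1 = point v" by (rule point_cases)
  obtain w where w: "w \<noteq> 0" "p2 = point w" by (rule point_cases)
  have vw: "det2 v w \<noteq> 0" using ne v w by (simp add: point_eq_iff)
  define cp where "cp x = point (comb v w x)" for x
  note act = pgl_act_hmap_comb[OF vw, folded cp_def]
  note eq = point_comb_eq_iff[OF vw, folded cp_def]
  obtain x0 where x0: "x0 \<noteq> (0, 0)" "p0 = cp x0"
    using point_comb_cases[OF vw] unfolding cp_def by metis
  obtain x3 where x3: "x3 \<noteq> (0, 0)" "p3 = cp x3"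
    using point_comb_cases[OF vw] unfolding cp_def by metis
  have p12: "p1 = cp (1, 0)" "p2 = cp (0, 1)" "(1, 0) \<noteq> (0::'a, 0::'a)" "(0, 1) \<noteq> (0::'a, 0::'a)"
    using v w by (auto simp: cp_def comb_def)
  define y1 where "y1 = hcoord \<beta> \<alpha> (0, 1) x0 (1, 0)"
  have y1: "q1 = cp y1" "y1 \<noteq> (0, 0)"
    using act[of \<beta> \<alpha> "(0, 1)" x0 "(1, 0)"] par ne x0 p12 q1 by (auto simp: y1_def)
  define y2 where "y2 = hcoord \<gamma> \<alpha> x3 y1 (0, 1)"
  have y2: "q2 = cp y2" "y2 \<noteq> (0, 0)"
    using act[of \<gamma> \<alpha> x3 y1 "(0, 1)"] par ne x3 p12 q1 q2 y1 by (auto simp: y2_def)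
  define z2 where "z2 = hcoord \<gamma> \<beta> x3 (1, 0) (0, 1)"
  have z2: "s2 = cp z2" "z2 \<noteq> (0, 0)"
    using act[of \<gamma> \<beta> x3 "(1, 0)" "(0, 1)"] par ne x3 p12 s2 by (auto simp: z2_def)
  define z1 where "z1 = hcoord \<gamma> \<alpha> z2 x0 (1, 0)"
  have z1: "s1 = cp z1" "z1 \<noteq> (0, 0)"
    using act[of \<gamma> \<alpha> z2 x0 "(1, 0)"] par ne x0 p12 s2 s1 z2 by (auto simp: z1_def)
  have y1': "y1 = (\<alpha> * fst x0, (\<alpha> - \<beta>) * snd x0)"
    by (cases x0) (simp add: y1_def hcoord_def bracket_def algebra_simps)
  have z2': "z2 = ((\<gamma> - \<beta>) * fst x3, \<gamma> * snd x3)"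
    by (cases x3) (simp add: z2_def hcoord_def bracket_def algebra_simps)
  have "bracket (hcoord \<gamma> \<beta> y2 x0 y1) z1 = 0"
    unfolding y2_def z1_def y1' z2'
    by (cases x0; cases x3) (simp add: hcoord_def bracket_def algebra_simps)
  then show "pgl_act (hmap \<gamma> \<beta> q2 p0) q1 = s1"
    using act[of \<gamma> \<beta> y2 x0 y1] eq z1 y1 y2 x0 par q2 by auto
  have "bracket (hcoord \<beta> \<alpha> x3 z1 z2) y2 = 0"
    unfolding y2_def z1_def y1' z2'
    by (cases x0; cases x3) (simp add: hcoord_def bracket_def algebra_simps)
  then show "pgl_act (hmap \<beta> \<alpha> p3 s1) s2 = q2"
    using act[of \<beta> \<alpha> x3 z1 z2] eq z1 z2 y2 x3 par s1 by auto
qed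

section \<open>Relations between flips\<close>

lemma curvature_flip:
  assumes "n \<ge> 2" shows "curvature (flip n j P) i = curvature P (adj_swap n j i)"
  using assms pred_mod_neq[OF assms, of j] by (simp add: flip_def adj_swap_def)

lemma monodromy_flip: "monodromy (flip n j P) = monodromy P"
  by (simp add: flip_def)

lemma vertex_flip:
  "i mod int n = j mod int n \<Longrightarrow> vertex (flip n j P) i =
     pgl_act (hmap (curvature P i) (curvature P (i - 1)) (vertex P (i + 1)) (vertex P (i - 1))) (vertex P i)"
  "i mod int n \<noteq> j mod int n \<Longrightarrow> vertex (flip n j P) i = vertex P i"
  by (simp_all add: flip_def)

lemma mod_neq_neighbours:
  assumes "n \<ge> 3" "i mod int n = j mod int n"
  shows "(i + 1) mod int n \<noteq> j mod int n" "(i - 1) mod int n \<noteq> j mod int n"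
    "(i + 2) mod int n \<noteq> j mod int n" "(i - 2) mod int n \<noteq> j mod int n"
  using mod_neq_shift[OF assms(2), of 1 0] mod_neq_shift[OF assms(2), of "-1" 0]
    mod_neq_shift[OF assms(2), of 2 0] mod_neq_shift[OF assms(2), of "-2" 0] assms(1) by simp_all

text \<open>A flip exchanges the two curvatures, which inverts the transformation. This includes degenerate
  arguments, where \<open>hmap\<close> is the identity in both directions.\<close>

lemma flip_involution:
  assumes n: "n \<ge> 3" shows "flip n j (flip n j P) = (P :: 'k::field polygon)"
proof (rule polygon.equality)
  have n2: "n \<ge> 2" using n by simp
  show "curvature (flip n j (flip n j P)) = curvature P"
    using adj_swap_involution[OF n2, of j] by (simp add: curvature_flip[OF n2] fun_eq_iff)
  show "vertex (flip n j (flip n j P)) = vertex P"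
  proof
    fix i show "vertex (flip n j (flip n j P)) i = vertex P i"
    proof (cases "i mod int n = j mod int n")
      case True
      then show ?thesis
        using n mod_neq_neighbours[OF n True]
        by (simp add: vertex_flip curvature_flip adj_swap_simps pgl_act_hmap_inverse)
    qed (simp add: vertex_flip)
  qed
qed (simp_all add: monodromy_flip)

lemma flip_mod: "i mod int n = j mod int n \<Longrightarrow> flip n i = flip n j"
  using mod_eq_shift[of i "-1" "int n" j] by (simp add: flip_def fun_eq_iff)

lemma flip_commute:
  assumes n: "n \<ge> 3" and d: "cyclic_dist n t j \<ge> 2"
  shows "flip n t (flip n j P) = flip n j (flip n t (P :: 'k::field polygon))"
proof (rule polygon.equality)
  have n2: "n \<ge> 2" using n by simp
  have d': "cyclic_dist n j t \<ge> 2" using d by (simp add: cyclic_dist_def min.commute)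
  show "curvature (flip n t (flip n j P)) = curvature (flip n j (flip n t P))"
    using adj_swaps_commute[OF n d] by (simp add: curvature_flip[OF n2] fun_eq_iff)
  have *: "vertex (flip n t (flip n j P)) i = vertex (flip n j (flip n t P)) i"
    if d: "cyclic_dist n t j \<ge> 2" and i: "i mod int n = j mod int n" for t j i
  proof -
    note ne = cyclic_dist_ge_2[OF d]
    have "(i - 1) mod int n \<noteq> t mod int n" "(i + 1) mod int n \<noteq> t mod int n" "i mod int n \<noteq> t mod int n"
      using ne i mod_eq_shift[of i 1 "int n" j] mod_eq_shift[of i "-1" "int n" j] by auto
    then show ?thesis
      using n i adj_swap_commute[OF n d i] by (simp add: vertex_flip curvature_flip)
  qed
  show "vertex (flip n t (flip n j P)) = vertex (flip n j (flip n t P))"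
  proof
    fix i show "vertex (flip n t (flip n j P)) i = vertex (flip n j (flip n t P)) i"
      using *[OF d, of i] *[OF d', of i] by (metis vertex_flip(2))
  qed
qed (simp_all add: monodromy_flip)

text \<open>The hypotheses say that the first two steps on either side give nondegenerate polygons.\<close>

lemma flip_braid:
  fixes P :: "'k::field polygon"
  assumes n: "n \<ge> 3" and j: "j mod int n = (t + 1) mod int n"
    and ng: "P \<in> ngons n" "flip n t P \<in> ngons n" "flip n j P \<in> ngons n"
      "flip n j (flip n t P) \<in> ngons n" "flip n t (flip n j P) \<in> ngons n"
  shows "flip n t (flip n j (flip n t P)) = flip n j (flip n t (flip n j P))"
proof (rule polygon.equality)
  have n2: "n \<ge> 2" using n by simp
  show "curvature (flip n t (flip n j (flip n t P))) = curvature (flip n j (flip n t (flip n j P)))"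
    using adj_swap_braid[OF n j] by (simp add: curvature_flip[OF n2] fun_eq_iff)
  have pair: "vertex (flip n t (flip n j (flip n t P))) i = vertex (flip n j (flip n t (flip n j P))) i"
      "vertex (flip n t (flip n j (flip n t P))) (i + 1) = vertex (flip n j (flip n t (flip n j P))) (i + 1)"
    if i: "i mod int n = t mod int n" for i
  proof -
    note sw = adj_swap_neighbours[OF n i j]
    have i': "(i + 1) mod int n = j mod int n" using i j by (simp add: mod_eq_shift)
    have ne: "(i - 1) mod int n \<noteq> t mod int n" "(i + 1) mod int n \<noteq> t mod int n"
      "(i + 2) mod int n \<noteq> t mod int n"
      "i mod int n \<noteq> j mod int n" "(i - 1) mod int n \<noteq> j mod int n" "(i + 2) mod int n \<noteq> j mod int n"
      using mod_neq_neighbours[OF n i] mod_neq_neighbours[OF n i'] by (simp_all add: add.commute)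
    have jt: "j mod int n \<noteq> t mod int n" "t mod int n \<noteq> j mod int n" using ne i i' by auto
    have two: "i + 1 + 1 = i + 2" by simp
    note vf = vertex_flip i i' ne jt curvature_flip[OF n2] sw two
    have dist: "vertex Q i \<noteq> vertex Q (i + 1)" "vertex Q (i + 1) \<noteq> vertex Q (i - 1)"
        "vertex Q (i + 2) \<noteq> vertex Q i" if "Q \<in> ngons n" for Q :: "'k polygon"
    proof -
      have ng: "vertex Q k \<noteq> vertex Q (k + 1)" "vertex Q k \<noteq> vertex Q (k + 2)" for k
        using that by (simp_all add: ngons_def)
      have "i - 1 + 2 = i + 1" by simp
      with ng[of i] ng[of "i - 1"] show "vertex Q i \<noteq> vertex Q (i + 1)"
        "vertex Q (i + 1) \<noteq> vertex Q (i - 1)" "vertex Q (i + 2) \<noteq> vertex Q i" by metis+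
    qed
    have curv: "curvature P k \<noteq> 0" for k using ng(1) by (simp add: ngons_def)
    have "pgl_act (hmap (curvature P (i + 1)) (curvature P i)
        (vertex (flip n j (flip n t P)) (i + 1)) (vertex P (i - 1))) (vertex (flip n t P) i)
      = vertex (flip n t (flip n j P)) i"
      and "pgl_act (hmap (curvature P i) (curvature P (i - 1))
        (vertex P (i + 2)) (vertex (flip n t (flip n j P)) i)) (vertex (flip n j P) (i + 1))
      = vertex (flip n j (flip n t P)) (i + 1)"
      using hmap_braid[of "curvature P (i - 1)" "curvature P i" "curvature P (i + 1)"
          "vertex P i" "vertex P (i + 1)" "vertex P (i - 1)" "vertex P (i + 2)"
          "vertex (flip n t P) i" "vertex (flip n j (flip n t P)) (i + 1)"
          "vertex (flip n j P) (i + 1)" "vertex (flip n t (flip n j P)) i"]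
        curv dist[OF ng(1)] dist[OF ng(2)] dist[OF ng(3)] dist[OF ng(4)] dist[OF ng(5)]
      by (simp_all add: vf)
    then show "vertex (flip n t (flip n j (flip n t P))) i = vertex (flip n j (flip n t (flip n j P))) i"
      "vertex (flip n t (flip n j (flip n t P))) (i + 1) = vertex (flip n j (flip n t (flip n j P))) (i + 1)"
      by (simp_all add: vf)
  qed
  show "vertex (flip n t (flip n j (flip n t P))) = vertex (flip n j (flip n t (flip n j P)))"
  proof
    fix i
    consider "i mod int n = t mod int n" | "(i - 1) mod int n = t mod int n"
      | "i mod int n \<noteq> t mod int n" "i mod int n \<noteq> j mod int n"
      using j mod_eq_shift[of i "-1" "int n" "t + 1"] by auto
    then show "vertex (flip n t (flip n j (flip n t P))) i = vertex (flip n j (flip n t (flip n j P))) i"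
    proof cases
      case 1 then show ?thesis by (rule pair)
    next
      case 2 then show ?thesis using pair(2)[OF 2] by simp
    qed (simp add: vertex_flip)
  qed
qed (simp_all add: monodromy_flip)
section \<open>Leading terms of rational functions of one variable\<close>

lemma eventually_poly_nonzero:
  fixes p :: "'k::idom poly"
  assumes "p \<noteq> 0" shows "\<forall>\<^sub>F t in cofinite. poly p t \<noteq> 0"
  using poly_roots_finite[OF assms] by (simp add: eventually_cofinite)

lemma poly_eq_0_of_eventually:
  fixes p :: "'k::idom poly"
  assumes "infinite (UNIV :: 'k set)" "\<forall>\<^sub>F t in cofinite. poly p t = 0" shows "p = 0"
proof (rule ccontr)
  assume "p \<noteq> 0"
  from assms(2) eventually_poly_nonzero[OF this] have "\<forall>\<^sub>F t :: 'k in cofinite. False"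
    by eventually_elim simp
  with assms(1) show False by (simp add: eventually_cofinite)
qed

text \<open>The function \<open>f\<close> agrees, up to finitely many points, with a rational function that is defined at \<open>0\<close>
  and has the value \<open>c\<close> there.\<close>

definition regular :: "('k::field \<Rightarrow> 'k) \<Rightarrow> 'k \<Rightarrow> bool" where
  "regular f c \<longleftrightarrow> (\<exists>A B. poly B 0 \<noteq> 0 \<and> poly A 0 = c * poly B 0 \<and>
     (\<forall>\<^sub>F t in cofinite. f t * poly B t = poly A t))"

lemma regular_poly: "regular (poly p) (poly p 0)"
  unfolding regular_def by (intro exI[of _ p] exI[of _ 1]) simp

lemma regular_const: "regular (\<lambda>t. c) c"
proof -
  have "poly [:c:] = (\<lambda>t. c)" by auto
  then show ?thesis using regular_poly[of "[:c:]"] by simp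
qed

lemma regular_ident: "regular (\<lambda>t :: 'k::field. t) 0"
proof -
  have "poly [:0, 1:] = (\<lambda>t :: 'k. t)" by (rule ext) simp
  then show ?thesis using regular_poly[of "[:0, 1 :: 'k:]"] by simp
qed

lemma regular_cong:
  assumes "regular f c" "\<forall>\<^sub>F t in cofinite. g t = f t" shows "regular g c"
proof -
  obtain A B where "poly B 0 \<noteq> 0" "poly A 0 = c * poly B 0" and
      e: "\<forall>\<^sub>F t in cofinite. f t * poly B t = poly A t"
    using assms(1) unfolding regular_def by blast
  moreover have "\<forall>\<^sub>F t in cofinite. g t * poly B t = poly A t"
    using e assms(2) by eventually_elim simp
  ultimately show ?thesis unfolding regular_def by blast
qed

lemma regular_add:
  assumes "regular f c" "regular g d" shows "regular (\<lambda>t. f t + g t) (c + d)"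
proof -
  obtain A B where f: "poly B 0 \<noteq> 0" "poly A 0 = c * poly B 0"
      "\<forall>\<^sub>F t in cofinite. f t * poly B t = poly A t"
    using assms(1) unfolding regular_def by blast
  obtain C D where g: "poly D 0 \<noteq> 0" "poly C 0 = d * poly D 0"
      "\<forall>\<^sub>F t in cofinite. g t * poly D t = poly C t"
    using assms(2) unfolding regular_def by blast
  have "\<forall>\<^sub>F t in cofinite. (f t + g t) * poly (B * D) t = poly (A * D + C * B) t"
    using f(3) g(3) by eventually_elim (simp add: algebra_simps flip: mult.assoc)
  moreover have "poly (A * D + C * B) 0 = (c + d) * poly (B * D) 0" "poly (B * D) 0 \<noteq> 0"
    using f g by (simp_all add: algebra_simps)
  ultimately show ?thesis unfolding regular_def by blast
qed

lemma regular_mult: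
  assumes "regular f c" "regular g d" shows "regular (\<lambda>t. f t * g t) (c * d)"
proof -
  obtain A B where f: "poly B 0 \<noteq> 0" "poly A 0 = c * poly B 0"
      "\<forall>\<^sub>F t in cofinite. f t * poly B t = poly A t"
    using assms(1) unfolding regular_def by blast
  obtain C D where g: "poly D 0 \<noteq> 0" "poly C 0 = d * poly D 0"
      "\<forall>\<^sub>F t in cofinite. g t * poly D t = poly C t"
    using assms(2) unfolding regular_def by blast
  have "\<forall>\<^sub>F t in cofinite. (f t * g t) * poly (B * D) t = poly (A * C) t"
    using f(3) g(3) by eventually_elim (simp add: algebra_simps flip: mult.assoc)
  moreover have "poly (A * C) 0 = (c * d) * poly (B * D) 0" "poly (B * D) 0 \<noteq> 0"
    using f g by (simp_all add: algebra_simps)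
  ultimately show ?thesis unfolding regular_def by blast
qed

lemma regular_nonzero:
  assumes "regular f c" "c \<noteq> 0" shows "\<forall>\<^sub>F t in cofinite. f t \<noteq> 0"
proof -
  obtain A B where f: "poly B 0 \<noteq> 0" "poly A 0 = c * poly B 0"
      "\<forall>\<^sub>F t in cofinite. f t * poly B t = poly A t"
    using assms(1) unfolding regular_def by blast
  then have "A \<noteq> 0" using assms(2) by auto
  from f(3) eventually_poly_nonzero[OF this] show ?thesis
    by eventually_elim auto
qed

lemma regular_inverse:
  assumes "regular f c" "c \<noteq> 0" shows "regular (\<lambda>t. inverse (f t)) (inverse c)"
proof -
  obtain A B where f: "poly B 0 \<noteq> 0" "poly A 0 = c * poly B 0"
      "\<forall>\<^sub>F t in cofinite. f t * poly B t = poly A t"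
    using assms(1) unfolding regular_def by blast
  have "\<forall>\<^sub>F t in cofinite. inverse (f t) * poly A t = poly B t"
    using f(3) regular_nonzero[OF assms]
  proof eventually_elim
    case (elim t)
    show ?case using elim(2) by (simp flip: elim(1))
  qed
  moreover have "poly B 0 = inverse c * poly A 0" "poly A 0 \<noteq> 0"
    using f assms(2) by simp_all
  ultimately show ?thesis unfolding regular_def by blast
qed

lemma regular_divide:
  "regular f c \<Longrightarrow> regular g d \<Longrightarrow> d \<noteq> 0 \<Longrightarrow> regular (\<lambda>t. f t / g t) (c / d)"
  using regular_mult[of f c "\<lambda>t. inverse (g t)" "inverse d"] regular_inverse[of g d]
  by (simp add: divide_inverse)

lemma regular_power: "regular f c \<Longrightarrow> regular (\<lambda>t. f t ^ k) (c ^ k)"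
  by (induction k) (auto intro: regular_mult regular_const)

lemma regular_unique:
  fixes f :: "'k::field \<Rightarrow> 'k"
  assumes inf: "infinite (UNIV :: 'k set)" and "regular f c" "regular f d" shows "c = d"
proof -
  obtain A B where f: "poly B 0 \<noteq> 0" "poly A 0 = c * poly B 0"
      "\<forall>\<^sub>F t in cofinite. f t * poly B t = poly A t"
    using assms(2) unfolding regular_def by blast
  obtain C D where g: "poly D 0 \<noteq> 0" "poly C 0 = d * poly D 0"
      "\<forall>\<^sub>F t in cofinite. f t * poly D t = poly C t"
    using assms(3) unfolding regular_def by blast
  have "\<forall>\<^sub>F t in cofinite. poly (A * D - C * B) t = 0"
    using f(3) g(3)
  proof eventually_elim
    case (elim t)
    show ?case by (simp add: algebra_simps flip: elim)
  qed
  then have "A * D - C * B = 0" by (rule poly_eq_0_of_eventually[OF inf])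
  then have "poly (A * D - C * B) 0 = 0" by simp
  then show ?thesis using f g by (simp add: algebra_simps)
qed

text \<open>The asymptotic relation \<open>f t \<sim> c t\<^sup>k\<close> at \<open>0\<close> for rational functions over a field without topology.
  If \<open>c = 0\<close> it says that \<open>f\<close> vanishes to an order greater than \<open>k\<close>.\<close>

definition leading :: "('k::field \<Rightarrow> 'k) \<Rightarrow> nat \<Rightarrow> 'k \<Rightarrow> bool" where
  "leading f k c \<longleftrightarrow> (\<exists>g. regular g c \<and> (\<forall>\<^sub>F t in cofinite. f t = t ^ k * g t))"

lemma eventually_cofinite_nonzero: "\<forall>\<^sub>F t :: 'k::field in cofinite. t \<noteq> 0"
  by (simp add: eventually_cofinite)

lemma leadingI: "regular g c \<Longrightarrow> (\<And>t. f t = t ^ k * g t) \<Longrightarrow> leading f k c"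
  unfolding leading_def by (intro exI[of _ g]) simp

lemma leading_regular: "regular f c \<Longrightarrow> leading f 0 c"
  by (rule leadingI) simp_all

lemma leading_cong:
  assumes "leading f k c" "\<forall>\<^sub>F t in cofinite. h t = f t" shows "leading h k c"
proof -
  obtain g where "regular g c" and e: "\<forall>\<^sub>F t in cofinite. f t = t ^ k * g t"
    using assms(1) unfolding leading_def by blast
  moreover have "\<forall>\<^sub>F t in cofinite. h t = t ^ k * g t" using e assms(2) by eventually_elim simp
  ultimately show ?thesis unfolding leading_def by blast
qed

lemma leading_add:
  assumes "leading f k c" "leading g k d" shows "leading (\<lambda>t. f t + g t) k (c + d)"
proof -
  obtain f' where f: "regular f' c" "\<forall>\<^sub>F t in cofinite. f t = t ^ k * f' t"
    using assms(1) unfolding leading_def by blast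
  obtain g' where g: "regular g' d" "\<forall>\<^sub>F t in cofinite. g t = t ^ k * g' t"
    using assms(2) unfolding leading_def by blast
  have "\<forall>\<^sub>F t in cofinite. f t + g t = t ^ k * (f' t + g' t)"
    using f(2) g(2) by eventually_elim (simp add: algebra_simps)
  then show ?thesis unfolding leading_def using regular_add[OF f(1) g(1)] by blast
qed

lemma leading_mult:
  assumes "leading f k c" "leading g l d" shows "leading (\<lambda>t. f t * g t) (k + l) (c * d)"
proof -
  obtain f' where f: "regular f' c" "\<forall>\<^sub>F t in cofinite. f t = t ^ k * f' t"
    using assms(1) unfolding leading_def by blast
  obtain g' where g: "regular g' d" "\<forall>\<^sub>F t in cofinite. g t = t ^ l * g' t"
    using assms(2) unfolding leading_def by blast
  have "\<forall>\<^sub>F t in cofinite. f t * g t = t ^ (k + l) * (f' t * g' t)"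
    using f(2) g(2) by eventually_elim (simp add: power_add)
  then show ?thesis unfolding leading_def using regular_mult[OF f(1) g(1)] by blast
qed

lemma leading_divide:
  assumes "leading f (k + l) c" "leading g l d" "d \<noteq> 0"
  shows "leading (\<lambda>t. f t / g t) k (c / d)"
proof -
  obtain f' where f: "regular f' c" "\<forall>\<^sub>F t in cofinite. f t = t ^ (k + l) * f' t"
    using assms(1) unfolding leading_def by blast
  obtain g' where g: "regular g' d" "\<forall>\<^sub>F t in cofinite. g t = t ^ l * g' t"
    using assms(2) unfolding leading_def by blast
  have "\<forall>\<^sub>F t in cofinite. f t / g t = t ^ k * (f' t / g' t)"
    using f(2) g(2) eventually_cofinite_nonzero by eventually_elim (simp add: power_add)
  then show ?thesis unfolding leading_def using regular_divide[OF f(1) g(1) assms(3)] by blast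
qed

lemma leading_weaken:
  assumes "leading f l c" "k < l" shows "leading f k 0"
proof -
  obtain f' where f: "regular f' c" "\<forall>\<^sub>F t in cofinite. f t = t ^ l * f' t"
    using assms(1) unfolding leading_def by blast
  have "regular (\<lambda>t. t ^ (l - k) * f' t) (0 ^ (l - k) * c)"
    by (intro regular_mult regular_power regular_ident f)
  moreover have pow: "t ^ l = t ^ k * t ^ (l - k)" for t :: 'a
    using assms(2) by (simp flip: power_add)
  have "\<forall>\<^sub>F t in cofinite. f t = t ^ k * (t ^ (l - k) * f' t)"
    using f(2) by eventually_elim (simp add: pow mult.assoc)
  ultimately show ?thesis unfolding leading_def using assms(2) by (auto simp: power_0_left)
qed

lemma leading_uminus: "leading f k c \<Longrightarrow> leading (\<lambda>t. - f t) k (- c)"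
  using leading_mult[OF leading_regular[OF regular_const[of "-1"]], of f k c] by simp

lemma leading_diff: "leading f k c \<Longrightarrow> leading g k d \<Longrightarrow> leading (\<lambda>t. f t - g t) k (c - d)"
  using leading_add[of f k c "\<lambda>t. - g t" "- d"] leading_uminus[of g k d] by simp

lemma leading_add_smaller:
  assumes "leading f k c" "leading g l d" "k < l"
  shows "leading (\<lambda>t. f t + g t) k c" "leading (\<lambda>t. f t - g t) k c" "leading (\<lambda>t. g t + f t) k c"
    "leading (\<lambda>t. g t - f t) k (- c)"
  using leading_add[OF assms(1) leading_weaken[OF assms(2,3)]]
    leading_diff[OF assms(1) leading_weaken[OF assms(2,3)]]
    leading_add[OF leading_weaken[OF assms(2,3)] assms(1)]
    leading_diff[OF leading_weaken[OF assms(2,3)] assms(1)] by simp_all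

lemma leading_nonzero:
  assumes "leading f k c" "c \<noteq> 0" shows "\<forall>\<^sub>F t in cofinite. f t \<noteq> 0"
proof -
  obtain f' where f: "regular f' c" "\<forall>\<^sub>F t in cofinite. f t = t ^ k * f' t"
    using assms(1) unfolding leading_def by blast
  from f(2) regular_nonzero[OF f(1) assms(2)] eventually_cofinite_nonzero
  show ?thesis by eventually_elim simp
qed

lemma leading_unique:
  fixes f :: "'k::field \<Rightarrow> 'k"
  assumes inf: "infinite (UNIV :: 'k set)" and "leading f k c" "leading f k d" shows "c = d"
proof -
  obtain f' where f: "regular f' c" "\<forall>\<^sub>F t in cofinite. f t = t ^ k * f' t"
    using assms(2) unfolding leading_def by blast
  obtain g' where g: "regular g' d" "\<forall>\<^sub>F t in cofinite. f t = t ^ k * g' t"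
    using assms(3) unfolding leading_def by blast
  have "\<forall>\<^sub>F t in cofinite. g' t = f' t"
    using f(2) g(2) eventually_cofinite_nonzero by eventually_elim simp
  then show ?thesis using regular_unique[OF inf] regular_cong f(1) g(1) by blast
qed

lemma leading_monom: "leading (\<lambda>t. c * t ^ k) k c"
  by (rule leadingI[OF regular_const]) simp

section \<open>Coordinates on the space of polygons\<close>

definition affine_point :: "'a::field \<Rightarrow> 'a proj_line" where
  "affine_point x = point (vector [x, 1])"

text \<open>The normalized representative of a monodromy in the chart of \<open>PGL\<^sub>2\<close>.\<close>

definition mon_mat :: "'a::field \<Rightarrow> 'a \<Rightarrow> 'a \<Rightarrow> 'a ^ 2 ^ 2" where
  "mon_mat a b c = vector [vector [a, b], vector [c, 1]]"

lemma vec1_nonzero [simp]: "vector [x, 1] \<noteq> (0 :: 'a::field ^ 2)"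
  by (simp add: vec_eq_iff forall_2)

lemma det_mon_mat: "det (mon_mat a b c) = a - b * c"
  by (simp add: mon_mat_def det_2)

lemma at_infinity_point: "v \<noteq> 0 \<Longrightarrow> at_infinity (point v) \<longleftrightarrow> v $ 2 = 0"
  by (simp add: at_infinity.abs_eq prop_vec_refl)

lemma affine_coord_point: "v \<noteq> 0 \<Longrightarrow> affine_coord (point v) = v $ 1 / v $ 2"
  by (simp add: affine_coord.abs_eq prop_vec_refl)

lemma affine_point_simps [simp]:
  "\<not> at_infinity (affine_point x)" "affine_coord (affine_point x) = x"
  by (simp_all add: affine_point_def at_infinity_point affine_coord_point)

lemma affine_point_eq_iff [simp]: "affine_point x = affine_point y \<longleftrightarrow> x = y"
  by (metis affine_point_simps(2))

lemma point_affine: "v $ 2 \<noteq> 0 \<Longrightarrow> point v = affine_point (v $ 1 / v $ 2)"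
proof -
  assume a: "v $ 2 \<noteq> 0"
  then have "v \<noteq> 0" by auto
  with a show ?thesis by (simp add: affine_point_def point_eq_iff det2_def)
qed

lemma affine_point_coord: "\<not> at_infinity p \<Longrightarrow> affine_point (affine_coord p) = p"
  by (metis affine_coord_point at_infinity_point point_affine point_cases)

lemma pgl_coord_mon_mat:
  assumes "a - b * c \<noteq> 0"
  shows "\<not> pgl_at_infinity (abs_pgl2 (mon_mat a b c))"
    "pgl_coord 1 1 (abs_pgl2 (mon_mat a b c)) = a"
    "pgl_coord 1 2 (abs_pgl2 (mon_mat a b c)) = b"
    "pgl_coord 2 1 (abs_pgl2 (mon_mat a b c)) = c"
  using assms
  by (simp_all add: pgl_at_infinity.abs_eq pgl_coord.abs_eq prop_mat_refl det_mon_mat)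
     (simp_all add: mon_mat_def)

abbreviation mon_a :: "'k::field polygon \<Rightarrow> 'k" where "mon_a P \<equiv> pgl_coord 1 1 (monodromy P)"
abbreviation mon_b :: "'k::field polygon \<Rightarrow> 'k" where "mon_b P \<equiv> pgl_coord 1 2 (monodromy P)"
abbreviation mon_c :: "'k::field polygon \<Rightarrow> 'k" where "mon_c P \<equiv> pgl_coord 2 1 (monodromy P)"
abbreviation coord :: "'k::field polygon \<Rightarrow> int \<Rightarrow> 'k" where "coord P i \<equiv> affine_coord (vertex P i)"

lemma monodromy_mon_mat:
  assumes "\<not> pgl_at_infinity (monodromy P)"
  shows "monodromy P = abs_pgl2 (mon_mat (mon_a P) (mon_b P) (mon_c P))"
    and "mon_a P - mon_b P * mon_c P \<noteq> 0"
proof -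
  obtain A where A: "det A \<noteq> 0" "monodromy P = abs_pgl2 A" by (rule pgl2_cases)
  have nz: "A $ 2 $ 2 \<noteq> 0" using assms A by (simp add: pgl_at_infinity.abs_eq prop_mat_refl)
  have co: "pgl_coord i j (monodromy P) = A $ i $ j / A $ 2 $ 2" for i j
    using A by (simp add: pgl_coord.abs_eq prop_mat_refl)
  have "mon_a P - mon_b P * mon_c P = det A / (A $ 2 $ 2)\<^sup>2"
    using nz by (simp add: co det_2 field_simps power2_eq_square)
  then show d: "mon_a P - mon_b P * mon_c P \<noteq> 0" using A nz by simp
  have "A = (\<chi> i j. A $ 2 $ 2 * mon_mat (mon_a P) (mon_b P) (mon_c P) $ i $ j)"
    using nz by (simp add: vec_eq_iff forall_2 co mon_mat_def)
  then have "prop_mat (mon_mat (mon_a P) (mon_b P) (mon_c P)) A"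
    unfolding prop_mat_def using A nz d by (auto simp: det_mon_mat)
  then show "monodromy P = abs_pgl2 (mon_mat (mon_a P) (mon_b P) (mon_c P))"
    using Quotient3_rel_abs[OF Quotient3_pgl2] A by metis
qed

text \<open>The polygons in the domain of the coordinates that satisfy the periodicity conditions but need not
  be nondegenerate. Among them the chart is defined by the nonvanishing of one polynomial
  (\<open>chart_iff_chart_poly\<close>).\<close>

definition prechart :: "nat \<Rightarrow> 'k::field polygon set" where
  "prechart n = {P.
     (\<forall>i. vertex P (i + int n) = pgl_act (monodromy P) (vertex P i)) \<and>
     (\<forall>i. curvature P (i + int n) = curvature P i) \<and>
     (\<forall>i\<in>{1..int n}. \<not> at_infinity (vertex P i)) \<and> \<not> pgl_at_infinity (monodromy P)}"

lemma chart_subset_prechart: "chart n \<subseteq> prechart n"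
  by (auto simp: chart_def prechart_def ngons_def)

text \<open>Polynomial homogeneous coordinates for the vertices of three consecutive periods: the monodromy
  is applied to those of the period \<open>1, \<dots>, n\<close> to go forward, and its adjugate matrix to go back.\<close>

definition hom_vertex :: "nat \<Rightarrow> 'k::field polygon \<Rightarrow> int \<Rightarrow> 'k ^ 2" where
  "hom_vertex n P i =
     (if i \<le> 0 then vector [coord P (i + int n) - mon_b P, mon_a P - mon_c P * coord P (i + int n)]
      else if i \<le> int n then vector [coord P i, 1]
      else vector [mon_a P * coord P (i - int n) + mon_b P, mon_c P * coord P (i - int n) + 1])"

lemma vertex_hom_vertex:
  assumes P: "P \<in> prechart n" and i: "i \<in> {1 - int n..2 * int n}"
  shows "vertex P i = point (hom_vertex n P i)" "hom_vertex n P i \<noteq> 0"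
proof -
  let ?A = "mon_mat (mon_a P) (mon_b P) (mon_c P)"
  have "\<not> pgl_at_infinity (monodromy P)" using P by (simp add: prechart_def)
  note mon = monodromy_mon_mat[OF this]
  have det: "det ?A \<noteq> 0" using mon by (simp add: det_mon_mat)
  have base: "vertex P k = point (vector [coord P k, 1])" if "k \<in> {1..int n}" for k
    using P that affine_point_coord by (fastforce simp: prechart_def affine_point_def)
  have per: "vertex P (k + int n) = pgl_act (abs_pgl2 ?A) (vertex P k)" for k
    using P mon by (simp add: prechart_def)
  consider "i \<le> 0" | "i \<in> {1..int n}" | "i > int n" by fastforce
  then have "vertex P i = point (hom_vertex n P i) \<and> hom_vertex n P i \<noteq> 0"
  proof cases
    case 1
    let ?x = "coord P (i + int n)"
    have A: "?A *v hom_vertex n P i = (mon_a P - mon_b P * mon_c P) *s vector [?x, 1]"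
      using 1 by (simp add: hom_vertex_def vec_eq_iff forall_2 mon_mat_def matrix_vector_mult_def
          sum_2 algebra_simps)
    have "?A *v hom_vertex n P i \<noteq> 0" unfolding A using mon(2) by simp
    then have nz: "hom_vertex n P i \<noteq> 0" by auto
    have "pgl_act (abs_pgl2 ?A) (point (hom_vertex n P i)) = point (?A *v hom_vertex n P i)"
      using det nz by (rule pgl_act_point)
    also have "\<dots> = point (vector [?x, 1])"
      unfolding A by (rule point_scale) (use mon(2) in simp_all)
    also have "\<dots> = pgl_act (abs_pgl2 ?A) (vertex P i)"
      using base[of "i + int n"] per[of i] 1 i by simp
    finally show ?thesis using nz by (simp add: pgl_act_eq_iff)
  next
    case 2 then show ?thesis using base by (simp add: hom_vertex_def)
  next
    case 3
    have A: "?A *v vector [coord P (i - int n), 1] = hom_vertex n P i"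
      using 3 by (simp add: hom_vertex_def vec_eq_iff forall_2 mon_mat_def matrix_vector_mult_def
          sum_2 algebra_simps)
    have "?A *v vector [coord P (i - int n), 1] \<noteq> 0"
      by (rule matrix_vector_mult_nonzero) (use det in simp_all)
    then have nz: "hom_vertex n P i \<noteq> 0" using A by simp
    have "vertex P i = pgl_act (abs_pgl2 ?A) (vertex P (i - int n))" using per[of "i - int n"] by simp
    also have "\<dots> = pgl_act (abs_pgl2 ?A) (point (vector [coord P (i - int n), 1]))"
      by (rule arg_cong[OF base]) (use 3 i in auto)
    also have "\<dots> = point (hom_vertex n P i)" using det A by (simp add: pgl_act_point)
    finally show ?thesis using nz by simp
  qed
  then show "vertex P i = point (hom_vertex n P i)" "hom_vertex n P i \<noteq> 0" by simp_all
qed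

definition chart_poly :: "nat \<Rightarrow> 'k::field polygon \<Rightarrow> 'k" where
  "chart_poly n P = (\<Prod>i\<in>{1..int n}. curvature P i *
     (det2 (hom_vertex n P i) (hom_vertex n P (i + 1)) * det2 (hom_vertex n P i) (hom_vertex n P (i + 2))))"

lemma chart_iff:
  assumes P: "P \<in> prechart n" and n: "n \<ge> 2"
  shows "P \<in> chart n \<longleftrightarrow> (\<forall>i\<in>{1..int n}. curvature P i \<noteq> 0 \<and>
     vertex P i \<noteq> vertex P (i + 1) \<and> vertex P i \<noteq> vertex P (i + 2))" (is "_ \<longleftrightarrow> (\<forall>i\<in>_. ?Q i)")
proof
  assume "P \<in> chart n"
  then show "\<forall>i\<in>{1..int n}. ?Q i" by (simp add: chart_def ngons_def)
next
  assume Q: "\<forall>i\<in>{1..int n}. ?Q i"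
  have vp: "vertex P (k + int n) = pgl_act (monodromy P) (vertex P k)" for k
    using P by (simp add: prechart_def)
  have "?Q i" for i
  proof (rule periodic_all[of n ?Q])
    fix i
    have s: "i + int n + 1 = i + 1 + int n" "i + int n + 2 = i + 2 + int n" by simp_all
    show "?Q (i + int n) = ?Q i"
      unfolding s vp using P by (simp add: prechart_def pgl_act_eq_iff)
  qed (use Q n in auto)
  then have "?Q i" "?Q (i + 1)" for i by blast+
  then show "P \<in> chart n"
    using P by (simp add: chart_def ngons_def prechart_def add.assoc)
qed

lemma chart_iff_chart_poly:
  assumes P: "P \<in> prechart n" and n: "n \<ge> 2"
  shows "P \<in> chart n \<longleftrightarrow> chart_poly n P \<noteq> 0"
proof -
  have "vertex P i \<noteq> vertex P k \<longleftrightarrow> det2 (hom_vertex n P i) (hom_vertex n P k) \<noteq> 0"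
    if "i \<in> {1 - int n..2 * int n}" "k \<in> {1 - int n..2 * int n}" for i k
    using vertex_hom_vertex[OF P that(1)] vertex_hom_vertex[OF P that(2)] by (simp add: point_eq_iff)
  then show ?thesis using n by (auto simp: chart_iff[OF P n] chart_poly_def)
qed

lemma pgl_act_surj: "surj (pgl_act M)"
proof -
  obtain A where A: "det A \<noteq> 0" "M = abs_pgl2 A" by (rule pgl2_cases)
  then obtain N where N: "A ** N = mat 1" using invertible_det_nz[of A] by (auto simp: invertible_def)
  have "\<exists>q. p = pgl_act M q" for p
  proof -
    obtain v where v: "v \<noteq> 0" "p = point v" by (rule point_cases)
    have "A *v (N *v v) = v" using N by (simp add: matrix_vector_mul_assoc)
    moreover from this have "N *v v \<noteq> 0" using v by auto
    ultimately have "p = pgl_act M (point (N *v v))" using A v by (simp add: pgl_act_point)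
    then show ?thesis ..
  qed
  then show ?thesis by (auto simp: surj_def)
qed

text \<open>Integral powers of a projective transformation; they extend the vertices \<open>1, \<dots>, n\<close> to a twisted
  polygon.\<close>

definition pgl_iterate :: "'k::field pgl2 \<Rightarrow> int \<Rightarrow> 'k proj_line \<Rightarrow> 'k proj_line" where
  "pgl_iterate M k = (if k \<ge> 0 then pgl_act M ^^ nat k else inv_into UNIV (pgl_act M) ^^ nat (- k))"

lemma pgl_iterate_Suc: "pgl_iterate M (k + 1) p = pgl_act M (pgl_iterate M k p)"
proof (cases "k \<ge> 0")
  case True then show ?thesis by (simp add: pgl_iterate_def nat_add_distrib)
next
  case False
  define m where "m = nat (- k - 1)"
  have m: "k = - int (Suc m)" using False by (simp add: m_def)
  have "pgl_act M ((inv_into UNIV (pgl_act M) ^^ Suc m) p) = (inv_into UNIV (pgl_act M) ^^ m) p"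
    by (simp add: surj_f_inv_f[OF pgl_act_surj])
  then show ?thesis by (cases "m = 0") (simp_all add: pgl_iterate_def m nat_add_distrib)
qed

definition polygon_of :: "nat \<Rightarrow> (int \<Rightarrow> 'k) \<Rightarrow> (int \<Rightarrow> 'k) \<Rightarrow> 'k \<Rightarrow> 'k \<Rightarrow> 'k \<Rightarrow> 'k::field polygon" where
  "polygon_of n x u a b c = \<lparr>
     vertex = (\<lambda>i. pgl_iterate (abs_pgl2 (mon_mat a b c)) ((i - 1) div int n)
                     (affine_point (x ((i - 1) mod int n + 1)))),
     monodromy = abs_pgl2 (mon_mat a b c),
     curvature = (\<lambda>i. u ((i - 1) mod int n + 1))\<rparr>"

lemma polygon_of_simps:
  assumes "i \<in> {1..int n}"
  shows "vertex (polygon_of n x u a b c) i = affine_point (x i)"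
    "curvature (polygon_of n x u a b c) i = u i"
  using assms by (simp_all add: polygon_of_def pgl_iterate_def)

lemma polygon_of_prechart:
  assumes n: "n \<ge> 1" and nz: "a - b * c \<noteq> 0"
  shows "polygon_of n x u a b c \<in> prechart n"
proof -
  have s: "i + int n - 1 = (i - 1) + int n" for i by simp
  have d: "((i - 1) + int n) div int n = (i - 1) div int n + 1" for i using n by simp
  have "\<not> at_infinity (vertex (polygon_of n x u a b c) i)" if "i \<in> {1..int n}" for i
    using that by (simp add: polygon_of_simps)
  moreover have "\<not> pgl_at_infinity (monodromy (polygon_of n x u a b c))"
    using pgl_coord_mon_mat(1)[OF nz] by (simp add: polygon_of_def)
  moreover have "vertex (polygon_of n x u a b c) (i + int n) =
      pgl_act (monodromy (polygon_of n x u a b c)) (vertex (polygon_of n x u a b c) i)" for i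
    by (simp add: polygon_of_def s d pgl_iterate_Suc)
  moreover have "curvature (polygon_of n x u a b c) (i + int n) = curvature (polygon_of n x u a b c) i" for i
    by (simp add: polygon_of_def s)
  ultimately show ?thesis unfolding prechart_def by blast
qed

section \<open>Polynomial families of polygons\<close>

locale flip_space =
  fixes \<iota> :: "'f::field \<Rightarrow> 'k::field" and n :: nat
  assumes n: "n \<ge> 3" and embedding: "field_embedding \<iota>" and infinite: "infinite (UNIV :: 'k set)"
begin

lemma const_neg_one: "(\<lambda>P. - 1) \<in> poly_funs \<iota> n" and const_one: "(\<lambda>P. 1) \<in> poly_funs \<iota> n"
proof -
  have "\<iota> 0 + \<iota> 0 = \<iota> 0" using embedding unfolding field_embedding_def by (metis add_0)
  then have "\<iota> 0 = 0" by (metis add_cancel_right_right)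
  then have "\<iota> (- 1) + 1 = 0"
    using embedding unfolding field_embedding_def by (metis add.left_inverse)
  then have "\<iota> (- 1) = - 1" by (simp add: eq_neg_iff_add_eq_0)
  then show "(\<lambda>P. - 1) \<in> poly_funs \<iota> n" by (metis poly_funs.const)
  have "\<iota> 1 = 1" using embedding by (simp add: field_embedding_def)
  then show "(\<lambda>P. 1) \<in> poly_funs \<iota> n" by (metis poly_funs.const)
qed

lemma poly_funs_uminus: "f \<in> poly_funs \<iota> n \<Longrightarrow> (\<lambda>P. - f P) \<in> poly_funs \<iota> n"
  using poly_funs.mult[OF const_neg_one, of f] by simp

lemma poly_funs_diff:
  "f \<in> poly_funs \<iota> n \<Longrightarrow> g \<in> poly_funs \<iota> n \<Longrightarrow> (\<lambda>P. f P - g P) \<in> poly_funs \<iota> n"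
  using poly_funs.add[of f \<iota> n "\<lambda>P. - g P"] poly_funs_uminus[of g] by simp

lemma poly_funs_power: "f \<in> poly_funs \<iota> n \<Longrightarrow> (\<lambda>P. f P ^ k) \<in> poly_funs \<iota> n"
  by (induction k) (auto intro: const_one poly_funs.mult)

lemma poly_funs_prod:
  "(\<And>i. i \<in> A \<Longrightarrow> f i \<in> poly_funs \<iota> n) \<Longrightarrow> (\<lambda>P. \<Prod>i\<in>A. f i P) \<in> poly_funs \<iota> n"
  by (induction A rule: infinite_finite_induct) (auto intro: const_one poly_funs.mult)

lemmas poly_intros = poly_funs.add poly_funs.mult poly_funs_diff poly_funs_uminus poly_funs_power
  const_one const_neg_one

lemma coordinate_polys:
  "i \<in> {1..int n} \<Longrightarrow> (\<lambda>P. coord P i) \<in> poly_funs \<iota> n"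
  "i \<in> {1..int n} \<Longrightarrow> (\<lambda>P. curvature P i) \<in> poly_funs \<iota> n"
  "mon_a \<in> poly_funs \<iota> n" "mon_b \<in> poly_funs \<iota> n" "mon_c \<in> poly_funs \<iota> n"
  by (rule poly_funs.coord, simp add: coords_def, blast)+
     (rule poly_funs.coord, simp add: coords_def, force)+

lemma hom_vertex_poly:
  assumes "i \<in> {1 - int n..2 * int n}"
  shows "(\<lambda>P. hom_vertex n P i $ 1) \<in> poly_funs \<iota> n" "(\<lambda>P. hom_vertex n P i $ 2) \<in> poly_funs \<iota> n"
proof -
  consider "i \<le> 0" "i + int n \<in> {1..int n}" | "i > 0" "i \<le> int n" "i \<in> {1..int n}"
    | "i > int n" "i > 0" "i - int n \<in> {1..int n}"
    using assms by fastforce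
  then have "(\<lambda>P. hom_vertex n P i $ 1) \<in> poly_funs \<iota> n \<and> (\<lambda>P. hom_vertex n P i $ 2) \<in> poly_funs \<iota> n"
    by cases (simp_all add: hom_vertex_def poly_intros coordinate_polys)
  then show "(\<lambda>P. hom_vertex n P i $ 1) \<in> poly_funs \<iota> n" "(\<lambda>P. hom_vertex n P i $ 2) \<in> poly_funs \<iota> n"
    by simp_all
qed

lemma det2_poly:
  assumes "i \<in> {1 - int n..2 * int n}" "j \<in> {1 - int n..2 * int n}"
  shows "(\<lambda>P. det2 (hom_vertex n P i) (hom_vertex n P j)) \<in> poly_funs \<iota> n"
  unfolding det2_def by (intro poly_intros hom_vertex_poly assms)

lemma chart_poly_poly: "chart_poly n \<in> poly_funs \<iota> n"
proof -
  have "(\<lambda>P. chart_poly n P) \<in> poly_funs \<iota> n"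
    unfolding chart_poly_def using n
    by (intro poly_funs_prod poly_funs.mult det2_poly coordinate_polys) auto
  then show ?thesis .
qed

definition family :: "(int \<Rightarrow> 'k poly) \<Rightarrow> (int \<Rightarrow> 'k poly) \<Rightarrow> 'k poly \<Rightarrow> 'k poly \<Rightarrow> 'k poly \<Rightarrow> 'k \<Rightarrow> 'k polygon" where
  "family X U A B C t =
     polygon_of n (\<lambda>i. poly (X i) t) (\<lambda>i. poly (U i) t) (poly A t) (poly B t) (poly C t)"

lemma family_coords:
  assumes "i \<in> {1..int n}"
  shows "coord (family X U A B C t) i = poly (X i) t" "curvature (family X U A B C t) i = poly (U i) t"
  using assms by (simp_all add: family_def polygon_of_simps)

lemma family_mon:
  assumes "poly A t - poly B t * poly C t \<noteq> 0"
  shows "mon_a (family X U A B C t) = poly A t" "mon_b (family X U A B C t) = poly B t"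
    "mon_c (family X U A B C t) = poly C t" "family X U A B C t \<in> prechart n"
  using pgl_coord_mon_mat[OF assms] polygon_of_prechart[OF _ assms, of n] n
  by (simp_all add: family_def polygon_of_def)

lemma coords_cases:
  assumes "c \<in> coords n"
  obtains i where "i \<in> {1..int n}" "c = (\<lambda>P. coord P i)"
    | i where "i \<in> {1..int n}" "c = (\<lambda>P. curvature P i)"
    | "c = mon_a" | "c = mon_b" | "c = mon_c"
proof -
  consider "\<exists>i \<in> {1..int n}. c = (\<lambda>P. coord P i)" | "\<exists>i \<in> {1..int n}. c = (\<lambda>P. curvature P i)"
    | k l where "c = (\<lambda>P. pgl_coord k l (monodromy P))" "(k, l) \<noteq> (2, 2)"
    using assms unfolding coords_def by blast
  then show thesis
  proof cases
    case 3
    then show ?thesis using that(3-5) exhaust_2[of k] exhaust_2[of l] by auto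
  qed (use that(1,2) in blast)+
qed

lemma family_poly:
  assumes "q \<in> poly_funs \<iota> n"
  shows "\<exists>R. \<forall>t. poly A t - poly B t * poly C t \<noteq> 0 \<longrightarrow> q (family X U A B C t) = poly R t"
  using assms
proof induction
  case (const c)
  have "\<forall>t. \<iota> c = poly [:\<iota> c:] t" by simp
  then show ?case by blast
next
  case (coord f)
  then show ?case
  proof (cases rule: coords_cases)
    case (1 i) then show ?thesis by (intro exI[of _ "X i"]) (simp add: family_coords)
  next
    case (2 i) then show ?thesis by (intro exI[of _ "U i"]) (simp add: family_coords)
  next
    case 3 then show ?thesis by (intro exI[of _ A]) (simp add: family_mon)
  next
    case 4 then show ?thesis by (intro exI[of _ B]) (simp add: family_mon)
  next
    case 5 then show ?thesis by (intro exI[of _ C]) (simp add: family_mon)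
  qed
next
  case (add f g)
  then obtain R S where "\<And>t. poly A t - poly B t * poly C t \<noteq> 0 \<Longrightarrow> f (family X U A B C t) = poly R t"
     "\<And>t. poly A t - poly B t * poly C t \<noteq> 0 \<Longrightarrow> g (family X U A B C t) = poly S t" by blast
  then show ?case by (intro exI[of _ "R + S"]) simp
next
  case (mult f g)
  then obtain R S where "\<And>t. poly A t - poly B t * poly C t \<noteq> 0 \<Longrightarrow> f (family X U A B C t) = poly R t"
     "\<And>t. poly A t - poly B t * poly C t \<noteq> 0 \<Longrightarrow> g (family X U A B C t) = poly S t" by blast
  then show ?case by (intro exI[of _ "R * S"]) simp
qed

lemma poly_funs_cong:
  assumes "q \<in> poly_funs \<iota> n" "\<And>c. c \<in> coords n \<Longrightarrow> c P = c Q"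
  shows "q P = q Q"
  using assms(1) by induction (auto simp: assms(2))

text \<open>A curve that meets the open set \<open>q \<noteq> 0\<close> at one parameter \<open>t0\<close> stays in it for almost all parameters,
  since a nonzero polynomial of one variable has finitely many roots. For this purpose only
  the coordinates of the curve at \<open>t0\<close> matter.\<close>

lemma family_generic:
  assumes q: "q \<in> poly_funs \<iota> n" and P: "P \<in> chart n" "q P \<noteq> 0"
    and at: "\<And>i. i \<in> {1..int n} \<Longrightarrow> poly (X i) t0 = coord P i"
      "\<And>i. i \<in> {1..int n} \<Longrightarrow> poly (U i) t0 = curvature P i"
      "poly A t0 = mon_a P" "poly B t0 = mon_b P" "poly C t0 = mon_c P"
  shows "\<forall>\<^sub>F t in cofinite. q (family X U A B C t) \<noteq> 0"
    and "\<forall>\<^sub>F t in cofinite. family X U A B C t \<in> chart n"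
proof -
  have "\<not> pgl_at_infinity (monodromy P)" using P by (simp add: chart_def)
  then have d0: "poly A t0 - poly B t0 * poly C t0 \<noteq> 0" using monodromy_mon_mat(2)[of P] by (simp add: at)
  then have "poly (A - B * C) t0 \<noteq> 0" by simp
  then have "A - B * C \<noteq> 0" by force
  from eventually_poly_nonzero[OF this]
  have det: "\<forall>\<^sub>F t in cofinite. poly A t - poly B t * poly C t \<noteq> 0" by simp
  have *: "\<forall>\<^sub>F t in cofinite. r (family X U A B C t) \<noteq> 0" if r: "r \<in> poly_funs \<iota> n" "r P \<noteq> 0" for r
  proof -
    obtain R where R: "\<And>t. poly A t - poly B t * poly C t \<noteq> 0 \<Longrightarrow> r (family X U A B C t) = poly R t"
      using family_poly[OF r(1)] by blast
    have "r (family X U A B C t0) = r P"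
    proof (rule poly_funs_cong[OF r(1)])
      fix c :: "'k polygon \<Rightarrow> 'k" assume "c \<in> coords n"
      then show "c (family X U A B C t0) = c P"
        by (cases rule: coords_cases) (simp_all add: family_coords family_mon[OF d0] at)
    qed
    then have "R \<noteq> 0" using R[OF d0] r(2) by auto
    from eventually_poly_nonzero[OF this] det show ?thesis
      by eventually_elim (simp add: R)
  qed
  show "\<forall>\<^sub>F t in cofinite. q (family X U A B C t) \<noteq> 0" by (rule *) fact+
  have "P \<in> prechart n" using P chart_subset_prechart by blast
  then have "chart_poly n P \<noteq> 0" using chart_iff_chart_poly n P by fastforce
  then have "\<forall>\<^sub>F t in cofinite. chart_poly n (family X U A B C t) \<noteq> 0"
    by (intro * chart_poly_poly)
  then show "\<forall>\<^sub>F t in cofinite. family X U A B C t \<in> chart n"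
    using det by eventually_elim (use family_mon chart_iff_chart_poly n in fastforce)
qed

text \<open>The line through a point where \<open>q\<close> does not vanish and a point where \<open>r\<close> does not vanish contains
  points where neither does.\<close>

lemma chart_irreducible:
  assumes q: "q \<in> poly_funs \<iota> n" "P \<in> chart n" "q P \<noteq> 0"
    and r: "r \<in> poly_funs \<iota> n" "Q \<in> chart n" "r Q \<noteq> 0"
  shows "\<exists>T \<in> chart n. q T \<noteq> 0 \<and> r T \<noteq> 0"
proof -
  define line :: "'k \<Rightarrow> 'k \<Rightarrow> 'k poly" where "line a b = [:a, b - a:]" for a b
  have line: "poly (line a b) 0 = a" "poly (line a b) 1 = b" for a b by (simp_all add: line_def)
  define T where "T = family (\<lambda>i. line (coord P i) (coord Q i)) (\<lambda>i. line (curvature P i) (curvature Q i))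
     (line (mon_a P) (mon_a Q)) (line (mon_b P) (mon_b Q)) (line (mon_c P) (mon_c Q))"
  have "\<forall>\<^sub>F t in cofinite. q (T t) \<noteq> 0" "\<forall>\<^sub>F t in cofinite. T t \<in> chart n"
    unfolding T_def by (rule family_generic[OF q, where ?t0.0 = 0]; simp add: line)+
  moreover have "\<forall>\<^sub>F t in cofinite. r (T t) \<noteq> 0"
    unfolding T_def by (rule family_generic[OF r, where ?t0.0 = 1]; simp add: line)
  ultimately have "\<forall>\<^sub>F t in cofinite. T t \<in> chart n \<and> q (T t) \<noteq> 0 \<and> r (T t) \<noteq> 0"
    by eventually_elim simp
  moreover have "(cofinite :: 'k filter) \<noteq> bot" using infinite by (simp add: cofinite_bot)
  ultimately show ?thesis using eventually_happens by blast
qed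

end
section \<open>Flips in coordinates\<close>

lemma pgl_act_hmap_affine:
  assumes "\<alpha> \<noteq> 0" "\<beta> \<noteq> 0" "b \<noteq> d" "(\<beta> - \<alpha>) * z - (\<beta> * b - \<alpha> * d) \<noteq> 0"
  shows "pgl_act (hmap \<alpha> \<beta> (affine_point b) (affine_point d)) (affine_point z) =
    affine_point (((\<beta> * d - \<alpha> * b) * z - (\<beta> - \<alpha>) * b * d) / ((\<beta> - \<alpha>) * z - (\<beta> * b - \<alpha> * d)))"
proof -
  let ?v = "hmat \<alpha> \<beta> (vector [b, 1]) (vector [d, 1]) *v vector [z, 1]"
  have ne: "point (vector [b, 1]) \<noteq> point (vector [d, 1])"
    using assms(3) by (simp flip: affine_point_def)
  have v: "?v $ 1 = (\<beta> * d - \<alpha> * b) * z - (\<beta> - \<alpha>) * b * d"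
    "?v $ 2 = (\<beta> - \<alpha>) * z - (\<beta> * b - \<alpha> * d)"
    by (simp_all add: hmat_def matrix_vector_mult_def sum_2)
  have "pgl_act (hmap \<alpha> \<beta> (affine_point b) (affine_point d)) (affine_point z) = point ?v"
    unfolding affine_point_def using assms(1,2) ne by (intro pgl_act_hmap) simp_all
  also have "\<dots> = affine_point (?v $ 1 / ?v $ 2)"
    by (rule point_affine) (use v assms(4) in simp)
  finally show ?thesis by (simp only: v)
qed

text \<open>Flipping all the vertices of a class modulo \<open>n\<close> is compatible with the monodromy.\<close>

lemma pgl_act_hmap_equivariant:
  "pgl_act (hmap \<alpha> \<beta> (pgl_act M b) (pgl_act M d)) (pgl_act M p) = pgl_act M (pgl_act (hmap \<alpha> \<beta> b d) p)"
proof (cases "\<alpha> = 0 \<or> \<beta> = 0 \<or> b = d")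
  case True then show ?thesis using hmap_trivial by metis
next
  case False
  obtain A where A: "det A \<noteq> 0" "M = abs_pgl2 A" by (rule pgl2_cases)
  obtain v where v: "v \<noteq> 0" "b = point v" by (rule point_cases)
  obtain w where w: "w \<noteq> 0" "d = point w" by (rule point_cases)
  obtain u where u: "u \<noteq> 0" "p = point u" by (rule point_cases)
  have ne: "point (A *v v) \<noteq> point (A *v w)"
    using pgl_act_eq_iff[of M b d] False A v w by (simp add: pgl_act_point)
  have h: "hmat \<alpha> \<beta> v w *v u \<noteq> 0" using False u v w by (intro pgl_act_hmap(2)) auto
  have "hmat \<alpha> \<beta> (A *v v) (A *v w) *v (A *v u) = det A *s (A *v (hmat \<alpha> \<beta> v w *v u))"
    unfolding hmat_mult_vec det2_matrix_vector_mult
    by (simp add: vec_eq_iff matrix_vector_mult_def sum_2 algebra_simps)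
  then show ?thesis
    using False A u v w ne h
    by (simp add: pgl_act_point pgl_act_hmap matrix_vector_mult_nonzero point_scale)
qed

lemma flip_prechart:
  assumes n: "n \<ge> 3" and j: "j \<in> {1..int n}" and P: "P \<in> prechart n"
    and fin: "\<not> at_infinity (vertex (flip n j P) j)"
  shows "flip n j P \<in> prechart n"
proof -
  have vp: "vertex P (i + int n) = pgl_act (monodromy P) (vertex P i)" for i
    using P by (simp add: prechart_def)
  have cp: "curvature P (i + int n) = curvature P i" for i
    using P by (simp add: prechart_def)
  have "vertex (flip n j P) (i + int n) = pgl_act (monodromy P) (vertex (flip n j P) i)" for i
  proof (cases "i mod int n = j mod int n")
    case True
    have s: "i + int n + 1 = i + 1 + int n" "i + int n - 1 = i - 1 + int n" by simp_all
    have True': "(i + int n) mod int n = j mod int n" using True by simp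
    show ?thesis
      unfolding vertex_flip(1)[OF True] vertex_flip(1)[OF True'] s vp cp
      by (rule pgl_act_hmap_equivariant)
  qed (simp add: vertex_flip vp)
  moreover have "curvature (flip n j P) (i + int n) = curvature (flip n j P) i" for i
    using n by (simp add: curvature_flip adj_swap_periodic cp)
  moreover have "\<not> at_infinity (vertex (flip n j P) i)" if i: "i \<in> {1..int n}" for i
  proof (cases "i = j")
    case False
    have "i mod int n \<noteq> j mod int n"
      using window_mod_eq_iff[OF i j] False by simp
    then show ?thesis using P i by (simp add: vertex_flip prechart_def)
  qed (use fin in simp)
  ultimately show ?thesis using P by (simp add: prechart_def monodromy_flip)
qed

section \<open>Families whose vertices have different orders\<close>

context flip_space
begin

text \<open>The asymptotic families. The exponent \<open>i + 1\<close> is nonnegative for the vertices at distance at most two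
  from \<open>1, \<dots>, n\<close>. The monodromy is the dilation by \<open>s\<^sup>-\<^sup>1 t\<^sup>n\<close> up to terms of higher order than these vertices, so that the leading terms at \<open>i + n\<close> are determined by those at \<open>i\<close>, in agreement
  with the same formula.\<close>

definition scaled_family :: "'k \<Rightarrow> int \<Rightarrow> ('k \<Rightarrow> 'k polygon) \<Rightarrow> bool" where
  "scaled_family s x Q \<longleftrightarrow> s \<noteq> 0 \<and> (\<forall>\<^sub>F t in cofinite. Q t \<in> prechart n) \<and>
     (\<forall>i\<in>{1..int n}. leading (\<lambda>t. coord (Q t) i) (nat (i + 1)) (s powi ((x - i) div int n))) \<and>
     (\<forall>i\<in>{1..int n}. leading (\<lambda>t. curvature (Q t) i) 0 (if i mod int n = x mod int n then s else 1)) \<and>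
     leading (\<lambda>t. mon_a (Q t)) n (inverse s) \<and>
     (\<exists>c. leading (\<lambda>t. mon_b (Q t)) (2 * n + 4) c) \<and> (\<exists>c. leading (\<lambda>t. mon_c (Q t)) (2 * n + 4) c)"

lemma scaled_family_vertex:
  assumes Q: "scaled_family s x Q" and i: "i \<in> {-1..int n + 2}"
  obtains f where "leading f (nat (i + 1)) (s powi ((x - i) div int n))"
    "\<forall>\<^sub>F t in cofinite. vertex (Q t) i = affine_point (f t)"
proof -
  have s: "s \<noteq> 0" and pre: "\<forall>\<^sub>F t in cofinite. Q t \<in> prechart n"
    and co: "\<And>i. i \<in> {1..int n} \<Longrightarrow> leading (\<lambda>t. coord (Q t) i) (nat (i + 1)) (s powi ((x - i) div int n))"
    and a: "leading (\<lambda>t. mon_a (Q t)) n (inverse s)"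
    using Q by (simp_all add: scaled_family_def)
  obtain b' c' where b: "leading (\<lambda>t. mon_b (Q t)) (2 * n + 4) b'"
    and c: "leading (\<lambda>t. mon_c (Q t)) (2 * n + 4) c'"
    using Q by (auto simp: scaled_family_def)
  define f where "f t = hom_vertex n (Q t) i $ 1 / hom_vertex n (Q t) i $ 2" for t
  consider "i \<le> 0" | "i \<in> {1..int n}" | "i > int n" by fastforce
  then have "leading f (nat (i + 1)) (s powi ((x - i) div int n)) \<and>
      (\<forall>\<^sub>F t in cofinite. hom_vertex n (Q t) i $ 2 \<noteq> 0)"
  proof cases
    case 1
    let ?k = "i + int n" and ?\<sigma> = "s powi ((x - (i + int n)) div int n)"
    have k: "?k \<in> {1..int n}" using 1 i n by auto
    have ord: "nat (?k + 1) = nat (i + 1) + n" using i 1 by auto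
    have num: "leading (\<lambda>t. coord (Q t) ?k - mon_b (Q t)) (nat (i + 1) + n) ?\<sigma>"
      using leading_add_smaller(2)[OF co[OF k] b] i 1 unfolding ord by simp
    have den: "leading (\<lambda>t. mon_a (Q t) - mon_c (Q t) * coord (Q t) ?k) n (inverse s)"
      using leading_add_smaller(2)[OF a leading_mult[OF c co[OF k]]] by simp
    have "x - i = (x - ?k) + int n" by simp
    then have "(x - i) div int n = (x - ?k) div int n + 1"
      using n by (simp only: div_add_self2)
    then have \<sigma>: "s powi ((x - i) div int n) = ?\<sigma> / inverse s"
      using s by (simp add: power_int_add divide_inverse)
    show ?thesis
      using leading_divide[OF num den] leading_nonzero[OF den] s 1
      by (simp add: f_def[abs_def] hom_vertex_def \<sigma>)
  next
    case 2
    then show ?thesis using co by (simp add: f_def[abs_def] hom_vertex_def)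
  next
    case 3
    let ?k = "i - int n" and ?\<sigma> = "s powi ((x - (i - int n)) div int n)"
    have k: "?k \<in> {1..int n}" using 3 i n by auto
    have ord: "n + nat (?k + 1) = nat (i + 1)" using i 3 by auto
    have num: "leading (\<lambda>t. mon_a (Q t) * coord (Q t) ?k + mon_b (Q t)) (nat (i + 1)) (inverse s * ?\<sigma>)"
      using leading_add_smaller(1)[OF leading_mult[OF a co[OF k]] b] i 3 unfolding ord by simp
    have den: "leading (\<lambda>t. mon_c (Q t) * coord (Q t) ?k + 1) 0 1"
      using leading_add_smaller(3)[OF leading_regular[OF regular_const[of 1]] leading_mult[OF c co[OF k]]]
      by simp
    have "x - ?k = (x - i) + int n" by simp
    then have "(x - ?k) div int n = (x - i) div int n + 1"
      using n by (simp only: div_add_self2)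
    then have \<sigma>: "s powi ((x - i) div int n) = (inverse s * ?\<sigma>) / 1"
      using s by (simp add: power_int_add)
    show ?thesis
      using leading_divide[of _ "nat (i + 1)" 0, OF _ den, of _ "inverse s * ?\<sigma>"] num leading_nonzero[OF den] s 3
      by (simp add: f_def[abs_def] hom_vertex_def \<sigma>)
  qed
  then have lead: "leading f (nat (i + 1)) (s powi ((x - i) div int n))"
    and nz: "\<forall>\<^sub>F t in cofinite. hom_vertex n (Q t) i $ 2 \<noteq> 0" by auto
  from pre nz have "\<forall>\<^sub>F t in cofinite. vertex (Q t) i = affine_point (f t)"
  proof eventually_elim
    case (elim t)
    have "i \<in> {1 - int n..2 * int n}" using i n by auto
    from vertex_hom_vertex(1)[OF elim(1) this] show ?case
      using point_affine[OF elim(2)] by (simp add: f_def)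
  qed
  with lead that show thesis by blast
qed

lemma scaled_family_curvature:
  assumes Q: "scaled_family s x Q"
  shows "leading (\<lambda>t. curvature (Q t) i) 0 (if i mod int n = x mod int n then s else 1)"
proof (rule periodic_all[of n "\<lambda>i. leading (\<lambda>t. curvature (Q t) i) 0 (if i mod int n = x mod int n then s else 1)"])
  fix i
  have pre: "\<forall>\<^sub>F t in cofinite. Q t \<in> prechart n" using Q by (simp add: scaled_family_def)
  have "\<forall>\<^sub>F t in cofinite. curvature (Q t) (i + int n) = curvature (Q t) i"
    using pre by eventually_elim (simp add: prechart_def)
  moreover have "\<forall>\<^sub>F t in cofinite. curvature (Q t) i = curvature (Q t) (i + int n)"
    using pre by eventually_elim (simp add: prechart_def)
  ultimately show "leading (\<lambda>t. curvature (Q t) (i + int n)) 0 (if (i + int n) mod int n = x mod int n then s else 1)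
    = leading (\<lambda>t. curvature (Q t) i) 0 (if i mod int n = x mod int n then s else 1)"
    using leading_cong by auto
qed (use Q n in \<open>simp_all add: scaled_family_def\<close>)

text \<open>Vertices of different orders are distinct for almost all \<open>t\<close>.\<close>

lemma scaled_family_chart:
  assumes Q: "scaled_family s x Q"
  shows "\<forall>\<^sub>F t in cofinite. Q t \<in> chart n"
proof -
  have s: "s \<noteq> 0" and pre: "\<forall>\<^sub>F t in cofinite. Q t \<in> prechart n"
    using Q by (simp_all add: scaled_family_def)
  have ne: "\<forall>\<^sub>F t in cofinite. vertex (Q t) i \<noteq> vertex (Q t) k"
    if "i < k" "i \<in> {-1..int n + 2}" "k \<in> {-1..int n + 2}" for i k
  proof -
    obtain f where f: "leading f (nat (i + 1)) (s powi ((x - i) div int n))"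
      "\<forall>\<^sub>F t in cofinite. vertex (Q t) i = affine_point (f t)"
      using scaled_family_vertex[OF Q \<open>i \<in> _\<close>] .
    obtain g where g: "leading g (nat (k + 1)) (s powi ((x - k) div int n))"
      "\<forall>\<^sub>F t in cofinite. vertex (Q t) k = affine_point (g t)"
      using scaled_family_vertex[OF Q \<open>k \<in> _\<close>] .
    have "leading (\<lambda>t. f t - g t) (nat (i + 1)) (s powi ((x - i) div int n))"
      by (rule leading_add_smaller(2)[OF f(1) g(1)]) (use that in auto)
    from leading_nonzero[OF this] s have "\<forall>\<^sub>F t in cofinite. f t - g t \<noteq> 0" by simp
    with f(2) g(2) show ?thesis by eventually_elim simp
  qed
  have "\<forall>\<^sub>F t in cofinite. \<forall>i\<in>{1..int n}. curvature (Q t) i \<noteq> 0 \<and>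
      vertex (Q t) i \<noteq> vertex (Q t) (i + 1) \<and> vertex (Q t) i \<noteq> vertex (Q t) (i + 2)"
    using s by (intro eventually_ball_finite ballI eventually_conj ne
        leading_nonzero[OF scaled_family_curvature[OF Q]]) auto
  with pre show ?thesis by eventually_elim (use chart_iff n in fastforce)
qed

text \<open>With \<open>z\<close> the vertex \<open>j\<close>, \<open>b\<close> the next and \<open>d\<close> the preceding one, \<open>d\<close> dominates \<open>z\<close>, which dominates \<open>b\<close>.
  So the numerator and the denominator of the flip formula reduce to \<open>\<beta> d z\<close> and \<open>\<alpha> d\<close>, and the new
  vertex is \<open>\<beta> z / \<alpha>\<close> to leading order. The factor \<open>\<beta> / \<alpha>\<close> is \<open>s\<close> if \<open>x\<close> moves up to a number congruent
  to \<open>j\<close>, its inverse if \<open>x\<close> moves down from one, and \<open>1\<close> otherwise, as \<open>adj_swap_div\<close>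
  requires.\<close>

lemma scaled_family_flip:
  assumes Q: "scaled_family s x Q" and j: "j \<in> {1..int n}"
  shows "scaled_family s (adj_swap n j x) (\<lambda>t. flip n j (Q t))"
proof -
  have n2: "n \<ge> 2" using n by simp
  have s: "s \<noteq> 0" and pre: "\<forall>\<^sub>F t in cofinite. Q t \<in> prechart n"
    and co: "\<And>i. i \<in> {1..int n} \<Longrightarrow> leading (\<lambda>t. coord (Q t) i) (nat (i + 1)) (s powi ((x - i) div int n))"
    using Q by (simp_all add: scaled_family_def)
  define k where "k = nat j"
  have k: "nat (j - 1 + 1) = k" "nat (j + 1) = k + 1" "nat (j + 1 + 1) = k + 2"
    using j by (auto simp: k_def)
  let ?\<sigma> = "\<lambda>i. s powi ((x - i) div int n)" and ?m = "\<lambda>i. if i mod int n = x mod int n then s else 1"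
  have nz: "?\<sigma> i \<noteq> 0" "?m i \<noteq> 0" for i using s by auto
  let ?\<alpha> = "\<lambda>t. curvature (Q t) j" and ?\<beta> = "\<lambda>t. curvature (Q t) (j - 1)"
  have \<alpha>: "leading ?\<alpha> 0 (?m j)" and \<beta>: "leading ?\<beta> 0 (?m (j - 1))"
    using scaled_family_curvature[OF Q] by blast+
  obtain d where d: "leading d k (?\<sigma> (j - 1))"
    "\<forall>\<^sub>F t in cofinite. vertex (Q t) (j - 1) = affine_point (d t)"
    using scaled_family_vertex[OF Q, of "j - 1", unfolded k] j by auto
  obtain z where z: "leading z (k + 1) (?\<sigma> j)"
    "\<forall>\<^sub>F t in cofinite. vertex (Q t) j = affine_point (z t)"
    using scaled_family_vertex[OF Q, of j, unfolded k] j by auto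
  obtain b where b: "leading b (k + 2) (?\<sigma> (j + 1))"
    "\<forall>\<^sub>F t in cofinite. vertex (Q t) (j + 1) = affine_point (b t)"
    using scaled_family_vertex[OF Q, of "j + 1", unfolded k] j by auto
  let ?num = "\<lambda>t. (?\<beta> t * d t - ?\<alpha> t * b t) * z t - (?\<beta> t - ?\<alpha> t) * b t * d t"
  let ?den = "\<lambda>t. (?\<beta> t - ?\<alpha> t) * z t - (?\<beta> t * b t - ?\<alpha> t * d t)"
  have \<beta>\<alpha>: "leading (\<lambda>t. ?\<beta> t - ?\<alpha> t) 0 (?m (j - 1) - ?m j)" using leading_diff[OF \<beta> \<alpha>] .
  have "leading (\<lambda>t. ?\<beta> t * d t - ?\<alpha> t * b t) k (?m (j - 1) * ?\<sigma> (j - 1))"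
    using leading_add_smaller(2)[OF leading_mult[OF \<beta> d(1)] leading_mult[OF \<alpha> b(1)]] by simp
  from leading_add_smaller(2)[OF leading_mult[OF this z(1)] leading_mult[OF leading_mult[OF \<beta>\<alpha> b(1)] d(1)]]
  have num: "leading ?num ((k + 1) + k) (?m (j - 1) * ?\<sigma> (j - 1) * ?\<sigma> j)" by (simp add: add.commute)
  have "leading (\<lambda>t. ?\<beta> t * b t - ?\<alpha> t * d t) k (- (?m j * ?\<sigma> (j - 1)))"
    using leading_add_smaller(4)[OF leading_mult[OF \<alpha> d(1)] leading_mult[OF \<beta> b(1)]] by simp
  from leading_add_smaller(4)[OF this leading_mult[OF \<beta>\<alpha> z(1)]]
  have den: "leading ?den k (?m j * ?\<sigma> (j - 1))" by simp
  have "leading (\<lambda>t. ?num t / ?den t) (k + 1) (?m (j - 1) * ?\<sigma> (j - 1) * ?\<sigma> j / (?m j * ?\<sigma> (j - 1)))"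
    by (rule leading_divide[OF num den]) (use nz in simp)
  moreover have "?m (j - 1) * ?\<sigma> (j - 1) * ?\<sigma> j / (?m j * ?\<sigma> (j - 1)) = s powi ((adj_swap n j x - j) div int n)"
    using s pred_mod_neq[OF n2, of j] by (auto simp: adj_swap_div[OF n2] power_int_add power_int_diff)
  ultimately have new: "leading (\<lambda>t. ?num t / ?den t) (nat (j + 1)) (s powi ((adj_swap n j x - j) div int n))"
    by (simp add: k)
  have mult_nz: "?m j * ?\<sigma> (j - 1) \<noteq> 0" using nz by simp
  have vnew: "\<forall>\<^sub>F t in cofinite. vertex (flip n j (Q t)) j = affine_point (?num t / ?den t)"
    using d(2) z(2) b(2) leading_nonzero[OF den mult_nz] leading_nonzero[OF \<alpha> nz(2)]
      leading_nonzero[OF \<beta> nz(2)] scaled_family_chart[OF Q]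
  proof eventually_elim
    case (elim t)
    have two: "j - 1 + 2 = j + 1" by simp
    have "vertex (Q t) (j - 1) \<noteq> vertex (Q t) (j - 1 + 2)"
      using elim(7) unfolding chart_def ngons_def by blast
    then have "b t \<noteq> d t" using elim(1,3) unfolding two by auto
    then show ?case
      using elim(1-3) pgl_act_hmap_affine[OF elim(5,6) _ elim(4)] by (simp add: vertex_flip)
  qed
  have pre': "\<forall>\<^sub>F t in cofinite. flip n j (Q t) \<in> prechart n"
    using pre vnew
  proof eventually_elim
    case (elim t)
    then show ?case by (intro flip_prechart[OF n j]) simp_all
  qed
  have "leading (\<lambda>t. coord (flip n j (Q t)) i) (nat (i + 1)) (s powi ((adj_swap n j x - i) div int n))"
    if i: "i \<in> {1..int n}" for i
  proof (cases "i = j")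
    case True
    have "\<forall>\<^sub>F t in cofinite. coord (flip n j (Q t)) j = ?num t / ?den t"
      using vnew by eventually_elim simp
    from leading_cong[OF new this] show ?thesis using True by simp
  next
    case False
    have "i mod int n \<noteq> j mod int n"
      using window_mod_eq_iff[OF i j] False by simp
    then show ?thesis using co[OF i] by (simp add: vertex_flip adj_swap_div[OF n2])
  qed
  moreover have "leading (\<lambda>t. curvature (flip n j (Q t)) i) 0 (if i mod int n = adj_swap n j x mod int n then s else 1)" for i
  proof -
    have "adj_swap n j i mod int n = x mod int n \<longleftrightarrow> i mod int n = adj_swap n j x mod int n"
      using adj_swap_cong[of "adj_swap n j i" n x j] adj_swap_cong[of i n "adj_swap n j x" j]
        adj_swap_involution[OF n2, of j] by (auto simp: fun_eq_iff)
    then show ?thesis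
      using scaled_family_curvature[OF Q, of "adj_swap n j i"] by (simp add: curvature_flip[OF n2])
  qed
  ultimately show ?thesis using Q pre' by (simp add: scaled_family_def monodromy_flip)
qed

text \<open>A scaled family can be led through an arbitrary point \<open>P\<close> at \<open>t = 1\<close>, by mixing the pure monomials
  with the coordinates of \<open>P\<close> in the proportion \<open>1 - t\<^sup>N\<close> to \<open>t\<^sup>N\<close>; for large \<open>N\<close> the leading terms at \<open>0\<close> are
  unaffected. Families through \<open>P\<close> inherit from it every open condition (\<open>family_generic\<close>).\<close>

lemma scaled_family_exists:
  fixes P :: "'k polygon"
  assumes s: "s \<noteq> 0"
  obtains X U A B C where "scaled_family s x (family X U A B C)"
    "\<And>i. poly (X i) 1 = coord P i" "\<And>i. poly (U i) 1 = curvature P i"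
    "poly A 1 = mon_a P" "poly B 1 = mon_b P" "poly C 1 = mon_c P"
proof -
  \<comment> \<open>larger than all exponents \<open>i + 1\<close> of the vertices up to \<open>n + 2\<close> and than \<open>n\<close>\<close>
  define N where "N = 2 * n + 4"
  define blend :: "'k \<Rightarrow> nat \<Rightarrow> 'k \<Rightarrow> 'k poly"
    where "blend c k v = (1 - monom 1 N) * monom c k + monom v N" for c k v
  have blend_1: "poly (blend c k v) 1 = v" for c k v
    by (simp add: blend_def poly_monom)
  have blend_lead: "leading (poly (blend c k v)) k c" if "k < N" for c k v
  proof -
    have a: "leading (\<lambda>t. c * t ^ k) k c" by (rule leading_monom)
    have "leading (\<lambda>t. 1 - 1 * t ^ N) 0 (1::'k)"
      by (rule leading_add_smaller(2)[OF leading_regular[OF regular_const] leading_monom])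
        (use that in simp)
    from leading_mult[OF this a] have "leading (\<lambda>t. (1 - t ^ N) * (c * t ^ k)) k c" by simp
    from leading_add_smaller(1)[OF this leading_monom that, of v]
    show ?thesis by (rule leading_cong) (simp add: blend_def poly_monom)
  qed
  define X where "X i = blend (s powi ((x - i) div int n)) (nat (i + 1)) (coord P i)" for i
  define U where "U i = blend (if i mod int n = x mod int n then s else 1) 0 (curvature P i)" for i
  define A where "A = blend (inverse s) n (mon_a P)"
  define B where "B = monom (mon_b P) N"
  define C where "C = monom (mon_c P) N"
  let ?Q = "family X U A B C"
  have A: "leading (poly A) n (inverse s)" unfolding A_def by (rule blend_lead) (simp add: N_def)
  have B: "leading (poly B) N (mon_b P)"
    using leading_monom[of "mon_b P" N] by (simp add: B_def poly_monom[abs_def])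
  have C: "leading (poly C) N (mon_c P)"
    using leading_monom[of "mon_c P" N] by (simp add: C_def poly_monom[abs_def])
  have "leading (\<lambda>t. poly A t - poly B t * poly C t) n (inverse s)"
    by (rule leading_add_smaller(2)[OF A leading_mult[OF B C]]) (simp add: N_def)
  then have det: "\<forall>\<^sub>F t in cofinite. poly A t - poly B t * poly C t \<noteq> 0"
    using s by (auto dest: leading_nonzero)
  have "leading (\<lambda>t. mon_a (?Q t)) n (inverse s)" "leading (\<lambda>t. mon_b (?Q t)) N (mon_b P)"
      "leading (\<lambda>t. mon_c (?Q t)) N (mon_c P)"
    by (rule leading_cong[OF A] leading_cong[OF B] leading_cong[OF C],
        use det in eventually_elim, simp add: family_mon)+
  moreover have "\<forall>\<^sub>F t in cofinite. ?Q t \<in> prechart n"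
    using det by eventually_elim (simp add: family_mon)
  moreover have "leading (\<lambda>t. coord (?Q t) i) (nat (i + 1)) (s powi ((x - i) div int n))"
    if i: "i \<in> {1..int n}" for i
  proof -
    have "leading (poly (X i)) (nat (i + 1)) (s powi ((x - i) div int n))"
      unfolding X_def by (rule blend_lead) (use i in \<open>auto simp: N_def\<close>)
    then show ?thesis using i by (simp add: family_coords)
  qed
  moreover have "leading (\<lambda>t. curvature (?Q t) i) 0 (if i mod int n = x mod int n then s else 1)"
    if i: "i \<in> {1..int n}" for i
  proof -
    have "leading (poly (U i)) 0 (if i mod int n = x mod int n then s else 1)"
      unfolding U_def by (rule blend_lead) (simp add: N_def)
    then show ?thesis using i by (simp add: family_coords)
  qed
  ultimately have "scaled_family s x ?Q"
    using s unfolding scaled_family_def N_def[symmetric] by blast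
  moreover have "poly (X i) 1 = coord P i" "poly (U i) 1 = curvature P i" for i
    by (simp_all add: X_def U_def blend_1)
  moreover have "poly A 1 = mon_a P" "poly B 1 = mon_b P" "poly C 1 = mon_c P"
    by (simp_all add: A_def B_def C_def blend_1 poly_monom)
  ultimately show thesis by (rule that)
qed

section \<open>Generic polygons\<close>

lemma cofinite_happens: "\<forall>\<^sub>F t :: 'k in cofinite. R t \<Longrightarrow> \<exists>t. R t"
  using infinite eventually_happens[of R "cofinite"] by (auto simp: cofinite_bot)

text \<open>The open set of polygons that can be flipped inside the chart is nonempty: a scaled family
  meets it.\<close>

lemma flip_chart_witness:
  assumes "j \<in> {1..int n}"
  obtains P :: "'k polygon" where "P \<in> chart n" "flip n j P \<in> chart n"
proof -
  obtain X U A B C where "scaled_family 1 0 (family X U A B C)"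
    by (rule scaled_family_exists[OF one_neq_zero, of 0 undefined]) (rule that)
  from scaled_family_chart[OF this] scaled_family_chart[OF scaled_family_flip[OF this assms]]
  have "\<forall>\<^sub>F t in cofinite. family X U A B C t \<in> chart n \<and> flip n j (family X U A B C t) \<in> chart n"
    by eventually_elim simp
  from cofinite_happens[OF this] that show thesis by blast
qed

lemma chart_nonempty: "chart n \<noteq> ({} :: 'k polygon set)"
  using flip_chart_witness[of 1] n by fastforce

lemma eventually_generic:
  "(\<forall>\<^sub>F P in generic \<iota> n. R P) \<longleftrightarrow>
   (\<exists>q \<in> poly_funs \<iota> n. (\<exists>P \<in> chart n. q P \<noteq> 0) \<and> (\<forall>P \<in> chart n. q P \<noteq> 0 \<longrightarrow> R P))"
proof -
  let ?B = "{q \<in> poly_funs \<iota> n. \<exists>P\<in>chart n. q P \<noteq> 0}"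
  have "(\<forall>\<^sub>F P in generic \<iota> n. R P) \<longleftrightarrow>
      (\<exists>q \<in> ?B. eventually R (principal {P \<in> chart n. q P \<noteq> 0}))"
    unfolding generic_def
  proof (rule eventually_INF_base)
    show "?B \<noteq> {}" using const_one chart_nonempty by force
  next
    fix q r assume "q \<in> ?B" "r \<in> ?B"
    then have "(\<lambda>P. q P * r P) \<in> ?B"
      using chart_irreducible[of q _ r] poly_funs.mult[of q \<iota> n r] by fastforce
    moreover have "principal {P \<in> chart n. q P * r P \<noteq> 0} \<le>
        inf (principal {P \<in> chart n. q P \<noteq> 0}) (principal {P \<in> chart n. r P \<noteq> 0})"
      by auto
    ultimately show "\<exists>t \<in> ?B. principal {P \<in> chart n. t P \<noteq> 0} \<le>
        inf (principal {P \<in> chart n. q P \<noteq> 0}) (principal {P \<in> chart n. r P \<noteq> 0})"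
      by (intro bexI[of _ "\<lambda>P. q P * r P"])
  qed
  then show ?thesis by (simp add: eventually_principal) blast
qed

lemma eventually_generic_chart: "\<forall>\<^sub>F P in generic \<iota> n. (P :: 'k polygon) \<in> chart n"
  unfolding eventually_generic using const_one chart_nonempty by force

lemma eventually_generic_poly:
  "q \<in> poly_funs \<iota> n \<Longrightarrow> P \<in> chart n \<Longrightarrow> q P \<noteq> 0 \<Longrightarrow> \<forall>\<^sub>F P in generic \<iota> n. q P \<noteq> 0"
  unfolding eventually_generic by blast

section \<open>Flips are birational\<close>

text \<open>The representative of an index in the period \<open>1, \<dots>, n\<close> used by the coordinates.\<close>

definition rep_index :: "int \<Rightarrow> int" where "rep_index i = (i - 1) mod int n + 1"

lemma rep_index: "rep_index i \<in> {1..int n}" "rep_index i mod int n = i mod int n"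
  using n mod_add_left_eq[of "i - 1" "int n" 1] pos_mod_bound[of "int n" "i - 1"]
  by (auto simp: rep_index_def add1_zle_eq)

lemma curvature_rep_index:
  assumes "P \<in> prechart n" shows "curvature P (rep_index i) = curvature P i"
proof -
  have "rep_index (i + int n) = rep_index i" for i
    by (simp add: rep_index_def mod_eq_shift[of "i - 1" "int n" "int n", simplified] diff_add_eq[symmetric])
  moreover have "rep_index i = i" if "i \<in> {1..int n}" for i
    using that by (simp add: rep_index_def)
  ultimately show ?thesis
    using assms periodic_all[of n "\<lambda>i. curvature P (rep_index i) = curvature P i" i] n
    by (simp add: prechart_def)
qed

definition hom_flip :: "int \<Rightarrow> 'k polygon \<Rightarrow> 'k ^ 2" where
  "hom_flip j P = hmat (curvature P j) (curvature P (rep_index (j - 1)))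
     (hom_vertex n P (j + 1)) (hom_vertex n P (j - 1)) *v hom_vertex n P j"

context
  fixes j :: int
  assumes j: "j \<in> {1..int n}"
begin

lemma hom_flip_poly:
  "(\<lambda>P. hom_flip j P $ 1) \<in> poly_funs \<iota> n" "(\<lambda>P. hom_flip j P $ 2) \<in> poly_funs \<iota> n"
proof -
  have range: "j - 1 \<in> {1 - int n..2 * int n}" "j \<in> {1 - int n..2 * int n}" "j + 1 \<in> {1 - int n..2 * int n}"
    using j n by auto
  show "(\<lambda>P. hom_flip j P $ 1) \<in> poly_funs \<iota> n"
    unfolding hom_flip_def hmat_mult_vec vector_add_component vector_smult_component
    by (intro poly_intros det2_poly hom_vertex_poly coordinate_polys j rep_index range)
  show "(\<lambda>P. hom_flip j P $ 2) \<in> poly_funs \<iota> n"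
    unfolding hom_flip_def hmat_mult_vec vector_add_component vector_smult_component
    by (intro poly_intros det2_poly hom_vertex_poly coordinate_polys j rep_index range)
qed

lemma vertex_flip_hom:
  assumes P: "P \<in> chart n"
  shows "vertex (flip n j P) j = point (hom_flip j P)" "hom_flip j P \<noteq> 0"
proof -
  have pre: "P \<in> prechart n" using P chart_subset_prechart by blast
  have "j - 1 \<in> {1 - int n..2 * int n}" "j \<in> {1 - int n..2 * int n}" "j + 1 \<in> {1 - int n..2 * int n}"
    using j n by auto
  note v = this[THEN vertex_hom_vertex(1)[OF pre]] this[THEN vertex_hom_vertex(2)[OF pre]]
  have two: "j - 1 + 2 = j + 1" by simp
  have "vertex P (j - 1) \<noteq> vertex P (j - 1 + 2)" using P unfolding chart_def ngons_def by blast
  then have ne: "point (hom_vertex n P (j + 1)) \<noteq> point (hom_vertex n P (j - 1))"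
    unfolding two v by simp
  have c: "curvature P i \<noteq> 0" for i using P by (simp add: chart_def ngons_def)
  show "vertex (flip n j P) j = point (hom_flip j P)" "hom_flip j P \<noteq> 0"
    using pgl_act_hmap[OF c c v(6) v(4) v(5) ne, of j "j - 1"]
    by (simp_all add: vertex_flip(1) v(1-3) hom_flip_def curvature_rep_index[OF pre])
qed

lemma flip_in_prechart:
  assumes P: "P \<in> chart n" and w: "hom_flip j P $ 2 \<noteq> 0"
  shows "flip n j P \<in> prechart n" "coord (flip n j P) j = hom_flip j P $ 1 / hom_flip j P $ 2"
proof -
  note v = vertex_flip_hom[OF P]
  show "coord (flip n j P) j = hom_flip j P $ 1 / hom_flip j P $ 2"
    unfolding v(1) using v(2) by (rule affine_coord_point)
  have "\<not> at_infinity (vertex (flip n j P) j)"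
    unfolding v(1) using v(2) w by (simp add: at_infinity_point)
  then show "flip n j P \<in> prechart n"
    using flip_prechart[OF n j] P chart_subset_prechart by blast
qed

lemma hom_flip_nonzero:
  assumes "P \<in> chart n" "flip n j P \<in> chart n" shows "hom_flip j P $ 2 \<noteq> 0"
proof -
  have "\<not> at_infinity (vertex (flip n j P) j)" using assms(2) j by (simp add: chart_def)
  then show ?thesis using vertex_flip_hom[OF assms(1)] by (simp add: at_infinity_point)
qed

text \<open>Pulling a polynomial back along a flip only introduces powers of the second homogeneous coordinate of
  the flipped vertex as denominator.\<close>

lemma flip_pullback:
  assumes "q \<in> poly_funs \<iota> n"
  shows "\<exists>num \<in> poly_funs \<iota> n. \<exists>k. \<forall>P \<in> chart n. hom_flip j P $ 2 \<noteq> 0 \<longrightarrow>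
    q (flip n j P) * hom_flip j P $ 2 ^ k = num P"
  using assms
proof induction
  case (const c)
  show ?case by (intro bexI[of _ "\<lambda>P. \<iota> c"] exI[of _ 0] poly_funs.const) simp
next
  case (coord f)
  then show ?case
  proof (cases rule: coords_cases)
    case (1 i)
    show ?thesis
    proof (cases "i = j")
      case True
      then show ?thesis using 1 flip_in_prechart(2)
        by (intro bexI[of _ "\<lambda>P. hom_flip j P $ 1"] exI[of _ 1] hom_flip_poly) simp
    next
      case False
      then have "i mod int n \<noteq> j mod int n" using window_mod_eq_iff[OF 1(1) j] by simp
      then show ?thesis using 1
        by (intro bexI[of _ "\<lambda>P. coord P i"] exI[of _ 0] coordinate_polys) (simp_all add: vertex_flip)
    qed
  next
    case (2 i)
    have "curvature (flip n j P) i = curvature P (rep_index (adj_swap n j i))" if "P \<in> chart n" for P :: "'k polygon"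
    proof -
      have "P \<in> prechart n" using that chart_subset_prechart by blast
      then show ?thesis using n by (simp add: curvature_flip curvature_rep_index)
    qed
    then show ?thesis using 2
      by (intro bexI[of _ "\<lambda>P. curvature P (rep_index (adj_swap n j i))"] exI[of _ 0]
          coordinate_polys rep_index) simp
  next
    case 3 then show ?thesis
      by (intro bexI[of _ mon_a] exI[of _ 0] coordinate_polys) (simp add: monodromy_flip)
  next
    case 4 then show ?thesis
      by (intro bexI[of _ mon_b] exI[of _ 0] coordinate_polys) (simp add: monodromy_flip)
  next
    case 5 then show ?thesis
      by (intro bexI[of _ mon_c] exI[of _ 0] coordinate_polys) (simp add: monodromy_flip)
  qed
next
  case (add f g)
  then obtain f' k g' l where f: "f' \<in> poly_funs \<iota> n"
      "\<And>P. P \<in> chart n \<Longrightarrow> hom_flip j P $ 2 \<noteq> 0 \<Longrightarrow> f (flip n j P) * hom_flip j P $ 2 ^ k = f' P"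
    and g: "g' \<in> poly_funs \<iota> n"
      "\<And>P. P \<in> chart n \<Longrightarrow> hom_flip j P $ 2 \<noteq> 0 \<Longrightarrow> g (flip n j P) * hom_flip j P $ 2 ^ l = g' P"
    by blast
  show ?case
    by (intro bexI[of _ "\<lambda>P. f' P * hom_flip j P $ 2 ^ l + g' P * hom_flip j P $ 2 ^ k"] exI[of _ "k + l"]
        poly_intros hom_flip_poly f(1) g(1))
      (simp add: power_add algebra_simps flip: f(2) g(2))
next
  case (mult f g)
  then obtain f' k g' l where f: "f' \<in> poly_funs \<iota> n"
      "\<And>P. P \<in> chart n \<Longrightarrow> hom_flip j P $ 2 \<noteq> 0 \<Longrightarrow> f (flip n j P) * hom_flip j P $ 2 ^ k = f' P"
    and g: "g' \<in> poly_funs \<iota> n"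
      "\<And>P. P \<in> chart n \<Longrightarrow> hom_flip j P $ 2 \<noteq> 0 \<Longrightarrow> g (flip n j P) * hom_flip j P $ 2 ^ l = g' P"
    by blast
  show ?case
    by (intro bexI[of _ "\<lambda>P. f' P * g' P"] exI[of _ "k + l"] poly_intros f(1) g(1))
      (simp add: power_add mult_ac flip: f(2) g(2))
qed

lemma flip_chart_poly:
  obtains E where "E \<in> poly_funs \<iota> n"
    "\<And>P. P \<in> chart n \<Longrightarrow> E P \<noteq> 0 \<longleftrightarrow> flip n j P \<in> chart n"
    "\<And>P. P \<in> chart n \<Longrightarrow> E P \<noteq> 0 \<Longrightarrow> hom_flip j P $ 2 \<noteq> 0"
proof -
  obtain D k where D: "D \<in> poly_funs \<iota> n"
    "\<And>P. P \<in> chart n \<Longrightarrow> hom_flip j P $ 2 \<noteq> 0 \<Longrightarrow> chart_poly n (flip n j P) * hom_flip j P $ 2 ^ k = D P"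
    using flip_pullback[OF chart_poly_poly] by blast
  show thesis
  proof (rule that[of "\<lambda>P. hom_flip j P $ 2 * D P"])
    fix P :: "'k polygon" assume P: "P \<in> chart n"
    show "hom_flip j P $ 2 * D P \<noteq> 0 \<longleftrightarrow> flip n j P \<in> chart n"
    proof (cases "hom_flip j P $ 2 = 0")
      case True
      then show ?thesis using hom_flip_nonzero[OF P] by auto
    next
      case False
      have "flip n j P \<in> chart n \<longleftrightarrow> chart_poly n (flip n j P) \<noteq> 0"
        using chart_iff_chart_poly[OF flip_in_prechart(1)[OF P False]] n by simp
      then show ?thesis using D(2)[OF P False] False by (metis mult_eq_0_iff power_not_zero)
    qed
  qed (auto intro: poly_intros hom_flip_poly D)
qed

text \<open>The pullback of \<open>q\<close> is not identically zero: since flips are involutions, it is nonzero at \<open>flip T\<close> if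
  \<open>q\<close> is nonzero at \<open>T\<close>, and \<open>T\<close> can be chosen such that \<open>flip T\<close> is in the chart too.\<close>

lemma filterlim_flip_window: "filterlim (flip n j) (generic \<iota> n) (generic \<iota> n)"
  unfolding filterlim_iff
proof (intro allI impI)
  fix R :: "'k polygon \<Rightarrow> bool" assume "\<forall>\<^sub>F P in generic \<iota> n. R P"
  then obtain q P where q: "q \<in> poly_funs \<iota> n" "P \<in> chart n" "q P \<noteq> 0"
    and R: "\<And>P. P \<in> chart n \<Longrightarrow> q P \<noteq> 0 \<Longrightarrow> R P" unfolding eventually_generic by blast
  obtain E where E: "E \<in> poly_funs \<iota> n" "\<And>P. P \<in> chart n \<Longrightarrow> E P \<noteq> 0 \<longleftrightarrow> flip n j P \<in> chart n"
    "\<And>P. P \<in> chart n \<Longrightarrow> E P \<noteq> 0 \<Longrightarrow> hom_flip j P $ 2 \<noteq> 0" using flip_chart_poly by blast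
  obtain D k where D: "D \<in> poly_funs \<iota> n"
    "\<And>P. P \<in> chart n \<Longrightarrow> hom_flip j P $ 2 \<noteq> 0 \<Longrightarrow> q (flip n j P) * hom_flip j P $ 2 ^ k = D P"
    using flip_pullback[OF q(1)] by blast
  obtain S :: "'k polygon" where S: "S \<in> chart n" "flip n j S \<in> chart n"
    using flip_chart_witness[OF j] by blast
  then obtain T where T: "T \<in> chart n" "q T \<noteq> 0" "E T \<noteq> 0"
    using chart_irreducible[OF q E(1), of S] E(2) by blast
  \<comment> \<open>the witness is a flipped polygon, because the pullback of \<open>q\<close> is evaluated by flipping back\<close>
  let ?P = "flip n j T"
  have P: "?P \<in> chart n" "flip n j ?P = T" using T E(2) flip_involution[OF n] by auto
  then have EP: "E ?P \<noteq> 0" using E(2) T by simp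
  have "D ?P \<noteq> 0" using D(2)[OF P(1) E(3)[OF P(1) EP]] E(3)[OF P(1) EP] P(2) T(2) by auto
  show "\<forall>\<^sub>F P in generic \<iota> n. R (flip n j P)"
    unfolding eventually_generic
  proof (intro bexI conjI ballI impI)
    show "(\<lambda>P. E P * D P) \<in> poly_funs \<iota> n" by (intro poly_intros E D)
    show "E ?P * D ?P \<noteq> 0" using EP \<open>D ?P \<noteq> 0\<close> by simp
    show "?P \<in> chart n" by fact
    fix P :: "'k polygon" assume P: "P \<in> chart n" "E P * D P \<noteq> 0"
    then have "flip n j P \<in> chart n" "hom_flip j P $ 2 \<noteq> 0" using E by auto
    moreover from this D(2)[OF P(1)] P(2) have "q (flip n j P) \<noteq> 0" by auto
    ultimately show "R (flip n j P)" by (intro R)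
  qed
qed

lemma rational_map_flip: "rational_map \<iota> n (flip n j)"
  unfolding rational_map_def
proof
  fix c :: "'k polygon \<Rightarrow> 'k" assume "c \<in> coords n"
  then have "c \<in> poly_funs \<iota> n" by (rule poly_funs.coord)
  from flip_pullback[OF this] obtain num k where num: "num \<in> poly_funs \<iota> n"
    "\<And>P. P \<in> chart n \<Longrightarrow> hom_flip j P $ 2 \<noteq> 0 \<Longrightarrow> c (flip n j P) * hom_flip j P $ 2 ^ k = num P"
    by blast
  obtain S :: "'k polygon" where S: "S \<in> chart n" "flip n j S \<in> chart n"
    using flip_chart_witness[OF j] by blast
  have "\<forall>\<^sub>F P in generic \<iota> n. hom_flip j P $ 2 \<noteq> 0"
    by (rule eventually_generic_poly[OF hom_flip_poly(2) S(1) hom_flip_nonzero[OF S]])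
  with eventually_generic_chart
  have "\<forall>\<^sub>F P in generic \<iota> n. hom_flip j P $ 2 ^ k \<noteq> 0 \<and> c (flip n j P) = num P / hom_flip j P $ 2 ^ k"
    by eventually_elim (simp add: num(2)[symmetric])
  then show "\<exists>num\<in>poly_funs \<iota> n. \<exists>den\<in>poly_funs \<iota> n.
      \<forall>\<^sub>F P in generic \<iota> n. den P \<noteq> 0 \<and> c (flip n j P) = num P / den P"
    by (intro bexI[of _ num] bexI[of _ "\<lambda>P. hom_flip j P $ 2 ^ k"] poly_intros hom_flip_poly num)
qed

lemma birational_map_flip: "birational_map \<iota> n (flip n j)"
  unfolding birational_map_def dominant_map_def
  using rational_map_flip filterlim_flip_window
  by (auto simp: flip_involution[OF n] intro!: exI[of _ "flip n j"])

end

section \<open>Words in the flips\<close>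

lemma filterlim_flip: "filterlim (flip n j :: 'k polygon \<Rightarrow> _) (generic \<iota> n) (generic \<iota> n)"
  using filterlim_flip_window[OF rep_index(1)[of j]] flip_mod[OF rep_index(2)[of j]] by metis

abbreviation flip_word :: "int word \<Rightarrow> 'k polygon \<Rightarrow> 'k polygon" where
  "flip_word \<equiv> word_map (flip n)"

lemma filterlim_flip_word: "filterlim (flip_word u) (generic \<iota> n) (generic \<iota> n)"
proof (induction u)
  case Nil then show ?case by (simp add: id_def filterlim_ident)
next
  case (Cons l u)
  from filterlim_compose[OF filterlim_flip this] show ?case by (simp add: comp_def)
qed

lemma eventually_flip_word:
  "\<forall>\<^sub>F P in generic \<iota> n. R P \<Longrightarrow> \<forall>\<^sub>F P in generic \<iota> n. R (flip_word u P)"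
  using filterlim_flip_word unfolding filterlim_iff by blast

lemma eventually_flip_word_ngon: "\<forall>\<^sub>F P in generic \<iota> n. flip_word u P \<in> ngons n"
  using eventually_flip_word[OF eventually_generic_chart, of u]
  by eventually_elim (simp add: chart_def)

lemma flip_relation_holds:
  assumes "(r, r') \<in> flip_relations n"
  shows "\<forall>\<^sub>F P in generic \<iota> n. flip_word r P = flip_word r' P"
proof -
  consider i where "r = [(i, True), (i, True)]" "r' = []"
    | i j where "r = [(i, True), (j, True)]" "r' = [(j, True), (i, True)]" "cyclic_dist n i j \<ge> 2"
    | i j where "r = [(i, True), (j, True), (i, True)]" "r' = [(j, True), (i, True), (j, True)]"
        "j mod int n = (i + 1) mod int n"
    using assms unfolding flip_relations_def by blast
  then show ?thesis
  proof cases
    case 1 then show ?thesis by (simp add: flip_involution[OF n])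
  next
    case 2
    have "flip_word r P = flip_word r' P" for P
      using flip_commute[OF n 2(3), of P] by (simp add: 2(1,2))
    then show ?thesis by simp
  next
    case 3
    from eventually_flip_word_ngon[of "[]"] eventually_flip_word_ngon[of "[(i, True)]"]
      eventually_flip_word_ngon[of "[(j, True)]"] eventually_flip_word_ngon[of "[(j, True), (i, True)]"]
      eventually_flip_word_ngon[of "[(i, True), (j, True)]"]
    show ?thesis unfolding 3(1,2)
      by eventually_elim (simp add: flip_braid[OF n 3(3)])
  qed
qed

lemma flip_word_invariant:
  assumes "flip_equiv n u v"
  shows "\<forall>\<^sub>F P in generic \<iota> n. flip_word u P = flip_word v P"
  using assms
proof (induction rule: word_equiv.induct)
  case (sym u v)
  from sym.IH show ?case by eventually_elim simp
next
  case (trans u v w)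
  from trans.IH show ?case by eventually_elim simp
next
  case (cancel g u b v)
  show ?case by (simp add: word_map_append flip_involution[OF n])
next
  case (relation r r' u v)
  from eventually_flip_word[OF flip_relation_holds[OF relation], of v]
  show ?case by eventually_elim (simp add: word_map_append)
qed simp

lemma scaled_family_word:
  assumes "scaled_family s x Q" "u \<in> flip_words n"
  shows "scaled_family s (word_perm n u x) (\<lambda>t. flip_word u (Q t))"
  using assms(2) by (induction u) (auto intro: scaled_family_flip simp: assms(1))

lemma exists_non_root_of_unity: "d > 0 \<Longrightarrow> \<exists>s :: 'k. s \<noteq> 0 \<and> s ^ d \<noteq> 1"
proof -
  assume d: "d > 0"
  have "poly (monom 1 d - 1 :: 'k poly) 0 \<noteq> 0" using d by (simp add: poly_monom power_0_left)
  then have "monom 1 d - 1 \<noteq> (0 :: 'k poly)" by force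
  from eventually_poly_nonzero[OF this] eventually_cofinite_nonzero
  have "\<forall>\<^sub>F s :: 'k in cofinite. s \<noteq> 0 \<and> s ^ d \<noteq> 1" by eventually_elim (simp add: poly_monom)
  from cofinite_happens[OF this] show ?thesis .
qed

text \<open>If \<open>x < y\<close>, the floors of \<open>(x - i) / n\<close> and \<open>(y - i) / n\<close> differ for the \<open>i\<close> congruent to \<open>y\<close>.\<close>

lemma div_window_inj:
  assumes "\<And>i. i \<in> {1..int n} \<Longrightarrow> (x - i) div int n = (y - i) div int n"
  shows "x = y"
proof -
  have np: "int n > 0" using n by simp
  have *: "y \<le> x" if e: "\<And>i. i \<in> {1..int n} \<Longrightarrow> (x - i) div int n = (y - i) div int n" for x y :: int
  proof -
    \<comment> \<open>for the \<open>i\<close> congruent to \<open>y\<close> the division of \<open>y - i\<close> by \<open>n\<close> is exact\<close>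
    have "int n dvd y - rep_index y" using rep_index(2)[of y] by (metis mod_eq_dvd_iff)
    then have "y - rep_index y = int n * ((y - rep_index y) div int n)" by simp
    also have "\<dots> = int n * ((x - rep_index y) div int n)" using e rep_index(1) by simp
    also have "\<dots> \<le> x - rep_index y" using mult_div_mod_eq[of "int n" "x - rep_index y"]
        pos_mod_sign[OF np, of "x - rep_index y"] by linarith
    finally show ?thesis by simp
  qed
  show ?thesis using *[of x y] *[of y x] assms by fastforce
qed

text \<open>Along a scaled family that starts at position \<open>x\<close> and meets the open set where the word acts trivially,
  the word moves the position to the image of \<open>x\<close>, but it must not change any leading coefficient.\<close>

lemma flip_word_faithful:
  assumes u: "u \<in> flip_words n" and id: "\<forall>\<^sub>F P in generic \<iota> n. flip_word u P = P"
  shows "word_perm n u = id"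
proof
  fix x
  let ?y = "word_perm n u x"
  obtain q P where q: "q \<in> poly_funs \<iota> n" "P \<in> chart n" "q P \<noteq> 0"
    and fixed: "\<And>P. P \<in> chart n \<Longrightarrow> q P \<noteq> 0 \<Longrightarrow> flip_word u P = P"
    using id unfolding eventually_generic by blast
  have *: "s powi ((?y - i) div int n) = s powi ((x - i) div int n)"
    if s: "s \<noteq> 0" and i: "i \<in> {1..int n}" for s :: 'k and i
  proof -
    obtain X U A B C where Q: "scaled_family s x (family X U A B C)"
      and one: "\<And>i. poly (X i) 1 = coord P i" "\<And>i. poly (U i) 1 = curvature P i"
      "poly A 1 = mon_a P" "poly B 1 = mon_b P" "poly C 1 = mon_c P"
      by (rule scaled_family_exists[OF s, of x P]) (rule that)
    let ?Q = "family X U A B C"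
    have "\<forall>\<^sub>F t in cofinite. q (?Q t) \<noteq> 0"
      by (rule family_generic(1)[OF q]) (rule one)+
    with scaled_family_chart[OF Q]
    have "\<forall>\<^sub>F t in cofinite. coord (flip_word u (?Q t)) i = coord (?Q t) i"
      by eventually_elim (simp add: fixed)
    moreover have "leading (\<lambda>t. coord (?Q t) i) (nat (i + 1)) (s powi ((x - i) div int n))"
      using Q i by (simp add: scaled_family_def)
    ultimately have "leading (\<lambda>t. coord (flip_word u (?Q t)) i) (nat (i + 1)) (s powi ((x - i) div int n))"
      by (rule leading_cong[rotated])
    moreover have "leading (\<lambda>t. coord (flip_word u (?Q t)) i) (nat (i + 1)) (s powi ((?y - i) div int n))"
      using scaled_family_word[OF Q u] i by (simp add: scaled_family_def)
    ultimately show ?thesis using leading_unique[OF infinite] by blast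
  qed
  have powi_inj: "a = b" if ab: "\<And>s :: 'k. s \<noteq> 0 \<Longrightarrow> s powi a = s powi b" for a b
  proof (rule ccontr)
    assume "a \<noteq> b"
    define d where "d = nat \<bar>a - b\<bar>"
    have "d > 0" using \<open>a \<noteq> b\<close> by (simp add: d_def)
    then obtain s :: 'k where s: "s \<noteq> 0" "s ^ d \<noteq> 1" using exists_non_root_of_unity by blast
    have "s powi (a - b) = 1" "s powi (b - a) = 1" using ab[OF s(1)] s by (simp_all add: power_int_diff)
    then have "s powi \<bar>a - b\<bar> = 1" by (cases "a \<ge> b") auto
    then show False using s by (simp add: d_def power_int_def)
  qed
  have "?y = x" by (rule div_window_inj, rule powi_inj, rule *)
  then show "?y = id x" by simp
qed

section \<open>The group of flips\<close>

lemma germ_eq_iff: "germ \<iota> n f = germ \<iota> n g \<longleftrightarrow> (\<forall>\<^sub>F P in generic \<iota> n. f P = g P)"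
proof
  assume "germ \<iota> n f = germ \<iota> n g"
  then have "f \<in> germ \<iota> n g" by (auto simp: germ_def)
  then show "\<forall>\<^sub>F P in generic \<iota> n. f P = g P" by (simp add: germ_def)
next
  assume fg: "\<forall>\<^sub>F P in generic \<iota> n. f P = g P"
  have "(\<forall>\<^sub>F P in generic \<iota> n. h P = f P) \<longleftrightarrow> (\<forall>\<^sub>F P in generic \<iota> n. h P = g P)" for h
    using eventually_elim2[OF _ fg, of "\<lambda>P. h P = f P" "\<lambda>P. h P = g P"]
      eventually_elim2[OF _ fg, of "\<lambda>P. h P = g P" "\<lambda>P. h P = f P"] by auto
  then show "germ \<iota> n f = germ \<iota> n g" by (simp add: germ_def)
qed

lemma germ_mult:
  assumes g: "filterlim g (generic \<iota> n) (generic \<iota> n)"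
  shows "germ \<iota> n f \<otimes>\<^bsub>birational_group \<iota> n\<^esub> germ \<iota> n g = germ \<iota> n (f \<circ> g)"
proof (intro equalityI subsetI)
  fix h assume "h \<in> germ \<iota> n f \<otimes>\<^bsub>birational_group \<iota> n\<^esub> germ \<iota> n g"
  then obtain f' g' where f': "\<forall>\<^sub>F P in generic \<iota> n. f' P = f P" and g': "\<forall>\<^sub>F P in generic \<iota> n. g' P = g P"
    and h: "\<forall>\<^sub>F P in generic \<iota> n. h P = f' (g' P)" by (auto simp: birational_group_def germ_def)
  have "\<forall>\<^sub>F P in generic \<iota> n. f' (g P) = f (g P)" using g f' unfolding filterlim_iff by blast
  with g' h have "\<forall>\<^sub>F P in generic \<iota> n. h P = (f \<circ> g) P" by eventually_elim simp
  then show "h \<in> germ \<iota> n (f \<circ> g)" by (simp add: germ_def)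
next
  fix h assume "h \<in> germ \<iota> n (f \<circ> g)"
  then have "\<forall>\<^sub>F P in generic \<iota> n. h P = (f \<circ> g) P" by (simp add: germ_def)
  moreover have "f \<in> germ \<iota> n f" "g \<in> germ \<iota> n g" by (simp_all add: germ_def)
  ultimately show "h \<in> germ \<iota> n f \<otimes>\<^bsub>birational_group \<iota> n\<^esub> germ \<iota> n g"
    unfolding birational_group_def by (simp only: monoid.simps mem_Collect_eq) blast
qed

lemma germ_flip_word_append:
  "germ \<iota> n (flip_word (u @ v)) = germ \<iota> n (flip_word u) \<otimes>\<^bsub>birational_group \<iota> n\<^esub> germ \<iota> n (flip_word v)"
  by (simp only: word_map_append germ_mult[OF filterlim_flip_word])

lemma one_birational_group: "\<one>\<^bsub>birational_group \<iota> n\<^esub> = germ \<iota> n (flip_word [])"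
  unfolding birational_group_def word_map_Nil by (simp only: monoid.simps)

lemma germ_flip_in_carrier:
  "j \<in> {1..int n} \<Longrightarrow> germ \<iota> n (flip n j) \<in> carrier (birational_group \<iota> n)"
  using birational_map_flip by (auto simp: birational_group_def)

text \<open>The inverse is a definite description; its uniqueness is cancellation of germs.\<close>

lemma inv_germ_flip:
  assumes j: "j \<in> {1..int n}"
  shows "inv\<^bsub>birational_group \<iota> n\<^esub> germ \<iota> n (flip n j) = germ \<iota> n (flip n j)"
  unfolding m_inv_def
proof (rule the_equality)
  let ?G = "birational_group \<iota> n" and ?x = "germ \<iota> n (flip n j)"
  have "flip n j \<circ> flip n j = (id :: 'k polygon \<Rightarrow> _)" by (auto simp: flip_involution[OF n])
  then have xx: "?x \<otimes>\<^bsub>?G\<^esub> ?x = \<one>\<^bsub>?G\<^esub>"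
    using germ_mult[OF filterlim_flip, of "flip n j" j] by (simp add: birational_group_def)
  then show "?x \<in> carrier ?G \<and> ?x \<otimes>\<^bsub>?G\<^esub> ?x = \<one>\<^bsub>?G\<^esub> \<and> ?x \<otimes>\<^bsub>?G\<^esub> ?x = \<one>\<^bsub>?G\<^esub>"
    using germ_flip_in_carrier[OF j] by simp
  fix y assume y: "y \<in> carrier ?G \<and> ?x \<otimes>\<^bsub>?G\<^esub> y = \<one>\<^bsub>?G\<^esub> \<and> y \<otimes>\<^bsub>?G\<^esub> ?x = \<one>\<^bsub>?G\<^esub>"
  then obtain g where g: "y = germ \<iota> n g" "birational_map \<iota> n g" by (auto simp: birational_group_def)
  then have "filterlim g (generic \<iota> n) (generic \<iota> n)"
    by (simp add: birational_map_def dominant_map_def)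
  from germ_mult[OF this, of "flip n j"] y g(1)
  have "germ \<iota> n (flip n j \<circ> g) = germ \<iota> n id" by (simp add: birational_group_def)
  then have "\<forall>\<^sub>F P in generic \<iota> n. flip n j (g P) = P" by (simp add: germ_eq_iff)
  then have "\<forall>\<^sub>F P in generic \<iota> n. g P = flip n j P"
    by eventually_elim (metis flip_involution[OF n])
  then show "y = ?x" by (simp add: g(1) germ_eq_iff)
qed

lemma carrier_flip_group: "carrier (flip_group \<iota> n) = (\<lambda>u. germ \<iota> n (flip_word u)) ` flip_words n"
proof -
  let ?G = "birational_group \<iota> n" and ?S = "(\<lambda>j. germ \<iota> n (flip n j)) ` {1..int n}"
  have S: "carrier ?G \<inter> ?S = ?S" using germ_flip_in_carrier by auto
  have "generate ?G ?S = (\<lambda>u. germ \<iota> n (flip_word u)) ` flip_words n"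
  proof (intro equalityI subsetI)
    fix x assume "x \<in> generate ?G ?S"
    then show "x \<in> (\<lambda>u. germ \<iota> n (flip_word u)) ` flip_words n"
    proof induction
      case one
      show ?case by (rule image_eqI[of _ _ "[]"]) (simp_all only: one_birational_group lists.Nil)
    next
      case (incl h)
      then obtain j where j: "j \<in> {1..int n}" "h = germ \<iota> n (flip n j)" by auto
      then show ?case by (intro image_eqI[of _ _ "[(j, True)]"]) simp_all
    next
      case (inv h)
      then obtain j where j: "j \<in> {1..int n}" "h = germ \<iota> n (flip n j)" by auto
      then show ?case by (intro image_eqI[of _ _ "[(j, True)]"]) (simp_all add: inv_germ_flip)
    next
      case (eng g h)
      then obtain u v where "u \<in> flip_words n" "v \<in> flip_words n"
        "g = germ \<iota> n (flip_word u)" "h = germ \<iota> n (flip_word v)" by auto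
      then show ?case by (intro image_eqI[of _ _ "u @ v"]) (simp_all only: germ_flip_word_append append_in_lists_conv)
    qed
  next
    fix x assume "x \<in> (\<lambda>u. germ \<iota> n (flip_word u)) ` flip_words n"
    then obtain u where u: "u \<in> flip_words n" "x = germ \<iota> n (flip_word u)" by auto
    have "germ \<iota> n (flip_word u) \<in> generate ?G ?S"
      using u(1)
    proof (induction u)
      case Nil
      then show ?case using generate.one[of ?G ?S] by (simp only: one_birational_group)
    next
      case (Cons l u)
      obtain j b where l: "l = (j, b)" by fastforce
      have "germ \<iota> n (flip n j) \<in> generate ?G ?S" by (rule generate.incl) (use Cons l in auto)
      then have "germ \<iota> n (flip_word [l]) \<otimes>\<^bsub>?G\<^esub> germ \<iota> n (flip_word u) \<in> generate ?G ?S"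
        using Cons l by (intro generate.eng) simp_all
      then show ?case
        using germ_flip_word_append[of "[l]" u] by (simp only: append_Cons append_Nil)
    qed
    with u show "x \<in> generate ?G ?S" by simp
  qed
  then show ?thesis
    by (simp add: flip_group_def subgroup_generated_def S)
qed

lemma mult_flip_group: "mult (flip_group \<iota> n) = mult (birational_group \<iota> n)"
  by (simp add: flip_group_def subgroup_generated_def)

lemma germ_flip_word_eq_iff:
  assumes u: "u \<in> flip_words n" and v: "v \<in> flip_words n"
  shows "germ \<iota> n (flip_word u) = germ \<iota> n (flip_word v) \<longleftrightarrow> flip_equiv n u v"
    and "germ \<iota> n (flip_word u) = germ \<iota> n (flip_word v) \<longleftrightarrow> word_perm n u = word_perm n v"
proof -
  have 1: "word_perm n u = word_perm n v" if "germ \<iota> n (flip_word u) = germ \<iota> n (flip_word v)"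
  proof -
    have "flip n g \<circ> flip n g = (id :: 'k polygon \<Rightarrow> _)" for g by (auto simp: flip_involution[OF n])
    then have inv: "flip_word (rev u) (flip_word u P) = P" for P
      using word_map_rev[of "flip n" u] by (metis comp_apply id_apply)
    have "\<forall>\<^sub>F P in generic \<iota> n. flip_word u P = flip_word v P" using that by (simp add: germ_eq_iff)
    then have "\<forall>\<^sub>F P in generic \<iota> n. flip_word (rev u @ v) P = P"
      by eventually_elim (metis inv word_map_append comp_apply)
    moreover have "rev u @ v \<in> flip_words n" using u v by (auto simp: in_lists_conv_set)
    ultimately have "word_perm n (rev u @ v) = id" using flip_word_faithful by blast
    moreover have "word_perm n (u @ rev u) = id"
      using word_perm_invariant[OF n flip_equiv_rev[OF u]] by simp
    ultimately show ?thesis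
      by (metis comp_id id_comp o_assoc word_map_append)
  qed
  have 2: "flip_equiv n u v" if "word_perm n u = word_perm n v"
    using flip_equiv_of_word_perm_eq[OF n u v that] .
  have 3: "germ \<iota> n (flip_word u) = germ \<iota> n (flip_word v)" if "flip_equiv n u v"
    using flip_word_invariant[OF that] by (simp add: germ_eq_iff)
  show "germ \<iota> n (flip_word u) = germ \<iota> n (flip_word v) \<longleftrightarrow> flip_equiv n u v"
    "germ \<iota> n (flip_word u) = germ \<iota> n (flip_word v) \<longleftrightarrow> word_perm n u = word_perm n v"
    using 1 2 3 by blast+
qed

lemma flip_group_has_presentation:
  "has_presentation (flip_group \<iota> n) (\<lambda>j. germ \<iota> n (flip n j)) {1..int n} (flip_relations n)"
proof (rule has_presentationI)
  show "carrier (flip_group \<iota> n) = (\<lambda>u. germ \<iota> n (flip_word u)) ` flip_words n"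
    by (rule carrier_flip_group)
  show "germ \<iota> n (flip_word (u @ v)) =
      germ \<iota> n (flip_word u) \<otimes>\<^bsub>flip_group \<iota> n\<^esub> germ \<iota> n (flip_word v)" for u v
    unfolding mult_flip_group by (rule germ_flip_word_append)
  show "germ \<iota> n (flip_word u) = germ \<iota> n (flip_word v) \<longleftrightarrow> flip_equiv n u v"
    if "u \<in> flip_words n" "v \<in> flip_words n" for u v
    using that by (rule germ_flip_word_eq_iff)
qed simp

lemma flip_group_iso_affine: "flip_group \<iota> n \<cong> affine_symmetric_group n"
proof -
  have "carrier (affine_symmetric_group n) = word_perm n ` flip_words n"
    using word_perm_surj[of n] word_perm_in_affine[of n] n by auto
  then have "\<exists>f \<in> iso (flip_group \<iota> n) (affine_symmetric_group n).
      \<forall>u \<in> flip_words n. f (germ \<iota> n (flip_word u)) = word_perm n u"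
  proof (rule iso_of_evaluations[OF carrier_flip_group])
    fix u v :: "int word"
    show "germ \<iota> n (flip_word (u @ v)) =
        germ \<iota> n (flip_word u) \<otimes>\<^bsub>flip_group \<iota> n\<^esub> germ \<iota> n (flip_word v)"
      unfolding mult_flip_group by (rule germ_flip_word_append)
    show "word_perm n (u @ v) = word_perm n u \<otimes>\<^bsub>affine_symmetric_group n\<^esub> word_perm n v"
      by (simp add: word_map_append affine_symmetric_group_def)
  qed (rule germ_flip_word_eq_iff(2))
  then show ?thesis unfolding is_iso_def by blast
qed

end

theorem theorem6p4:
  fixes \<iota> :: "'f::field \<Rightarrow> 'k::field" and n :: nat
  assumes "n \<ge> 3" and "field_embedding \<iota>" and "infinite (UNIV :: 'k set)"
  shows "has_presentation (flip_group \<iota> n) (\<lambda>j. germ \<iota> n (flip n j)) {1..int n} (flip_relations n) \<and>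
         flip_group \<iota> n \<cong> affine_symmetric_group n"
proof -
  interpret flip_space \<iota> n using assms by unfold_locales
  show ?thesis using flip_group_has_presentation flip_group_iso_affine by blast
qed

end
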